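(* Let $\Delta$ be a graph on $[n]$ (a simplicial complex all of whose facets have dimension $0$ or $1$) and let $d=(2,2,\dots,2)$. Then the marginal polytope $P_\Delta$ is compressed if and only if $\Delta$ has no $K_4$ minor and every induced cycle in $\Delta$ has length at most $4$.
   Context: For a pair $(\Delta,d)$: tables are indexed by cells $\iota\in[d_1]\times\cdots\times[d_n]$; for each facet $T$ of $\Delta$ and $j\in\prod_{t\in T}[d_t]$ the $(T,j)$ marginal of $\mathbf{x}$ is $\sum_{\iota:\iota_T=j}x_\iota$; $A_\Delta$ is the $0/1$ matrix computing all these marginals and the marginal polytope $P_\Delta$ is the convex hull of its columns. A cycle is induced if it has no chord. Compressed is with respect to the smallest lattice $\mathcal{L}$ containing the columns: every pulling triangulation using the points of $P_\Delta\cap\mathcal{L}$ (recursively: cone from the first point over pulling triangulations, with induced ordering, of the facets not containing it) is unimodular, i.e. each simplex has minimal volume among simplices spanned by lattice points of $P_\Delta$. *)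

theory Defs
  imports "HOL-Analysis.Analysis" "HOL-Computational_Algebra.Group_Closure"
begin

section \<open>Simplicial complexes and graphs\<close>

definition simplicial_complex_on :: "'v set \<Rightarrow> 'v set set \<Rightarrow> bool" where
  "simplicial_complex_on V \<Delta> \<longleftrightarrow>
     (\<forall>S\<in>\<Delta>. finite S \<and> S \<subseteq> V) \<and> (\<forall>S\<in>\<Delta>. \<forall>T. T \<subseteq> S \<longrightarrow> T \<in> \<Delta>) \<and> (\<forall>v\<in>V. {v} \<in> \<Delta>)"

definition sc_facets :: "'v set set \<Rightarrow> 'v set set" where
  "sc_facets \<Delta> = {T \<in> \<Delta>. \<forall>S\<in>\<Delta>. T \<subseteq> S \<longrightarrow> S = T}"

definition face_dim :: "'v set \<Rightarrow> int" where
  "face_dim T = int (card T) - 1"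

definition graph_on :: "'v set \<Rightarrow> 'v set set \<Rightarrow> bool" where
  "graph_on V \<Delta> \<longleftrightarrow>
     simplicial_complex_on V \<Delta> \<and> (\<forall>T\<in>sc_facets \<Delta>. face_dim T = 0 \<or> face_dim T = 1)"

definition sc_edges :: "'v set set \<Rightarrow> 'v set set" where
  "sc_edges \<Delta> = {e \<in> \<Delta>. card e = 2}"

definition connected_in :: "'v set set \<Rightarrow> 'v set \<Rightarrow> bool" where
  "connected_in E B \<longleftrightarrow>
     B \<noteq> {} \<and> (\<forall>u\<in>B. \<forall>v\<in>B. (u, v) \<in> {(x, y). x \<in> B \<and> y \<in> B \<and> {x, y} \<in> E}\<^sup>*)"

text \<open>The graph with vertex set \<open>W\<close> and edge set \<open>F\<close> is a minor of the graph with vertex set \<open>V\<close>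
  and edge set \<open>E\<close>: contracting the connected, pairwise disjoint branch sets \<open>B w\<close> and deleting
  the superfluous vertices and edges leaves \<open>(W, F)\<close>.\<close>

definition has_minor :: "'v set \<Rightarrow> 'v set set \<Rightarrow> 'w set \<Rightarrow> 'w set set \<Rightarrow> bool" where
  "has_minor V E W F \<longleftrightarrow>
     (\<exists>B. (\<forall>w\<in>W. B w \<subseteq> V \<and> connected_in E (B w)) \<and> disjoint_family_on B W \<and>
          (\<forall>w w'. {w, w'} \<in> F \<longrightarrow> (\<exists>x\<in>B w. \<exists>y\<in>B w'. {x, y} \<in> E)))"

definition complete_edges :: "'w set \<Rightarrow> 'w set set" where
  "complete_edges W = {e. e \<subseteq> W \<and> card e = 2}"

definition has_K4_minor :: "'v set set \<Rightarrow> bool" where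
  "has_K4_minor \<Delta> \<longleftrightarrow> has_minor (\<Union>\<Delta>) (sc_edges \<Delta>) {0..<4::nat} (complete_edges {0..<4})"

definition graph_cycle :: "'v set set \<Rightarrow> 'v list \<Rightarrow> bool" where
  "graph_cycle E vs \<longleftrightarrow>
     3 \<le> length vs \<and> distinct vs \<and>
     (\<forall>i<length vs. {vs ! i, vs ! (Suc i mod length vs)} \<in> E)"

definition cycle_has_chord :: "'v set set \<Rightarrow> 'v list \<Rightarrow> bool" where
  "cycle_has_chord E vs \<longleftrightarrow>
     (\<exists>i<length vs. \<exists>j<length vs. {vs ! i, vs ! j} \<in> E \<and>
        j \<noteq> Suc i mod length vs \<and> i \<noteq> Suc j mod length vs)"

definition induced_cycle :: "'v set set \<Rightarrow> 'v list \<Rightarrow> bool" where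
  "induced_cycle \<Delta> vs \<longleftrightarrow>
     graph_cycle (sc_edges \<Delta>) vs \<and> \<not> cycle_has_chord (sc_edges \<Delta>) vs"


section \<open>Marginal polytopes\<close>

text \<open>The set \<open>d v\<close> of levels of the \<open>v\<close>-th factor plays the role of \<open>[d\<^sub>v]\<close>.\<close>

definition cells :: "('n \<Rightarrow> 'k set) \<Rightarrow> ('n \<Rightarrow> 'k) set" where
  "cells d = (\<Pi>\<^sub>E v\<in>UNIV. d v)"

definition marginal ::
    "('n::finite \<Rightarrow> 'k::finite set) \<Rightarrow> 'n set \<Rightarrow> ('n \<Rightarrow> 'k) \<Rightarrow> (('n \<Rightarrow> 'k) \<Rightarrow> real) \<Rightarrow> real" where
  "marginal d T j x = (\<Sum>\<iota> | \<iota> \<in> cells d \<and> restrict \<iota> T = j. x \<iota>)"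

definition marginal_rows :: "'n set set \<Rightarrow> ('n \<Rightarrow> 'k set) \<Rightarrow> ('n set \<times> ('n \<Rightarrow> 'k)) set" where
  "marginal_rows \<Delta> d = (SIGMA T : sc_facets \<Delta>. \<Pi>\<^sub>E t\<in>T. d t)"

text \<open>To stay inside a fixed finite-dimensional type, the rows and columns of the matrix are
  indexed by all of \<open>'n set \<times> ('n \<Rightarrow> 'k)\<close> and \<open>'n \<Rightarrow> 'k\<close>. Rows outside \<open>marginal_rows \<Delta> d\<close> vanish,
  so the polytope below lies in the coordinate subspace spanned by the genuine rows; columns
  outside \<open>cells d\<close> are discarded.\<close>

definition marginal_matrix ::
    "'n::finite set set \<Rightarrow> ('n \<Rightarrow> 'k::finite set) \<Rightarrow> real ^ ('n \<Rightarrow> 'k) ^ ('n set \<times> ('n \<Rightarrow> 'k))" where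
  "marginal_matrix \<Delta> d =
     (\<chi> r \<iota>. if r \<in> marginal_rows \<Delta> d \<and> \<iota> \<in> cells d \<and> restrict \<iota> (fst r) = snd r then 1 else 0)"

lemma marginal_matrix_mult:
  "(marginal_matrix \<Delta> d *v x) $ (T, j) =
     (if (T, j) \<in> marginal_rows \<Delta> d then marginal d T j (($) x) else 0)"
proof -
  have "(marginal_matrix \<Delta> d *v x) $ (T, j) =
      (\<Sum>\<iota>\<in>UNIV. if (T, j) \<in> marginal_rows \<Delta> d \<and> \<iota> \<in> cells d \<and> restrict \<iota> T = j then x $ \<iota> else 0)"
    unfolding marginal_matrix_def matrix_vector_mult_def by (simp add: if_distrib[of "\<lambda>c. c * _"] cong: if_cong)
  also have "\<dots> = (\<Sum>\<iota> | (T, j) \<in> marginal_rows \<Delta> d \<and> \<iota> \<in> cells d \<and> restrict \<iota> T = j. x $ \<iota>)"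
    by (subst sum.If_cases) simp_all
  finally show ?thesis by (simp add: marginal_def)
qed

definition marginal_columns ::
    "'n::finite set set \<Rightarrow> ('n \<Rightarrow> 'k::finite set) \<Rightarrow> (real ^ ('n set \<times> ('n \<Rightarrow> 'k))) set" where
  "marginal_columns \<Delta> d = (\<lambda>\<iota>. column \<iota> (marginal_matrix \<Delta> d)) ` cells d"

definition marginal_polytope ::
    "'n::finite set set \<Rightarrow> ('n \<Rightarrow> 'k::finite set) \<Rightarrow> (real ^ ('n set \<times> ('n \<Rightarrow> 'k))) set" where
  "marginal_polytope \<Delta> d = convex hull (marginal_columns \<Delta> d)"

text \<open>The columns are integral, so the additive group they generate is discrete, i.e. it is the
  smallest lattice containing them.\<close>

definition marginal_lattice ::
    "'n::finite set set \<Rightarrow> ('n \<Rightarrow> 'k::finite set) \<Rightarrow> (real ^ ('n set \<times> ('n \<Rightarrow> 'k))) set" where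
  "marginal_lattice \<Delta> d = group_closure (marginal_columns \<Delta> d)"


section \<open>Pulling triangulations and compressed polytopes\<close>

text \<open>Maximal simplices, given by their vertex sets, of the pulling triangulation of the point
  configuration \<open>set xs\<close>, ordered as in \<open>xs\<close>. Filtering \<open>xs\<close> yields the induced ordering on the
  points of a facet, and the convex hull of these points is again that facet.\<close>

function pulling_triangulation :: "'a::euclidean_space list \<Rightarrow> 'a set set" where
  "pulling_triangulation xs =
     (if \<not> affine_dependent (set xs) then {set xs}
      else \<Union>F\<in>{F. F facet_of convex hull (set xs) \<and> hd xs \<notin> F}.
             insert (hd xs) ` pulling_triangulation (filter (\<lambda>x. x \<in> F) xs))"
  by auto
termination
proof (relation "Wellfounded.measure length")
  fix xs :: "'a list" and F
  assume "\<not> \<not> affine_dependent (set xs)"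
    and "F \<in> {F. F facet_of convex hull (set xs) \<and> hd xs \<notin> F}"
  then have "xs \<noteq> []" "hd xs \<notin> F" by auto
  then show "(filter (\<lambda>x. x \<in> F) xs, xs) \<in> Wellfounded.measure length"
    using length_filter_less[of "hd xs" xs "\<lambda>x. x \<in> F"] by simp
qed simp

declare pulling_triangulation.simps [simp del]

text \<open>The \<open>k\<close>-dimensional volume of a \<open>k\<close>-dimensional set \<open>S\<close>, where \<open>k = aff_dim S\<close>: the product of
  \<open>S\<close> with the unit ball of the orthogonal complement of its direction space has as Lebesgue
  measure this volume times the volume of the \<open>(DIM('a) - k)\<close>-dimensional unit ball.\<close>

definition rel_volume :: "'a::euclidean_space set \<Rightarrow> real" where
  "rel_volume S =
     measure lebesgue {x + w | x w. x \<in> S \<and> (\<forall>y\<in>S. \<forall>z\<in>S. w \<bullet> (y - z) = 0) \<and> norm w \<le> 1}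
       / unit_ball_vol (real DIM('a) - real_of_int (aff_dim S))"

definition unimodular_simplex ::
    "'a::euclidean_space set \<Rightarrow> 'a set \<Rightarrow> 'a set \<Rightarrow> bool" where
  "unimodular_simplex L P \<sigma> \<longleftrightarrow>
     (\<forall>C. C \<subseteq> P \<inter> L \<and> \<not> affine_dependent C \<and> aff_dim C = aff_dim P \<longrightarrow>
        rel_volume (convex hull \<sigma>) \<le> rel_volume (convex hull C))"

definition compressed :: "'a::euclidean_space set \<Rightarrow> 'a set \<Rightarrow> bool" where
  "compressed L P \<longleftrightarrow>
     (\<forall>xs. distinct xs \<and> set xs = P \<inter> L \<longrightarrow>
        (\<forall>\<sigma>\<in>pulling_triangulation xs. unimodular_simplex L P \<sigma>))"

text \<open>In a full-dimensional ambient space, \<open>rel_volume\<close> is the Lebesgue measure.\<close>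

lemma rel_volume_full_dim:
  fixes S :: "'a::euclidean_space set"
  assumes "aff_dim S = int DIM('a)"
  shows "rel_volume S = measure lebesgue S"
proof -
  have w0: "w = 0" if w: "\<forall>y\<in>S. \<forall>z\<in>S. w \<bullet> (y - z) = 0" for w
  proof (rule ccontr)
    assume "w \<noteq> 0"
    have "S \<noteq> {}" using assms by auto
    then obtain a where a: "a \<in> S" by blast
    have "w \<bullet> x = w \<bullet> a" if "x \<in> S" for x
      using w[rule_format, OF that a] by (simp add: inner_diff_right)
    then have "S \<subseteq> {x. w \<bullet> x = w \<bullet> a}" by blast
    then have "aff_dim S \<le> aff_dim {x. w \<bullet> x = w \<bullet> a}" by (rule aff_dim_subset)
    then show False using \<open>w \<noteq> 0\<close> assms by (simp add: aff_dim_hyperplane)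
  qed
  have "{x + w | x w. x \<in> S \<and> (\<forall>y\<in>S. \<forall>z\<in>S. w \<bullet> (y - z) = 0) \<and> norm w \<le> 1} = S"
  proof (intro equalityI subsetI)
    fix u assume "u \<in> S"
    then show "u \<in> {x + w | x w. x \<in> S \<and> (\<forall>y\<in>S. \<forall>z\<in>S. w \<bullet> (y - z) = 0) \<and> norm w \<le> 1}"
      by (intro CollectI exI[of _ u] exI[of _ 0]) simp
  next
    fix u assume "u \<in> {x + w | x w. x \<in> S \<and> (\<forall>y\<in>S. \<forall>z\<in>S. w \<bullet> (y - z) = 0) \<and> norm w \<le> 1}"
    then obtain x w where "u = x + w" "x \<in> S" "\<forall>y\<in>S. \<forall>z\<in>S. w \<bullet> (y - z) = 0" by blast
    then show "u \<in> S" using w0[of w] by simp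
  qed
  then show ?thesis using assms by (simp add: rel_volume_def unit_ball_vol_def)
qed

text \<open>The orderings quantified over in \<open>compressed\<close> exist, as there are finitely many lattice
  points.\<close>

lemma finite_marginal_lattice_points:
  fixes \<Delta> :: "'n::finite set set" and d :: "'n \<Rightarrow> 'k::finite set"
  shows "finite (marginal_polytope \<Delta> d \<inter> marginal_lattice \<Delta> d)"
proof -
  have cols: "c $ r \<in> {0, 1}" if "c \<in> marginal_columns \<Delta> d" for c r
    using that by (auto simp: marginal_columns_def column_def marginal_matrix_def)
  have int: "x $ r \<in> \<int>" if "x \<in> marginal_lattice \<Delta> d" for x r
    using that unfolding marginal_lattice_def
  proof (induction rule: group_closure.induct)
    case (base s)
    then show ?case using cols[of s r] by auto
  qed simp
  have box: "marginal_polytope \<Delta> d \<subseteq> cbox 0 1"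
    unfolding marginal_polytope_def
  proof (rule hull_minimal)
    show "marginal_columns \<Delta> d \<subseteq> cbox 0 1"
    proof
      fix c assume "c \<in> marginal_columns \<Delta> d"
      then have "0 \<le> c $ r \<and> c $ r \<le> 1" for r using cols[of c r] by auto
      then show "c \<in> cbox 0 1" by (simp add: mem_box_cart)
    qed
  qed simp
  have *: "x $ r \<in> {0, 1}"
    if x: "x \<in> marginal_polytope \<Delta> d \<inter> marginal_lattice \<Delta> d" for x r
  proof -
    have "0 \<le> x $ r" "x $ r \<le> 1"
      using subsetD[OF box, of x] that unfolding mem_box_cart by (cases r; simp)+
    moreover obtain k where "x $ r = of_int k"
      using x int[of x r] by (auto elim: Ints_cases)
    ultimately show ?thesis by auto
  qed
  have "marginal_polytope \<Delta> d \<inter> marginal_lattice \<Delta> d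
      \<subseteq> (\<lambda>f. \<chi> r. if f r then 1 else 0) ` UNIV"
  proof (intro subsetI image_eqI)
    fix x assume x: "x \<in> marginal_polytope \<Delta> d \<inter> marginal_lattice \<Delta> d"
    show "x = (\<chi> r. if x $ r = 1 then 1 else 0)"
      unfolding vec_eq_iff using *[OF x] by fastforce
  qed simp
  then show ?thesis by (rule finite_subset) simp
qed

end

theory Submission
  imports Defs
begin

text \<open>The columns of the marginal matrix are the vectors \<open>col \<iota>\<close> for \<open>\<iota> \<in> {0,1}\<^sup>n\<close>, and linear functionals
  on them are exactly the sums of functions of at most two adjacent coordinates of \<open>\<iota>\<close>.

  A polytope is compressed iff every facet functional takes only two values on the lattice points:
  coning a simplex of a facet with a point at larger distance from that facet gives a larger volume,
  and conversely, if all facets have width one, the vertices of each simplex of a pulling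
  triangulation generate the lattice, so that every lattice simplex is the image of it under an
  integral map of nonzero determinant.

  Necessity. A face of the polytope is an intersection of facets, hence of zero sets of two-valued
  functionals. A \<open>K\<^sub>4\<close> minor with branch sets \<open>B\<^sub>0,\<dots>,B\<^sub>3\<close> gives the face of cells that are constant on
  the branch sets and true on one or two of them; a pairwise function vanishing there satisfies
  \<open>h(1111) = 3 h(0000)\<close>. An induced cycle of length at least five gives the face of its cycle
  inequality; a function vanishing there satisfies \<open>h({1,3}) = 2 h({1})\<close>.

  Sufficiency. It suffices that a signed weight with nonnegative expectation for all
  \<open>0/1\<close>-valued pairwise functions has the same marginals as a probability distribution. A graph as in
  the theorem is a triangle or smaller, or splits along a vertex, an edge or the empty set, or is a
  complete bipartite graph \<open>K\<^sub>2\<^sub>,\<^sub>r\<close>. Distributions are glued along separators by conditional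
  independence; for \<open>K\<^sub>2\<^sub>,\<^sub>r\<close> one first chooses the joint distribution of the two centres, whose
  missing moment has to lie in an intersection of intervals, and the conditions that these intervals
  meet pairwise are \<open>0/1\<close>-valued inequalities.\<close>

section \<open>Volumes of simplices\<close>

text \<open>Why length four: around a cycle the number of edges with disagreeing ends is even, so
  the disagreements on all edges but one minus the disagreement on the last take only the values 0
  and 2 for length three or four, while length five also admits 4. Likewise the functional exposing
  the K4 face has value (s - 1)(s - 2)/2 on a cell that is true on s blocks: 0 or 1 for at most
  three blocks, 3 for four.

  Why 0/1-valued inequalities: such a functional is integral on the lattice and lies in [0,1] on the
  polytope, so a facet cut out by it has every other lattice point at level 1.

  The polytope lies in a proper affine subspace, so volumes are only ever compared between simplices
  with the same affine hull. Completing the edge vectors of both by one and the same basis of the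
  orthogonal complement turns the ratio of volumes into a ratio of determinants.\<close>

text \<open>Both sides are multiplicative under composition, so elementary maps suffice. The index
  type is an arbitrary finite one, because the rows of the marginal matrix are indexed by pairs of a
  set and a function, which carry no well-order.\<close>

lemma measure_linear_image_cart:
  fixes f :: "real^'n \<Rightarrow> real^'n"
  assumes "linear f" "S \<in> lmeasurable"
  shows "measure lebesgue (f ` S) = \<bar>det (matrix f)\<bar> * measure lebesgue S"
proof -
  have "\<forall>S\<in>lmeasurable. f ` S \<in> lmeasurable \<and>
      measure lebesgue (f ` S) = \<bar>det (matrix f)\<bar> * measure lebesgue S" (is "?P f")
    using assms(1)
  proof (rule induct_linear_elementary[where P = ?P])
    fix f g :: "real^'n \<Rightarrow> real^'n"
    assume fg: "linear f" "linear g" "?P f" "?P g"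
    have "matrix (f \<circ> g) = matrix f ** matrix g" using fg by (intro matrix_compose) auto
    then have dfg: "\<bar>det (matrix (f \<circ> g))\<bar> = \<bar>det (matrix f)\<bar> * \<bar>det (matrix g)\<bar>"
      by (simp only: det_mul abs_mult)
    show "?P (f \<circ> g)"
      unfolding dfg image_comp[symmetric] using fg(3,4) by (simp add: mult.assoc)
  next
    fix f :: "real^'n \<Rightarrow> real^'n" and i
    assume f: "linear f" "\<And>x. f x $ i = 0"
    have "\<not> surj f"
    proof
      assume "surj f"
      then obtain x where "axis i 1 = f x" by (rule surjE)
      then have "axis i (1::real) $ i = 0" using f(2)[of x] by simp
      then show False by (simp add: axis_def)
    qed
    then have ninj: "\<not> inj f" using f(1) linear_injective_imp_surjective by blast
    then have "det (matrix f) = 0" using det_nz_iff_inj[OF f(1)] by blast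
    moreover have "negligible (f ` S)" for S
      using negligible_linear_singular_image[OF f(1) ninj] .
    ultimately show "?P f"
      by (simp add: negligible_imp_measurable negligible_imp_measure0)
  next
    fix c :: "'n \<Rightarrow> real"
    have "det (matrix (\<lambda>x. \<chi> i. c i * x $ i)) = prod c UNIV"
      by (subst det_diagonal) (auto simp: matrix_def axis_def)
    then show "?P (\<lambda>x. \<chi> i. c i * x $ i)"
      by (simp add: measurable_stretch measure_stretch)
  next
    fix m n :: 'n assume "m \<noteq> n"
    define t where "t = Transposition.transpose m n"
    let ?h = "\<lambda>x::real^'n. \<chi> i. x $ t i"
    have t: "t permutes UNIV" "t (t i) = i" for i
      unfolding t_def by (auto intro: permutes_swap_id)
    have lin: "linear ?h" by (rule linearI) (simp_all add: vec_eq_iff)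
    have box: "?h ` cbox a b = cbox (?h a) (?h b)" for a b
    proof (intro equalityI subsetI)
      fix y assume "y \<in> cbox (?h a) (?h b)"
      then have y: "a $ t i \<le> y $ i \<and> y $ i \<le> b $ t i" for i by (auto simp: mem_box_cart)
      have "?h y \<in> cbox a b" unfolding mem_box_cart using y[of "t _"] t(2) by (metis vec_lambda_beta)
      moreover have "y = ?h (?h y)" by (simp add: vec_eq_iff t(2))
      ultimately show "y \<in> ?h ` cbox a b" by (rule rev_image_eqI)
    qed (auto simp: mem_box_cart)
    have "measure lebesgue (?h ` cbox a b) = 1 * measure lebesgue (cbox a b)" for a b
    proof (cases "cbox a b = {}")
      case False
      then have "cbox (?h a) (?h b) \<noteq> {}" using box[of a b] by (metis image_is_empty)
      then have "measure lebesgue (?h ` cbox a b) = (\<Prod>i\<in>UNIV. b $ t i - a $ t i)"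
        unfolding box by (simp add: content_cbox_cart)
      also have "\<dots> = (\<Prod>i\<in>UNIV. b $ i - a $ i)"
        using prod.permute[OF t(1), of "\<lambda>i. b $ i - a $ i"] by (simp add: o_def)
      finally show ?thesis using False by (simp add: content_cbox_cart)
    qed simp
    then have meas: "?h ` S \<in> lmeasurable \<and> measure lebesgue (?h ` S) = 1 * measure lebesgue S"
      if "S \<in> lmeasurable" for S
      using measure_linear_sufficient[OF lin that, of 1] by simp
    have "matrix ?h = (\<chi> i. mat 1 $ t i)"
      by (simp add: matrix_def mat_def axis_def vec_eq_iff)
    then have det1: "\<bar>det (matrix ?h)\<bar> = 1"
      using det_permute_rows[OF t(1), of "mat 1 :: real^'n^'n"] by (simp add: abs_mult sign_def)
    show "?P (\<lambda>x. \<chi> i. x $ Transposition.transpose m n i)"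
      unfolding t_def[symmetric] det1 using meas by blast
  next
    fix m n :: 'n assume mn: "m \<noteq> n"
    let ?h = "\<lambda>x::real^'n. \<chi> i. if i = m then x $ m + x $ n else x $ i"
    have lin: "linear ?h" by (rule linearI) (auto simp: vec_eq_iff algebra_simps)
    have "measure lebesgue (?h ` cbox a b) = 1 * measure lebesgue (cbox a b)" for a b
    proof (cases "cbox a b = {}")
      case False
      \<comment> \<open>The shear formula wants a box whose lower bound in coordinate
        \<open>n\<close> is nonnegative; translating by \<open>c\<close> makes that bound
        zero.\<close>
      define c where "c = axis n (a $ n)"
      have cb: "cbox a b = (+) c ` cbox (a - c) (b - c)"
        using cbox_translation[of c "a - c" "b - c"] by simp
      have "?h ` cbox a b = (+) (?h c) ` (?h ` cbox (a - c) (b - c))"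
        unfolding cb image_image by (intro image_cong refl linear_add[OF lin])
      then have "measure lebesgue (?h ` cbox a b) = measure lebesgue (?h ` cbox (a - c) (b - c))"
        by (simp only: measure_translation)
      also have "\<dots> = measure lebesgue (cbox (a - c) (b - c))"
        using False cb by (intro measure_shear_interval[OF mn]) (auto simp: c_def axis_def)
      finally show ?thesis using cb measure_translation[of c] by simp
    qed simp
    then have meas: "?h ` S \<in> lmeasurable \<and> measure lebesgue (?h ` S) = 1 * measure lebesgue S"
      if "S \<in> lmeasurable" for S
      using measure_linear_sufficient[OF lin that, of 1] by simp
    let ?one = "mat 1 :: real^'n^'n"
    have rows: "row i ?one = axis i 1" for i by (simp add: row_def mat_def axis_def vec_eq_iff)
    have "matrix ?h = (\<chi> k. if k = m then row m ?one + axis n 1 else row k ?one)"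
      unfolding rows by (auto simp: matrix_def axis_def vec_eq_iff)
    moreover have "axis n 1 \<in> vec.span {row j ?one |j. j \<noteq> m}"
      unfolding rows using mn by (intro vec.span_base) blast
    ultimately have det1: "det (matrix ?h) = 1"
      using det_row_span[of "axis n 1" ?one m] by simp
    show "?P ?h" unfolding det1 abs_one using meas by blast
  qed
  then show ?thesis using assms(2) by blast
qed

section \<open>Volume of a simplex in coordinates adapted to its affine hull\<close>

text \<open>The thickened simplex measured by \<open>rel_volume\<close>, in the coordinates of a
  frame \<open>f\<close>: those in \<open>I\<close> run along the edges, the others along the
  orthogonal complement. Only the complement part of \<open>f\<close> enters, so simplices with a
  common complement frame share this body.\<close>

definition simplex_body :: "'m::finite set \<Rightarrow> ('m \<Rightarrow> real^'m) \<Rightarrow> (real^'m) set" where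
  "simplex_body I f = {x. (\<forall>i\<in>I. 0 \<le> x $ i) \<and> (\<Sum>i\<in>I. x $ i) \<le> 1 \<and> norm (\<Sum>j\<in>-I. x $ j *\<^sub>R f j) \<le> 1}"

definition frame_map :: "('m::finite \<Rightarrow> real^'m) \<Rightarrow> real^'m \<Rightarrow> real^'m" where
  "frame_map f x = (\<Sum>j\<in>UNIV. x $ j *\<^sub>R f j)"

lemma linear_frame_map: "linear (frame_map f)"
  by (rule linearI) (simp_all add: frame_map_def scaleR_add_left sum.distrib scaleR_sum_right)

lemma frame_map_axis: "frame_map f (axis j 1) = f j"
proof -
  have "frame_map f (axis j 1) = (\<Sum>i\<in>UNIV. if i = j then f i else 0)"
    unfolding frame_map_def by (rule sum.cong) (auto simp: axis_def)
  then show ?thesis by simp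
qed

lemma frame_map_split: "frame_map f x = (\<Sum>i\<in>I. x $ i *\<^sub>R f i) + (\<Sum>j\<in>-I. x $ j *\<^sub>R f j)"
  using sum.union_disjoint[of I "- I" "\<lambda>j. x $ j *\<^sub>R f j"] by (simp add: frame_map_def)

lemma det_matrix_frame_map: "det (matrix (frame_map f)) = det (\<chi> j. f j)"
proof -
  have "matrix (frame_map f) = transpose (\<chi> j. f j)"
    by (simp add: matrix_def frame_map_axis transpose_def vec_eq_iff)
  then show ?thesis by (simp add: det_transpose)
qed

lemma convex_hull_frame:
  "convex hull (insert s ((\<lambda>i. s + f i) ` I)) =
    (\<lambda>x. s + frame_map f x) ` {x. (\<forall>i\<in>I. 0 \<le> x $ i) \<and> (\<Sum>i\<in>I. x $ i) \<le> 1 \<and> (\<forall>j\<in>-I. x $ j = 0)}"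
    (is "_ = _ ` ?T")
proof
  have "convex ?T"
  proof (rule convexI)
    fix x y :: "real^'a" and u v :: real
    assume xy: "x \<in> ?T" "y \<in> ?T" and uv: "0 \<le> u" "0 \<le> v" "u + v = 1"
    have "(\<Sum>i\<in>I. (u *\<^sub>R x + v *\<^sub>R y) $ i) = u * (\<Sum>i\<in>I. x $ i) + v * (\<Sum>i\<in>I. y $ i)"
      by (simp add: sum.distrib sum_distrib_left)
    also have "\<dots> \<le> 1" using xy uv by (intro convex_bound_le) auto
    finally show "u *\<^sub>R x + v *\<^sub>R y \<in> ?T" using xy uv by auto
  qed
  then have "convex (frame_map f ` ?T)" by (rule convex_linear_image[OF linear_frame_map])
  then have conv: "convex ((\<lambda>x. s + frame_map f x) ` ?T)"
    using convex_translation[of "frame_map f ` ?T" s] by (simp add: image_image)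
  have "s \<in> (\<lambda>x. s + frame_map f x) ` ?T"
    by (rule image_eqI[of _ _ 0]) (simp_all add: frame_map_def)
  moreover have "s + f i \<in> (\<lambda>x. s + frame_map f x) ` ?T" if "i \<in> I" for i
  proof (rule image_eqI[of _ _ "axis i 1"])
    show "axis i 1 \<in> ?T" using that by (auto simp: axis_def)
  qed (simp add: frame_map_axis)
  ultimately show "convex hull (insert s ((\<lambda>i. s + f i) ` I)) \<subseteq> (\<lambda>x. s + frame_map f x) ` ?T"
    by (intro hull_minimal conv) auto
next
  show "(\<lambda>x. s + frame_map f x) ` ?T \<subseteq> convex hull (insert s ((\<lambda>i. s + f i) ` I))" (is "_ \<subseteq> ?H")
  proof (rule image_subsetI)
    fix x assume x: "x \<in> ?T"
    \<comment> \<open>The index \<open>None\<close> stands for the vertex \<open>s\<close> and takes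
      the remaining weight. Indexing by options instead of points tolerates coincidences among the
      points \<open>s + f i\<close>.\<close>
    define c where "c = (\<lambda>k. case k of None \<Rightarrow> 1 - (\<Sum>i\<in>I. x $ i) | Some i \<Rightarrow> x $ i)"
    define y where "y = (\<lambda>k. case k of None \<Rightarrow> s | Some i \<Rightarrow> s + f i)"
    have fin: "finite (Some ` I)" "None \<notin> Some ` I" by auto
    have "(\<Sum>k\<in>insert None (Some ` I). c k *\<^sub>R y k) \<in> ?H"
    proof (rule convex_sum)
      show "sum c (insert None (Some ` I)) = 1"
        using fin by (simp add: sum.reindex c_def)
      fix k assume "k \<in> insert None (Some ` I)"
      then show "0 \<le> c k" "y k \<in> ?H" using x by (auto simp: c_def y_def intro: hull_inc)
    qed auto
    moreover have "(\<Sum>k\<in>insert None (Some ` I). c k *\<^sub>R y k)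
        = (1 - (\<Sum>i\<in>I. x $ i)) *\<^sub>R s + (\<Sum>i\<in>I. x $ i *\<^sub>R (s + f i))"
      using fin by (simp add: sum.reindex c_def y_def)
    moreover have "\<dots> = s + (\<Sum>i\<in>I. x $ i *\<^sub>R f i)"
      by (simp add: scaleR_add_right sum.distrib scaleR_left_diff_distrib flip: scaleR_sum_left)
    moreover have "\<dots> = s + frame_map f x"
      using x by (simp add: frame_map_split[of f x I])
    ultimately show "s + frame_map f x \<in> ?H" by simp
  qed
qed

text \<open>Translation by \<open>s\<close> after \<open>frame_map f\<close> carries
  \<open>simplex_body I f\<close> onto the thickened simplex, so the determinant factors out.
  Measurability comes from the other side: the thickened simplex is a sum of two compact sets, and a
  linear left inverse pulls compactness back.\<close>

lemma rel_volume_frame: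
  fixes f :: "'m::finite \<Rightarrow> real^'m"
  assumes det: "det (\<chi> j. f j) \<noteq> 0"
    and orth: "{w. \<forall>i\<in>I. w \<bullet> f i = 0} = span (f ` (-I))"
    and \<sigma>_def: "\<sigma> = insert s ((\<lambda>i. s + f i) ` I)"
  shows "simplex_body I f \<in> lmeasurable"
    and "rel_volume (convex hull \<sigma>) = \<bar>det (\<chi> j. f j)\<bar> * measure lebesgue (simplex_body I f)
      / unit_ball_vol (real CARD('m) - real_of_int (aff_dim \<sigma>))"
proof -
  let ?S = "convex hull \<sigma>" and ?\<phi> = "frame_map f" and ?K = "simplex_body I f"
  let ?W = "{w. \<forall>y\<in>?S. \<forall>z\<in>?S. w \<bullet> (y - z) = 0}"
  let ?B = "{x + w | x w. x \<in> ?S \<and> (\<forall>y\<in>?S. \<forall>z\<in>?S. w \<bullet> (y - z) = 0) \<and> norm w \<le> 1}"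
  have inj: "inj ?\<phi>"
    using det det_nz_iff_inj[OF linear_frame_map, of f] by (simp add: det_matrix_frame_map)
  have inj_f: "inj f"
  proof (rule injI)
    fix i j assume "f i = f j"
    then have "axis i (1::real) = axis j 1"
      using injD[OF inj, of "axis i 1" "axis j 1"] by (simp only: frame_map_axis)
    then show "i = j" by (simp add: axis_eq_axis)
  qed
  have W: "?W = span (f ` (-I))"
  proof (subst orth[symmetric], intro equalityI subsetI; clarify)
    fix w i assume w: "\<forall>y\<in>?S. \<forall>z\<in>?S. w \<bullet> (y - z) = 0" and "i \<in> I"
    then have "s + f i \<in> ?S" "s \<in> ?S" by (auto simp: \<sigma>_def intro: hull_inc)
    then have "w \<bullet> ((s + f i) - s) = 0" using w by blast
    then show "w \<bullet> f i = 0" by simp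
  next
    fix w y z assume w: "\<forall>i\<in>I. w \<bullet> f i = 0" and yz: "y \<in> ?S" "z \<in> ?S"
    have "w \<bullet> y = w \<bullet> s" if yS: "y \<in> ?S" for y
    proof -
      obtain x where x: "y = s + ?\<phi> x" "\<forall>j\<in>-I. x $ j = 0"
        using yS unfolding \<sigma>_def convex_hull_frame by auto
      then have "?\<phi> x = (\<Sum>i\<in>I. x $ i *\<^sub>R f i)" by (simp add: frame_map_split[of f x I])
      then show ?thesis using w x by (simp add: inner_add_right inner_sum_right)
    qed
    then show "w \<bullet> (y - z) = 0" using yz by (simp add: inner_diff_right)
  qed
  have B: "?B = (\<lambda>x. s + ?\<phi> x) ` ?K"
  proof (intro equalityI subsetI)
    fix b assume "b \<in> ?B"
    then obtain x w where b: "b = x + w" "x \<in> ?S" "w \<in> ?W" "norm w \<le> 1" by auto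
    obtain y where y: "x = s + ?\<phi> y" "\<forall>i\<in>I. 0 \<le> y $ i" "(\<Sum>i\<in>I. y $ i) \<le> 1" "\<forall>j\<in>-I. y $ j = 0"
      using b(2) unfolding \<sigma>_def convex_hull_frame by auto
    have "w \<in> range (\<lambda>u. \<Sum>v\<in>f ` (-I). u v *\<^sub>R v)"
      using b(3) span_finite[of "f ` (-I)"] unfolding W by simp
    then obtain u where u: "w = (\<Sum>v\<in>f ` (-I). u v *\<^sub>R v)" by auto
    have u': "w = (\<Sum>j\<in>-I. u (f j) *\<^sub>R f j)"
      unfolding u by (rule sum.reindex_cong[OF inj_on_subset[OF inj_f]]) auto
    define z where "z = (\<chi> j. if j \<in> I then y $ j else u (f j))"
    have zI: "(\<Sum>i\<in>I. z $ i *\<^sub>R f i) = (\<Sum>i\<in>I. y $ i *\<^sub>R f i)"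
      "(\<Sum>i\<in>I. z $ i) = (\<Sum>i\<in>I. y $ i)"
      by (auto intro!: sum.cong simp: z_def)
    have zJ: "(\<Sum>j\<in>-I. z $ j *\<^sub>R f j) = w"
      unfolding u' by (rule sum.cong) (auto simp: z_def)
    have "?\<phi> y = (\<Sum>i\<in>I. y $ i *\<^sub>R f i)" using y(4) by (simp add: frame_map_split[of f y I])
    then have "b = s + ?\<phi> z" using b(1) y(1) zI zJ by (simp add: frame_map_split[of f z I])
    moreover have "z \<in> ?K" using y zI zJ b(4) by (auto simp: simplex_body_def z_def)
    ultimately show "b \<in> (\<lambda>x. s + ?\<phi> x) ` ?K" by blast
  next
    fix b assume "b \<in> (\<lambda>x. s + ?\<phi> x) ` ?K"
    then obtain x where x: "b = s + ?\<phi> x" "x \<in> ?K" by blast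
    define y where "y = (\<chi> j. if j \<in> I then x $ j else 0)"
    define w where "w = (\<Sum>j\<in>-I. x $ j *\<^sub>R f j)"
    have yI: "(\<Sum>i\<in>I. y $ i *\<^sub>R f i) = (\<Sum>i\<in>I. x $ i *\<^sub>R f i)"
      "(\<Sum>i\<in>I. y $ i) = (\<Sum>i\<in>I. x $ i)" "(\<Sum>j\<in>-I. y $ j *\<^sub>R f j) = 0"
      by (auto intro!: sum.cong simp: y_def)
    have "s + ?\<phi> y \<in> ?S" unfolding \<sigma>_def convex_hull_frame
      using x(2) yI by (intro imageI) (auto simp: simplex_body_def y_def)
    moreover have "w \<in> ?W" unfolding W w_def by (intro span_sum span_scale span_base) auto
    moreover have "norm w \<le> 1" using x(2) by (simp add: simplex_body_def w_def)
    moreover have "b = (s + ?\<phi> y) + w"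
      using x(1) yI by (simp add: frame_map_split[of f _ I] w_def)
    ultimately show "b \<in> ?B" by blast
  qed
  have c1: "compact ?S" unfolding \<sigma>_def by (intro finite_imp_compact_convex_hull) auto
  have c2: "compact (?W \<inter> cball 0 1)" unfolding W by (intro closed_Int_compact closed_span) auto
  have "?B = {x + w | x w. x \<in> ?S \<and> w \<in> ?W \<inter> cball 0 1}" by auto
  then have compB: "compact ?B" using compact_sums[OF c1 c2] by simp
  obtain \<psi> where \<psi>: "linear \<psi>" "\<psi> \<circ> ?\<phi> = id"
    using linear_injective_left_inverse[OF linear_frame_map inj] by blast
  have "(\<lambda>y. \<psi> (y - s)) ` ?B = ?K" unfolding B using \<psi>(2) by (simp add: image_image fun_eq_iff)
  moreover have "compact ((\<lambda>y. \<psi> (y - s)) ` ?B)"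
    by (intro compact_continuous_image compB linear_continuous_on_compose[OF _ \<psi>(1)] continuous_intros)
  ultimately have "compact ?K" by simp
  then show K: "?K \<in> lmeasurable" by (rule lmeasurable_compact)
  have "?B = (+) s ` (?\<phi> ` ?K)" unfolding B by (simp add: image_image)
  then have "measure lebesgue ?B = measure lebesgue (?\<phi> ` ?K)"
    by (simp only: measure_translation)
  also have "\<dots> = \<bar>det (\<chi> j. f j)\<bar> * measure lebesgue ?K"
    using measure_linear_image_cart[OF linear_frame_map K, of f] by (simp add: det_matrix_frame_map)
  finally show "rel_volume ?S = \<bar>det (\<chi> j. f j)\<bar> * measure lebesgue ?K
      / unit_ball_vol (real CARD('m) - real_of_int (aff_dim \<sigma>))"
    by (simp add: rel_volume_def aff_dim_convex_hull)
qed

lemma simplex_body_cong: "(\<And>j. j \<notin> I \<Longrightarrow> f j = e j) \<Longrightarrow> simplex_body I f = simplex_body I e"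
  unfolding simplex_body_def by (auto cong: sum.cong_simp)

text \<open>The complement depends on the affine hull alone; this lets two simplices with equal
  hulls use the same complement frame.\<close>

lemma orthogonal_complement_affine_hull:
  fixes \<sigma> :: "'a::euclidean_space set"
  assumes "s \<in> \<sigma>"
  shows "{w. \<forall>y\<in>\<sigma>. w \<bullet> (y - s) = 0} = {w. \<forall>y\<in>affine hull \<sigma>. \<forall>z\<in>affine hull \<sigma>. w \<bullet> (y - z) = 0}"
proof (intro equalityI subsetI CollectI ballI)
  fix w y z assume w: "w \<in> {w. \<forall>y\<in>\<sigma>. w \<bullet> (y - s) = 0}"
    and yz: "y \<in> affine hull \<sigma>" "z \<in> affine hull \<sigma>"
  have "\<sigma> \<subseteq> {x. w \<bullet> x = w \<bullet> s}" using w by (auto simp: inner_diff_right)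
  then have "affine hull \<sigma> \<subseteq> {x. w \<bullet> x = w \<bullet> s}" by (rule hull_minimal) (rule affine_hyperplane)
  then have "w \<bullet> y = w \<bullet> s" "w \<bullet> z = w \<bullet> s" using yz by auto
  then show "w \<bullet> (y - z) = 0" by (simp add: inner_diff_right)
next
  fix w y assume "w \<in> {w. \<forall>y\<in>affine hull \<sigma>. \<forall>z\<in>affine hull \<sigma>. w \<bullet> (y - z) = 0}" "y \<in> \<sigma>"
  then show "w \<bullet> (y - s) = 0" using assms by (auto intro: hull_inc)
qed

text \<open>A vanishing combination of the frame splits into an edge part and a complement part.
  These are orthogonal, so each vanishes by itself, and each family is independent.\<close>

lemma simplex_frame:
  fixes \<sigma> :: "(real^'m) set"
  assumes ind: "\<not> affine_dependent \<sigma>" and s: "s \<in> \<sigma>" and g: "bij_betw g I (\<sigma> - {s})"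
    and e: "inj_on e (-I)" "independent (e ` (-I))" "span (e ` (-I)) = {w. \<forall>y\<in>\<sigma>. w \<bullet> (y - s) = 0}"
    and f: "\<And>j. f j = (if j \<in> I then g j - s else e j)"
  shows "det (\<chi> j. f j) \<noteq> 0" "{w. \<forall>i\<in>I. w \<bullet> f i = 0} = span (f ` (-I))"
    "\<sigma> = insert s ((\<lambda>i. s + f i) ` I)"
proof -
  have gI: "g ` I = \<sigma> - {s}" "inj_on g I" using g by (auto simp: bij_betw_def)
  show \<sigma>: "\<sigma> = insert s ((\<lambda>i. s + f i) ` I)"
  proof -
    have "(\<lambda>i. s + f i) ` I = g ` I" by (rule image_cong) (auto simp: f)
    then show ?thesis using gI s by auto
  qed
  have fe: "f ` (-I) = e ` (-I)" by (rule image_cong) (auto simp: f)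
  have "{w. \<forall>i\<in>I. w \<bullet> f i = 0} = {w. \<forall>y\<in>\<sigma>. w \<bullet> (y - s) = 0}"
    by (subst \<sigma>) auto
  then show orth: "{w. \<forall>i\<in>I. w \<bullet> f i = 0} = span (f ` (-I))" using e(3) fe by simp
  have indI: "independent ((\<lambda>y. - s + y) ` (\<sigma> - {s}))"
    using ind affine_dependent_iff_dependent2[OF s] by blast
  have "inj (frame_map f)"
  proof (rule linear_injective_0[OF linear_frame_map, THEN iffD2], intro allI impI)
    fix x assume x0: "frame_map f x = 0"
    define u where "u = (\<Sum>i\<in>I. x $ i *\<^sub>R f i)"
    define w where "w = (\<Sum>j\<in>-I. x $ j *\<^sub>R f j)"
    have uw: "u + w = 0" using x0 frame_map_split[of f x I] by (simp add: u_def w_def)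
    have "w \<in> span (f ` (-I))" unfolding w_def by (intro span_sum span_scale span_base) auto
    then have "w \<bullet> u = 0" unfolding orth[symmetric] u_def by (auto simp: inner_sum_right)
    then have "w \<bullet> w = 0" using uw by (metis add_eq_0_iff inner_minus_right neg_equal_0_iff_equal)
    then have w0: "w = 0" and u0: "u = 0" using uw by auto
    have "x $ i = 0" if "i \<in> I" for i
    proof -
      let ?h = "\<lambda>i. g i - s"
      have inj: "inj_on ?h I" using gI(2) by (auto simp: inj_on_def)
      have im: "?h ` I = (\<lambda>y. - s + y) ` (\<sigma> - {s})" unfolding gI(1)[symmetric] by (simp add: image_image)
      have "(\<Sum>v\<in>?h ` I. x $ (inv_into I ?h v) *\<^sub>R v) = (\<Sum>i\<in>I. x $ i *\<^sub>R ?h i)"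
        by (subst sum.reindex[OF inj]) (auto intro!: sum.cong simp: inv_into_f_f[OF inj])
      also have "\<dots> = u" unfolding u_def by (rule sum.cong) (auto simp: f)
      finally have sum0: "(\<Sum>v\<in>?h ` I. x $ (inv_into I ?h v) *\<^sub>R v) = 0" using u0 by simp
      have "independent (?h ` I)" unfolding im by (rule indI)
      then have "x $ (inv_into I ?h (?h i)) = 0"
        by (rule independentD[OF _ _ subset_refl sum0]) (use that in auto)
      then show ?thesis using inv_into_f_f[OF inj that] by simp
    qed
    moreover have "x $ j = 0" if "j \<in> -I" for j
    proof -
      have "(\<Sum>v\<in>e ` (-I). x $ (inv_into (-I) e v) *\<^sub>R v) = (\<Sum>j\<in>-I. x $ j *\<^sub>R e j)"
        by (subst sum.reindex[OF e(1)]) (auto intro!: sum.cong simp: inv_into_f_f[OF e(1)])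
      also have "\<dots> = w" unfolding w_def by (rule sum.cong) (auto simp: f)
      finally have "x $ (inv_into (-I) e (e j)) = 0"
        using independentD[OF e(2), of "e ` (-I)" "\<lambda>v. x $ (inv_into (-I) e v)" "e j"] w0 that by auto
      then show ?thesis using inv_into_f_f[OF e(1) that] by simp
    qed
    ultimately show "x = 0" by (auto simp: vec_eq_iff)
  qed
  then show "det (\<chi> j. f j) \<noteq> 0"
    using det_nz_iff_inj[OF linear_frame_map, of f] by (simp add: det_matrix_frame_map)
qed

text \<open>The number of edges at \<open>s\<close> and the dimension of their orthogonal complement
  add up to the ambient dimension, so the coordinate type can be split into \<open>I\<close> for the
  edges and the rest for a basis of the complement.\<close>

lemma exists_complement_frame:
  fixes \<sigma> :: "(real^'m) set"
  assumes ind: "\<not> affine_dependent \<sigma>" and s: "s \<in> \<sigma>"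
  obtains I :: "'m set" and e where "card I = card (\<sigma> - {s})" "inj_on e (-I)" "independent (e ` (-I))"
    "span (e ` (-I)) = {w. \<forall>y\<in>\<sigma>. w \<bullet> (y - s) = 0}"
proof -
  let ?T = "(\<lambda>y. - s + y) ` (\<sigma> - {s})" and ?W = "{w. \<forall>y\<in>\<sigma>. w \<bullet> (y - s) = 0}"
  have fin: "finite \<sigma>" using ind aff_independent_finite by blast
  have "independent ?T" using ind affine_dependent_iff_dependent2[OF s] by blast
  then have "dim (span ?T) = card ?T" by (simp add: dim_eq_card_independent)
  then have dimU: "dim (span ?T) = card (\<sigma> - {s})" by (simp add: card_image)
  have W: "?W = {y \<in> UNIV. \<forall>x\<in>span ?T. orthogonal x y}"
  proof (intro equalityI subsetI CollectI conjI ballI UNIV_I)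
    fix w x assume w: "w \<in> ?W" and x: "x \<in> span ?T"
    from x show "orthogonal x w"
    proof (induction rule: span_induct)
      case base
      show ?case by (auto simp: subspace_def orthogonal_def inner_add_left)
    next
      case (step x)
      then show ?case using w by (auto simp: orthogonal_def inner_commute)
    qed
  next
    fix w y assume w: "w \<in> {y \<in> UNIV. \<forall>x\<in>span ?T. orthogonal x y}" and "y \<in> \<sigma>"
    show "w \<bullet> (y - s) = 0"
    proof (cases "y = s")
      case False
      then have "- s + y \<in> span ?T" using \<open>y \<in> \<sigma>\<close> by (intro span_base) auto
      then show ?thesis using w by (auto simp: orthogonal_def inner_commute)
    qed simp
  qed
  have dims: "dim ?W + card (\<sigma> - {s}) = CARD('m)"
    using dim_subspace_orthogonal_to_vectors[of "span ?T" UNIV] dimU unfolding W[symmetric] by simp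
  obtain B where B: "B \<subseteq> ?W" "independent B" "?W \<subseteq> span B" "card B = dim ?W"
    using basis_exists by blast
  have "subspace ?W" unfolding subspace_def by (auto simp: inner_add_left)
  then have spanB: "span B = ?W" using B by (simp add: span_minimal subset_antisym)
  obtain I :: "'m set" where I: "card I = card (\<sigma> - {s})"
  proof (rule obtain_subset_with_card_n)
    show "card (\<sigma> - {s}) \<le> card (UNIV :: 'm set)" using dims by simp
  qed (rule that)
  have "card (-I) = card B" using I dims B(4) by (simp add: Compl_eq_Diff_UNIV card_Diff_subset)
  then obtain e where e: "bij_betw e (-I) B"
    using finite_same_card_bij[of "-I" B] independent_imp_finite[OF B(2)] by auto
  show thesis
    by (rule that[of I e]) (use e I B spanB in \<open>auto simp: bij_betw_def\<close>)
qed

section \<open>Volume comparisons within one affine hull\<close>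

definition int_affine_hull :: "'a::real_vector set \<Rightarrow> 'a set" where
  "int_affine_hull \<sigma> = {\<Sum>y\<in>\<sigma>. of_int (k y) *\<^sub>R y | k. sum k \<sigma> = (1::int)}"

lemma det_int_entries:
  fixes A :: "real^'n^'n"
  assumes "\<And>i j. A $ i $ j \<in> \<int>"
  shows "det A \<in> \<int>"
  unfolding det_def by (intro Ints_sum Ints_mult Ints_prod assms) auto

lemma finite_affine_independent_bij:
  fixes C :: "'a::euclidean_space set"
  assumes "\<not> affine_dependent \<sigma>" "\<not> affine_dependent C" "affine hull \<sigma> = affine hull C"
    and "s \<in> \<sigma>" "t \<in> C" and "finite I" "card I = card (\<sigma> - {s})"
  obtains g where "bij_betw g I (C - {t})"
proof -
  have "aff_dim \<sigma> = aff_dim C" using assms(3) by (metis aff_dim_affine_hull)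
  then have "card \<sigma> = card C"
    using aff_dim_affine_independent[OF assms(1)] aff_dim_affine_independent[OF assms(2)] by simp
  then have "card I = card (C - {t})" using assms by simp
  then show thesis
    using finite_same_card_bij[of I "C - {t}"] assms(2,6) aff_independent_finite that by blast
qed

text \<open>Over a shared complement frame the two frames differ by an integer matrix. It is
  nonsingular because both frames are, so its determinant has absolute value at least 1.\<close>

lemma rel_volume_le_int_affine_hull:
  fixes \<sigma> C :: "(real^'m) set"
  assumes \<sigma>: "\<not> affine_dependent \<sigma>" and C: "\<not> affine_dependent C"
    and aff: "affine hull \<sigma> = affine hull C" and gen: "C \<subseteq> int_affine_hull \<sigma>"
  shows "rel_volume (convex hull \<sigma>) \<le> rel_volume (convex hull C)"
proof (cases "\<sigma> = {}")
  case True
  then have "C = {}" using aff by simp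
  then show ?thesis using True by simp
next
  case False
  then obtain s where s: "s \<in> \<sigma>" by blast
  have "C \<noteq> {}" using aff False by (metis affine_hull_eq_empty)
  then obtain t where t: "t \<in> C" by blast
  have fin: "finite \<sigma>" using \<sigma> aff_independent_finite by blast
  obtain I :: "'m set" and e where I: "card I = card (\<sigma> - {s})"
    and e: "inj_on e (-I)" "independent (e ` (-I))" "span (e ` (-I)) = {w. \<forall>y\<in>\<sigma>. w \<bullet> (y - s) = 0}"
    by (rule exists_complement_frame[OF \<sigma> s])
  have e': "span (e ` (-I)) = {w. \<forall>y\<in>C. w \<bullet> (y - t) = 0}"
    using e(3) orthogonal_complement_affine_hull[OF s] orthogonal_complement_affine_hull[OF t] aff by simp
  obtain g where g: "bij_betw g I (\<sigma> - {s})"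
    by (rule finite_affine_independent_bij[OF \<sigma> \<sigma> refl s s _ I]) auto
  obtain h where h: "bij_betw h I (C - {t})"
    by (rule finite_affine_independent_bij[OF \<sigma> C aff s t _ I]) auto
  define f where "f = (\<lambda>j. if j \<in> I then g j - s else e j)"
  define f' where "f' = (\<lambda>j. if j \<in> I then h j - t else e j)"
  note F = simplex_frame[OF \<sigma> s g e, of f] and F' = simplex_frame[OF C t h e(1,2) e', of f']
  have dim: "aff_dim \<sigma> = aff_dim C" using aff by (metis aff_dim_affine_hull)
  have vol: "rel_volume (convex hull \<sigma>) = \<bar>det (\<chi> j. f j)\<bar> * measure lebesgue (simplex_body I e)
      / unit_ball_vol (real CARD('m) - real_of_int (aff_dim \<sigma>))"
    using rel_volume_frame(2)[of f I \<sigma> s] F simplex_body_cong[of I f e] by (simp add: f_def)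
  have vol': "rel_volume (convex hull C) = \<bar>det (\<chi> j. f' j)\<bar> * measure lebesgue (simplex_body I e)
      / unit_ball_vol (real CARD('m) - real_of_int (aff_dim \<sigma>))"
    using rel_volume_frame(2)[of f' I C t] F' simplex_body_cong[of I f' e] dim by (simp add: f'_def)
  have "\<forall>c\<in>C. \<exists>k. c = (\<Sum>y\<in>\<sigma>. of_int (k y) *\<^sub>R y) \<and> sum k \<sigma> = (1::int)"
    using gen unfolding int_affine_hull_def by blast
  then obtain k where k: "\<And>c. c \<in> C \<Longrightarrow> c = (\<Sum>y\<in>\<sigma>. of_int (k c y) *\<^sub>R y) \<and> sum (k c) \<sigma> = (1::int)"
    by metis
  \<comment> \<open>Rows in \<open>I\<close> express the edges of \<open>C\<close> through those of
    \<sigma>; the remaining rows are the identity on the shared complement. The coefficients of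
    \<open>c\<close> and of \<open>t\<close> both sum to 1, so in their difference the base vertex
    \<open>s\<close> drops out.\<close>
  define M :: "real^'m^'m" where
    "M = (\<chi> i j. if i \<in> I then (if j \<in> I then of_int (k (h i) (g j) - k t (g j)) else 0) else of_bool (i = j))"
  have diff: "c - t = (\<Sum>j\<in>I. of_int (k c (g j) - k t (g j)) *\<^sub>R (g j - s))" if c: "c \<in> C" for c
  proof -
    have "sum (\<lambda>y. k c y - k t y) \<sigma> = 0" using k[OF c] k[OF t] by (simp add: sum_subtractf)
    then have "(\<Sum>y\<in>\<sigma>. real_of_int (k c y - k t y)) = 0"
      by (metis of_int_0 of_int_sum)
    then have z: "(\<Sum>y\<in>\<sigma>. of_int (k c y - k t y) *\<^sub>R s) = 0" by (simp flip: scaleR_sum_left)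
    have "c - t = (\<Sum>y\<in>\<sigma>. of_int (k c y - k t y) *\<^sub>R y)"
      using k[OF c] k[OF t] by (simp add: scaleR_left_diff_distrib sum_subtractf)
    also have "\<dots> = (\<Sum>y\<in>\<sigma>. of_int (k c y - k t y) *\<^sub>R (y - s))"
      using z by (simp add: scaleR_right_diff_distrib sum_subtractf)
    also have "\<dots> = (\<Sum>y\<in>\<sigma> - {s}. of_int (k c y - k t y) *\<^sub>R (y - s))"
      using fin s by (simp add: sum.remove)
    also have "\<dots> = (\<Sum>j\<in>I. of_int (k c (g j) - k t (g j)) *\<^sub>R (g j - s))"
      by (rule sum.reindex_bij_betw[OF g, symmetric])
    finally show ?thesis .
  qed
  have "(\<chi> i. f' i) = M ** (\<chi> j. f j)"
  proof -
    have "f' i = (\<Sum>j\<in>UNIV. M $ i $ j *\<^sub>R f j)" for i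
    proof (cases "i \<in> I")
      case True
      then have "h i \<in> C" using h by (auto simp: bij_betw_def)
      have "(\<Sum>j\<in>UNIV. M $ i $ j *\<^sub>R f j) = (\<Sum>j\<in>I. M $ i $ j *\<^sub>R f j)"
        by (rule sum.mono_neutral_right) (use True in \<open>auto simp: M_def\<close>)
      also have "\<dots> = (\<Sum>j\<in>I. of_int (k (h i) (g j) - k t (g j)) *\<^sub>R (g j - s))"
        by (rule sum.cong) (use True in \<open>auto simp: M_def f_def\<close>)
      also have "\<dots> = f' i" using diff[OF \<open>h i \<in> C\<close>] True by (simp add: f'_def)
      finally show ?thesis by simp
    next
      case False
      have "(\<Sum>j\<in>UNIV. M $ i $ j *\<^sub>R f j) = (\<Sum>j\<in>UNIV. if i = j then f j else 0)"
        by (rule sum.cong) (use False in \<open>auto simp: M_def\<close>)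
      then show ?thesis using False by (simp add: f_def f'_def)
    qed
    then show ?thesis by (simp add: vec_eq_iff matrix_matrix_mult_def)
  qed
  then have det: "det (\<chi> i. f' i) = det M * det (\<chi> j. f j)" by (simp add: det_mul)
  have "det M \<in> \<int>" by (rule det_int_entries) (auto simp: M_def)
  moreover have "det M \<noteq> 0" using det F'(1) by (auto simp: f'_def)
  ultimately have "1 \<le> \<bar>det M\<bar>" using Ints_nonzero_abs_ge1 by blast
  then have "\<bar>det (\<chi> j. f j)\<bar> \<le> \<bar>det (\<chi> j. f' j)\<bar>"
    unfolding det abs_mult by (metis abs_ge_zero mult_right_mono mult_1)
  moreover have "0 \<le> unit_ball_vol (real CARD('m) - real_of_int (aff_dim \<sigma>))"
    using aff_dim_le_DIM[of \<sigma>] by simp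
  ultimately show ?thesis unfolding vol vol' by (intro divide_right_mono mult_right_mono) auto
qed

lemma measure_simplex_body_pos:
  fixes f :: "'m::finite \<Rightarrow> real^'m"
  assumes "simplex_body I f \<in> lmeasurable"
  shows "0 < measure lebesgue (simplex_body I f)"
proof -
  \<comment> \<open>With r = 1/N, a cube of side \<open>r\<close> meets both bounds of the body: the
    coordinate sum is at most r times \<open>card I\<close>, the complement part at most r times the
    sum of norms. The summand 1 keeps \<open>N\<close> positive.\<close>
  define N where "N = real (card I) + (\<Sum>j\<in>-I. norm (f j)) + 1"
  define r where "r = inverse N"
  have s0: "0 \<le> (\<Sum>j\<in>-I. norm (f j))" by (intro sum_nonneg) auto
  then have N: "0 < N" unfolding N_def by (simp add: add_nonneg_pos)
  then have r: "0 < r" unfolding r_def by simp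
  have rN: "r * N = 1" using N unfolding r_def by simp
  have "cbox 0 (\<chi> i. r) \<subseteq> simplex_body I f"
  proof
    fix x :: "real^'m" assume "x \<in> cbox 0 (\<chi> i. r)"
    then have x: "0 \<le> x $ i" "x $ i \<le> r" for i by (auto simp: mem_box_cart)
    have "(\<Sum>i\<in>I. x $ i) \<le> (\<Sum>i\<in>I. r)" by (intro sum_mono x)
    also have "\<dots> \<le> r * N" using r s0 unfolding N_def by (simp add: algebra_simps)
    finally have 1: "(\<Sum>i\<in>I. x $ i) \<le> 1" using rN by simp
    have "norm (\<Sum>j\<in>-I. x $ j *\<^sub>R f j) \<le> (\<Sum>j\<in>-I. norm (x $ j *\<^sub>R f j))" by (rule norm_sum)
    also have "\<dots> \<le> (\<Sum>j\<in>-I. r * norm (f j))"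
      using x by (intro sum_mono) (simp add: mult_right_mono)
    also have "\<dots> \<le> r * N" using r unfolding N_def by (simp add: algebra_simps sum_distrib_left)
    finally show "x \<in> simplex_body I f" using 1 rN x by (simp add: simplex_body_def)
  qed
  then have "measure lebesgue (cbox 0 (\<chi> i. r) :: (real^'m) set) \<le> measure lebesgue (simplex_body I f)"
    by (intro measure_mono_fmeasurable assms) auto
  moreover have "cbox 0 (\<chi> i. r) \<noteq> ({} :: (real^'m) set)"
    using r by (auto simp: interval_ne_empty_cart)
  then have "0 < measure lebesgue (cbox 0 (\<chi> i. r) :: (real^'m) set)"
    using r by (simp add: content_cbox_cart)
  ultimately show ?thesis by simp
qed

text \<open>Modulo the edges of \<tau> at \<open>s\<close>, the vector \<open>v - s\<close> is a
  multiple of \<open>u - s\<close>. The factor is the ratio of the distances of \<open>v\<close> and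
  \<open>u\<close> from the hyperplane containing \<tau>, hence greater than 1, and it is also the
  ratio of the determinants.\<close>

lemma rel_volume_cone_less:
  fixes \<tau> :: "(real^'m) set"
  assumes u: "\<not> affine_dependent (insert u \<tau>)" and v: "\<not> affine_dependent (insert v \<tau>)"
    and aff: "affine hull (insert u \<tau>) = affine hull (insert v \<tau>)"
    and \<tau>: "\<tau> \<noteq> {}" "\<And>y. y \<in> \<tau> \<Longrightarrow> a \<bullet> y = b" and uv: "a \<bullet> u < b" "a \<bullet> v < a \<bullet> u"
  shows "rel_volume (convex hull (insert u \<tau>)) < rel_volume (convex hull (insert v \<tau>))"
proof -
  let ?\<sigma> = "insert u \<tau>" and ?C = "insert v \<tau>"
  obtain s where s: "s \<in> \<tau>" using \<tau> by blast
  then have su: "s \<in> ?\<sigma>" and sv: "s \<in> ?C" by auto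
  have not: "u \<notin> \<tau>" "v \<notin> \<tau>" "u \<noteq> s" "v \<noteq> s" using \<tau>(2) uv s by auto
  obtain I :: "'m set" and e where I: "card I = card (?\<sigma> - {s})"
    and e: "inj_on e (-I)" "independent (e ` (-I))" "span (e ` (-I)) = {w. \<forall>y\<in>?\<sigma>. w \<bullet> (y - s) = 0}"
    by (rule exists_complement_frame[OF u su])
  have e': "span (e ` (-I)) = {w. \<forall>y\<in>?C. w \<bullet> (y - s) = 0}"
    using e(3) orthogonal_complement_affine_hull[OF su] orthogonal_complement_affine_hull[OF sv] aff by simp
  obtain g where g: "bij_betw g I (?\<sigma> - {s})"
    by (rule finite_affine_independent_bij[OF u u refl su su _ I]) auto
  have gim: "g ` I = ?\<sigma> - {s}" and ginj: "inj_on g I" using g by (auto simp: bij_betw_def)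
  then obtain i0 where i0: "i0 \<in> I" "g i0 = u" using not by (metis Diff_iff imageE insertI1 singletonD)
  define h where "h = g(i0 := v)"
  have g': "g ` (I - {i0}) = \<tau> - {s}"
    using gim i0 ginj not by (auto simp: inj_on_image_set_diff[of g I])
  have h: "bij_betw h I (?C - {s})"
  proof -
    have "bij_betw g (I - {i0}) (\<tau> - {s})"
      using g' ginj by (auto simp: bij_betw_def intro: inj_on_subset)
    then have "bij_betw h (I - {i0}) (\<tau> - {s})"
      by (subst bij_betw_cong[of _ h g]) (auto simp: h_def)
    then have "bij_betw h (insert i0 (I - {i0})) (insert (h i0) (\<tau> - {s}))"
      by (intro bij_betw_combine[of h "{i0}" "{h i0}", simplified]) (use not in \<open>auto simp: h_def\<close>)
    moreover have "insert i0 (I - {i0}) = I" "insert (h i0) (\<tau> - {s}) = ?C - {s}"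
      using i0 not by (auto simp: h_def)
    ultimately show ?thesis by simp
  qed
  define f where "f = (\<lambda>j. if j \<in> I then g j - s else e j)"
  define f' where "f' = (\<lambda>j. if j \<in> I then h j - s else e j)"
  note F = simplex_frame[OF u su g e, of f] and F' = simplex_frame[OF v sv h e(1,2) e', of f']
  have dim: "aff_dim ?\<sigma> = aff_dim ?C" using aff by (metis aff_dim_affine_hull)
  let ?c = "unit_ball_vol (real CARD('m) - real_of_int (aff_dim ?\<sigma>))"
  have vol: "rel_volume (convex hull ?\<sigma>) = \<bar>det (\<chi> j. f j)\<bar> * measure lebesgue (simplex_body I e) / ?c"
    using rel_volume_frame(2)[of f I ?\<sigma> s] F simplex_body_cong[of I f e] by (simp add: f_def)
  have meas: "simplex_body I e \<in> lmeasurable"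
    using rel_volume_frame(1)[of f I ?\<sigma> s] F simplex_body_cong[of I f e] by (simp add: f_def)
  have vol': "rel_volume (convex hull ?C) = \<bar>det (\<chi> j. f' j)\<bar> * measure lebesgue (simplex_body I e) / ?c"
    using rel_volume_frame(2)[of f' I ?C s] F' simplex_body_cong[of I f' e] dim by (simp add: f'_def)
  have "v \<in> affine hull ?\<sigma>" using aff by (metis hull_inc insertI1)
  then have "v - s \<in> span ((\<lambda>x. - s + x) ` (?\<sigma> - {s}))"
    unfolding affine_hull_span2[OF su] by auto
  moreover have "(\<lambda>x. - s + x) ` (?\<sigma> - {s}) = insert (u - s) ((\<lambda>x. - s + x) ` (\<tau> - {s}))"
    using not by auto
  ultimately obtain k where k: "v - s - k *\<^sub>R (u - s) \<in> span ((\<lambda>x. - s + x) ` (\<tau> - {s}))"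
    by (auto simp: span_insert)
  define x where "x = v - s - k *\<^sub>R (u - s)"
  have "span ((\<lambda>x. - s + x) ` (\<tau> - {s})) \<subseteq> {x. a \<bullet> x = 0}"
    by (rule span_minimal) (use \<tau> s in \<open>auto simp: subspace_hyperplane inner_diff_right\<close>)
  then have "a \<bullet> x = 0" using k by (auto simp: x_def)
  then have kk: "b - a \<bullet> v = k * (b - a \<bullet> u)"
    using \<tau>(2)[OF s] by (simp add: x_def inner_diff_right algebra_simps)
  have k1: "1 < k"
  proof (rule ccontr)
    assume "\<not> 1 < k"
    then have "k * (b - a \<bullet> u) \<le> 1 * (b - a \<bullet> u)" using uv by (intro mult_right_mono) auto
    then have "b - a \<bullet> v \<le> 1 * (b - a \<bullet> u)" unfolding kk .
    then show False using uv by simp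
  qed
  \<comment> \<open>\<open>A\<close> scales the apex row by \<open>k\<close>; adding
    \<open>x\<close>, a combination of the other rows, then turns it into the apex row of
    \<open>f'\<close> without changing the determinant.\<close>
  define A where "A = (\<chi> j. if j = i0 then k *s f j else f j)"
  have rowA: "row j A = (if j = i0 then k *s f j else f j)" for j
    by (simp add: A_def row_def vec_eq_iff)
  have "(\<lambda>x. - s + x) ` (\<tau> - {s}) \<subseteq> {row j A |j. j \<noteq> i0}"
  proof
    fix y assume "y \<in> (\<lambda>x. - s + x) ` (\<tau> - {s})"
    then obtain j where j: "j \<in> I" "j \<noteq> i0" "y = - s + g j" unfolding g'[symmetric] by auto
    then have "y = row j A" by (simp add: rowA f_def)
    then show "y \<in> {row j A |j. j \<noteq> i0}" using j by blast
  qed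
  then have "x \<in> vec.span {row j A |j. j \<noteq> i0}"
    using k span_mono unfolding span_vec_eq x_def by blast
  then have "det (\<chi> j. if j = i0 then row i0 A + x else row j A) = det A" by (rule det_row_span)
  moreover have "(\<chi> j. if j = i0 then row i0 A + x else row j A) = (\<chi> j. f' j)"
  proof -
    have "k *s f i0 + x = f' i0"
      using i0 by (simp add: f_def f'_def h_def x_def scalar_mult_eq_scaleR)
    moreover have "f j = f' j" if "j \<noteq> i0" for j using that by (simp add: f_def f'_def h_def)
    ultimately have "(if j = i0 then row i0 A + x else row j A) = f' j" for j by (simp add: rowA)
    then show ?thesis by simp
  qed
  moreover have "det A = k * det (\<chi> j. f j)"
    unfolding A_def det_row_mul by simp
  ultimately have det: "det (\<chi> j. f' j) = k * det (\<chi> j. f j)" by simp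
  have pos: "0 < \<bar>det (\<chi> j. f j)\<bar>" using F(1) by (simp add: f_def)
  then have "1 * \<bar>det (\<chi> j. f j)\<bar> < \<bar>k\<bar> * \<bar>det (\<chi> j. f j)\<bar>"
    using k1 by (intro mult_strict_right_mono) auto
  then have lt: "\<bar>det (\<chi> j. f j)\<bar> < \<bar>det (\<chi> j. f' j)\<bar>" unfolding det abs_mult by simp
  have "0 < ?c" using aff_dim_le_DIM[of ?\<sigma>] by simp
  then show ?thesis unfolding vol vol'
    using lt measure_simplex_body_pos[OF meas] by (intro divide_strict_right_mono mult_strict_right_mono)
qed

section \<open>Pulling triangulations\<close>

lemma convex_hull_face_points:
  fixes X :: "'a::euclidean_space set"
  assumes "finite X" "F face_of convex hull X"
  shows "convex hull (X \<inter> F) = F"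
proof
  obtain S where S: "S \<subseteq> X" "F = convex hull S"
    using face_of_convex_hull_subset[OF finite_imp_compact[OF assms(1)] assms(2)] by blast
  then have "S \<subseteq> X \<inter> F" by (auto intro: hull_inc)
  then show "F \<subseteq> convex hull (X \<inter> F)" using S(2) by (metis hull_mono)
  show "convex hull (X \<inter> F) \<subseteq> F"
    using assms(2) by (intro hull_minimal) (auto simp: face_of_imp_convex)
qed

lemma facet_filter_nonempty:
  assumes "F facet_of convex hull (set xs)"
  shows "filter (\<lambda>x. x \<in> F) xs \<noteq> []"
proof
  assume "filter (\<lambda>x. x \<in> F) xs = []"
  then have "set xs \<inter> F = {}" by (auto simp: filter_empty_conv)
  moreover have "convex hull (set xs \<inter> F) = F"
    by (rule convex_hull_face_points) (use assms facet_of_imp_face_of in auto)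
  ultimately have "F = {}" by simp
  then show False using assms by (simp add: facet_of_def)
qed

lemma not_in_affine_hull_face:
  fixes X :: "'a::euclidean_space set"
  assumes "F face_of convex hull X" "v \<in> X" "v \<notin> F"
  shows "v \<notin> affine hull F"
  using face_of_imp_eq_affine_Int[OF convex_convex_hull assms(1)] assms(2,3) hull_inc[of v X convex]
  by blast

lemma affine_hull_cone_facet:
  fixes X :: "'a::euclidean_space set"
  assumes F: "F facet_of convex hull X" and v: "v \<in> X" "v \<notin> F"
  shows "affine hull (insert v F) = affine hull X"
proof -
  have face: "F face_of convex hull X" and ne: "F \<noteq> {}" and dim: "aff_dim F = aff_dim (convex hull X) - 1"
    using F unfolding facet_of_def by auto
  have "insert v F \<subseteq> convex hull X" using v hull_inc[of v X convex] face_of_imp_subset[OF face] by auto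
  then have "affine hull (insert v F) \<subseteq> affine hull (convex hull X)" by (rule hull_mono)
  then have "affine hull (insert v F) \<subseteq> affine hull X" by simp
  moreover have "aff_dim (insert v F) = aff_dim X"
    using not_in_affine_hull_face[OF face v] dim by (simp add: aff_dim_insert aff_dim_convex_hull)
  ultimately show ?thesis
    using ne by (intro affine_dim_equal) (auto simp: affine_hull_eq_empty)
qed

lemma pulling_triangulation_simplex:
  assumes "\<sigma> \<in> pulling_triangulation xs" "xs \<noteq> []"
  shows "\<sigma> \<subseteq> set xs \<and> \<not> affine_dependent \<sigma> \<and> affine hull \<sigma> = affine hull (set xs)"
  using assms
proof (induction xs arbitrary: \<sigma> rule: pulling_triangulation.induct)
  case (1 xs)
  show ?case
  proof (cases "affine_dependent (set xs)")
    case False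
    then show ?thesis using 1(2) by (subst (asm) pulling_triangulation.simps) auto
  next
    case True
    then obtain F \<tau> where F: "F facet_of convex hull (set xs)" "hd xs \<notin> F"
      and \<tau>: "\<tau> \<in> pulling_triangulation (filter (\<lambda>x. x \<in> F) xs)" and \<sigma>: "\<sigma> = insert (hd xs) \<tau>"
      using 1(2) by (subst (asm) pulling_triangulation.simps) auto
    have face: "F face_of convex hull (set xs)" using F(1) facet_of_imp_face_of by blast
    have FX: "convex hull (set xs \<inter> F) = F" by (rule convex_hull_face_points) (use face in auto)
    have ne: "filter (\<lambda>x. x \<in> F) xs \<noteq> []" by (rule facet_filter_nonempty[OF F(1)])
    have set: "set (filter (\<lambda>x. x \<in> F) xs) = set xs \<inter> F" by auto
    have IH: "\<tau> \<subseteq> set xs \<inter> F" "\<not> affine_dependent \<tau>" "affine hull \<tau> = affine hull (set xs \<inter> F)"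
      using 1(1)[OF _ _ \<tau> ne] True F unfolding set by auto
    have hull: "affine hull \<tau> = affine hull F"
      using IH(3) FX affine_hull_convex_hull by metis
    have hd: "hd xs \<in> set xs" using 1(3) by simp
    have "hd xs \<notin> affine hull \<tau>" unfolding hull by (rule not_in_affine_hull_face[OF face hd F(2)])
    then have "\<not> affine_dependent \<sigma>" unfolding \<sigma> by (rule affine_independent_insert[OF IH(2)])
    moreover have "affine hull \<sigma> = affine hull (set xs)"
    proof -
      have "affine hull \<sigma> = affine hull (insert (hd xs) F)"
        unfolding \<sigma> by (metis hull hull_insert)
      then show ?thesis using affine_hull_cone_facet[OF F(1) hd F(2)] by simp
    qed
    ultimately show ?thesis using IH(1) hd \<sigma> by auto
  qed
qed

text \<open>Some extreme point differs from \<open>v\<close>, and as a proper face it is the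
  intersection of the facets containing it, so one of these misses \<open>v\<close>. This guarantees
  that the recursion of a pulling triangulation always finds a facet to cone over.\<close>

lemma facet_avoiding_point:
  fixes X :: "'a::euclidean_space set"
  assumes fin: "finite X" and dep: "affine_dependent X"
  shows "\<exists>F. F facet_of convex hull X \<and> v \<notin> F"
proof -
  let ?P = "convex hull X"
  have poly: "polyhedron ?P" using fin by (intro polytope_imp_polyhedron) (auto simp: polytope_def)
  have "\<exists>e. e extreme_point_of ?P \<and> e \<noteq> v"
  proof (rule ccontr)
    assume "\<not> ?thesis"
    then have "{x. x extreme_point_of ?P} \<subseteq> {v}" by blast
    then have "?P \<subseteq> {v}"
      using Krein_Milman_polytope[OF fin] hull_mono[of _ "{v}" convex] by (metis convex_hull_singleton)
    then have "X \<subseteq> {v}" by (meson hull_subset subset_trans)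
    then show False using dep affine_independent_1 affine_dependent_subset by blast
  qed
  then obtain e where e: "e extreme_point_of ?P" "e \<noteq> v" by blast
  have face: "{e} face_of ?P" using e(1) by (simp add: face_of_singleton)
  have "?P \<noteq> {e}"
  proof
    assume "?P = {e}"
    then have "X \<subseteq> {e}" by (metis hull_subset)
    then show False using dep affine_independent_1 affine_dependent_subset by blast
  qed
  then have "{e} = \<Inter>{F. F facet_of ?P \<and> {e} \<subseteq> F}"
    using face_of_polyhedron[OF poly face] by blast
  moreover have "v \<notin> {e}" using e(2) by simp
  ultimately have "v \<notin> \<Inter>{F. F facet_of ?P \<and> {e} \<subseteq> F}" by metis
  then show ?thesis by blast
qed

lemma pulling_triangulation_nonempty: "xs \<noteq> [] \<Longrightarrow> pulling_triangulation xs \<noteq> {}"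
proof (induction xs rule: pulling_triangulation.induct)
  case (1 xs)
  show ?case
  proof (cases "affine_dependent (set xs)")
    case False
    then show ?thesis by (subst pulling_triangulation.simps) auto
  next
    case True
    obtain F where F: "F facet_of convex hull (set xs)" "hd xs \<notin> F"
      using facet_avoiding_point[OF _ True] by blast
    have "filter (\<lambda>x. x \<in> F) xs \<noteq> []" by (rule facet_filter_nonempty[OF F(1)])
    then have "pulling_triangulation (filter (\<lambda>x. x \<in> F) xs) \<noteq> {}" using 1(1) True F by blast
    then show ?thesis using True F by (subst pulling_triangulation.simps) auto
  qed
qed

section \<open>From compressed to two-valued facets\<close>

text \<open>Pull first at a point \<open>v\<close> strictly farther from the facet than
  \<open>u\<close>. Some simplex of the triangulation is then a cone from \<open>v\<close> over a
  simplex of the facet, and moving its apex to \<open>u\<close> gives a lattice simplex of smaller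
  volume.\<close>

lemma compressed_facet_two_valued:
  fixes P :: "(real^'m) set"
  assumes comp: "compressed L P" and fin: "finite (P \<inter> L)" and hull: "convex hull (P \<inter> L) = P"
    and P: "P \<subseteq> {x. a \<bullet> x \<le> b}" and facet: "P \<inter> {x. a \<bullet> x = b} facet_of P"
    and u: "u \<in> P \<inter> L" "a \<bullet> u < b" and v: "v \<in> P \<inter> L" "a \<bullet> v < b"
  shows "a \<bullet> u = a \<bullet> v"
proof -
  have le: "a \<bullet> u \<le> a \<bullet> v" if u: "u \<in> P \<inter> L" "a \<bullet> u < b" and v: "v \<in> P \<inter> L" "a \<bullet> v < b" for u v
  proof (rule ccontr)
    assume "\<not> a \<bullet> u \<le> a \<bullet> v"
    then have lt: "a \<bullet> v < a \<bullet> u" by simp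
    let ?H = "P \<inter> {x. a \<bullet> x = b}"
    let ?X = "P \<inter> L"
    obtain ys where ys: "set ys = ?X - {v}" "distinct ys" using finite_distinct_list fin by (metis finite_Diff)
    let ?xs = "v # ys"
    have xs: "distinct ?xs" "set ?xs = ?X" using ys v by auto
    have facet': "?H facet_of convex hull (set ?xs)" using facet hull unfolding xs by simp
    have face: "?H face_of convex hull (set ?xs)" using facet' facet_of_imp_face_of by blast
    have HX: "convex hull (set ?xs \<inter> ?H) = ?H" by (rule convex_hull_face_points) (use face in auto)
    have uX: "u \<in> set ?xs" and vX: "v \<in> set ?xs" using u v xs by auto
    have uH: "u \<notin> ?H" and vH: "v \<notin> ?H" using u v by auto
    show False
    proof (cases "affine_dependent (set ?xs)")
      case False
      \<comment> \<open>If the lattice points form a simplex, a facet omits only one vertex, yet the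
        distinct points \<open>u\<close> and \<open>v\<close> both lie off it.\<close>
      obtain w where w: "w \<in> set ?xs" "?H = convex hull (set ?xs - {w})"
        using facet' facet_of_convex_hull_affine_independent[OF False] by blast
      have "u \<noteq> v" using lt by auto
      then have "u \<in> ?H \<or> v \<in> ?H" unfolding w(2) using uX vX by (metis Diff_iff hull_inc singletonD)
      then show False using uH vH by blast
    next
      case True
      have ne: "filter (\<lambda>x. x \<in> ?H) ?xs \<noteq> []" by (rule facet_filter_nonempty[OF facet'])
      obtain \<tau> where \<tau>: "\<tau> \<in> pulling_triangulation (filter (\<lambda>x. x \<in> ?H) ?xs)"
        using pulling_triangulation_nonempty[OF ne] by blast
      have set: "set (filter (\<lambda>x. x \<in> ?H) ?xs) = set ?xs \<inter> ?H" by auto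
      have \<tau>': "\<tau> \<subseteq> set ?xs \<inter> ?H" "\<not> affine_dependent \<tau>" "affine hull \<tau> = affine hull (set ?xs \<inter> ?H)"
        using pulling_triangulation_simplex[OF \<tau> ne] unfolding set by auto
      have hull\<tau>: "affine hull \<tau> = affine hull ?H" using \<tau>'(3) HX affine_hull_convex_hull by metis
      have "insert (hd ?xs) \<tau> \<in> pulling_triangulation ?xs"
        using True facet' vH \<tau> by (subst pulling_triangulation.simps) auto
      then have uni: "unimodular_simplex L P (insert v \<tau>)"
        using comp[unfolded compressed_def, rule_format, of ?xs "insert v \<tau>"] xs by simp
      have cone: "\<not> affine_dependent (insert w \<tau>)" "affine hull (insert w \<tau>) = affine hull P"
        if "w \<in> set ?xs" "w \<notin> ?H" for w
      proof -
        have "w \<notin> affine hull \<tau>" unfolding hull\<tau> by (rule not_in_affine_hull_face[OF face that])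
        then show "\<not> affine_dependent (insert w \<tau>)" by (rule affine_independent_insert[OF \<tau>'(2)])
        have "affine hull (insert w \<tau>) = affine hull (insert w ?H)" by (metis hull\<tau> hull_insert)
        also have "\<dots> = affine hull (set ?xs)" by (rule affine_hull_cone_facet[OF facet' that])
        also have "\<dots> = affine hull P" unfolding xs using hull affine_hull_convex_hull by metis
        finally show "affine hull (insert w \<tau>) = affine hull P" .
      qed
      have ne\<tau>: "\<tau> \<noteq> {}" using hull\<tau> facet by (auto simp: facet_of_def affine_hull_eq_empty)
      have "rel_volume (convex hull (insert u \<tau>)) < rel_volume (convex hull (insert v \<tau>))"
        by (rule rel_volume_cone_less[where a = a and b = b])
           (use cone[OF uX uH] cone[OF vX vH] ne\<tau> \<tau>'(1) u lt in auto)
      moreover have "insert u \<tau> \<subseteq> P \<inter> L" using u \<tau>'(1) xs by auto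
      moreover have "aff_dim (insert u \<tau>) = aff_dim P"
        using cone(2)[OF uX uH] by (metis aff_dim_affine_hull)
      ultimately show False
        using uni[unfolded unimodular_simplex_def, rule_format, of "insert u \<tau>"] cone(1)[OF uX uH]
        by simp
    qed
  qed
  show ?thesis using le[OF u v] le[OF v u] by simp
qed

section \<open>From width one to compressed\<close>

text \<open>The functional is scaled so that the points off the facet sit one level above it.
  \<Lambda> stays fixed while \<open>X\<close> shrinks to faces in the recursion; integrality on all
  of \<Lambda> makes the level of a lattice point the integer coefficient of the apex.\<close>

definition width_one :: "'a::euclidean_space set \<Rightarrow> 'a set \<Rightarrow> bool" where
  "width_one X \<Lambda> \<longleftrightarrow> (\<forall>F. F facet_of convex hull X \<longrightarrow>
     (\<exists>a b. F = convex hull X \<inter> {x. a \<bullet> x = b} \<and> (\<forall>x\<in>X - F. a \<bullet> x = b + 1) \<and> (\<forall>p\<in>\<Lambda>. a \<bullet> p - b \<in> \<int>)))"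

text \<open>A facet of a facet \<open>F\<close> is cut out of \<open>F\<close> by another facet of the whole polytope.\<close>

lemma width_one_facet:
  fixes X :: "'a::euclidean_space set"
  assumes fin: "finite X" and w1: "width_one X \<Lambda>" and F: "F facet_of convex hull X"
  shows "width_one (X \<inter> F) \<Lambda>"
  unfolding width_one_def
proof (intro allI impI)
  fix G assume "G facet_of convex hull (X \<inter> F)"
  let ?P = "convex hull X"
  have faceF: "F face_of ?P" using F facet_of_imp_face_of by blast
  have FX: "convex hull (X \<inter> F) = F" by (rule convex_hull_face_points[OF fin faceF])
  have G: "G face_of F" "G \<noteq> {}" "aff_dim G = aff_dim F - 1"
    using \<open>G facet_of convex hull (X \<inter> F)\<close> unfolding FX facet_of_def by auto
  have poly: "polyhedron ?P" using fin by (intro polytope_imp_polyhedron) (auto simp: polytope_def)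
  have GP: "G face_of ?P" using face_of_trans[OF G(1) faceF] .
  have GF: "G \<subseteq> F" "G \<noteq> F" using face_of_imp_subset[OF G(1)] G(3) by auto
  then have "G \<noteq> ?P" using face_of_imp_subset[OF faceF] by blast
  then have "G = \<Inter>{H. H facet_of ?P \<and> G \<subseteq> H}" using face_of_polyhedron[OF poly GP G(2)] by blast
  then obtain H where H: "H facet_of ?P" "G \<subseteq> H" "\<not> F \<subseteq> H" using GF by blast
  have faceH: "H face_of ?P" using H facet_of_imp_face_of by blast
  have convF: "convex F" using face_of_imp_convex faceF by blast
  have HF: "H \<inter> F face_of F"
    by (rule face_of_subset[OF face_of_Int[OF faceH faceF]]) (use face_of_imp_subset[OF faceF] in auto)
  \<comment> \<open>\<open>G\<close> has codimension one in \<open>F\<close>, which leaves no room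
    for a face strictly between them.\<close>
  have "G = H \<inter> F"
  proof (rule ccontr)
    assume ne: "G \<noteq> H \<inter> F"
    have "G face_of H \<inter> F" by (rule face_of_subset[OF G(1)]) (use GF H in auto)
    then have "aff_dim G < aff_dim (H \<inter> F)"
      by (intro face_of_aff_dim_lt) (use ne face_of_imp_convex[OF HF] in auto)
    moreover have "aff_dim (H \<inter> F) < aff_dim F"
      by (intro face_of_aff_dim_lt convF HF) (use H in auto)
    ultimately show False using G(3) by simp
  qed
  obtain a b where ab: "H = ?P \<inter> {x. a \<bullet> x = b}" "\<forall>x\<in>X - H. a \<bullet> x = b + 1" "\<forall>p\<in>\<Lambda>. a \<bullet> p - b \<in> \<int>"
    using w1 H(1) unfolding width_one_def by blast
  have "G = F \<inter> {x. a \<bullet> x = b}" using \<open>G = H \<inter> F\<close> ab(1) face_of_imp_subset[OF faceF] by blast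
  moreover have "\<forall>x\<in>X \<inter> F - G. a \<bullet> x = b + 1" using \<open>G = H \<inter> F\<close> ab(2) by blast
  ultimately show "\<exists>a b. G = convex hull (X \<inter> F) \<inter> {x. a \<bullet> x = b} \<and>
      (\<forall>x\<in>X \<inter> F - G. a \<bullet> x = b + 1) \<and> (\<forall>p\<in>\<Lambda>. a \<bullet> p - b \<in> \<int>)"
    unfolding FX using ab(3) by blast
qed

text \<open>The facet functionals of a simplex are its barycentric coordinates.\<close>

lemma width_one_simplex_generates:
  fixes X :: "'a::euclidean_space set"
  assumes ind: "\<not> affine_dependent X" and w1: "width_one X \<Lambda>"
  shows "\<Lambda> \<inter> affine hull X \<subseteq> int_affine_hull X"
proof
  fix p assume p: "p \<in> \<Lambda> \<inter> affine hull X"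
  have fin: "finite X" using ind aff_independent_finite by blast
  obtain c where c: "sum c X = 1" "(\<Sum>x\<in>X. c x *\<^sub>R x) = p"
    using p affine_hull_finite[OF fin] by auto
  have int: "c x \<in> \<int>" if x: "x \<in> X" for x
  \<comment> \<open>A single point has no nonempty proper face, hence no facet; its coefficient is 1
    by normalization.\<close>
  proof (cases "X = {x}")
    case True
    then show ?thesis using c(1) by simp
  next
    case False
    let ?F = "convex hull (X - {x})"
    have "?F facet_of convex hull X"
      using facet_of_convex_hull_affine_independent[OF ind] x False by auto
    then obtain a b where ab: "?F = convex hull X \<inter> {x. a \<bullet> x = b}" "\<forall>x\<in>X - ?F. a \<bullet> x = b + 1"
      "\<forall>p\<in>\<Lambda>. a \<bullet> p - b \<in> \<int>"
      using w1 unfolding width_one_def by blast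
    have "x \<notin> affine hull (X - {x})" using ind x unfolding affine_dependent_def by blast
    then have "x \<notin> ?F" using convex_hull_subset_affine_hull by blast
    then have ax: "a \<bullet> x = b + 1" using ab(2) x by blast
    have ay: "a \<bullet> y = b" if "y \<in> X - {x}" for y
      using ab(1) hull_inc[OF that, of convex] by blast
    have "a \<bullet> p - b = (\<Sum>y\<in>X. c y * (a \<bullet> y)) - b * sum c X"
      using c by (simp add: inner_sum_right flip: c(2))
    also have "\<dots> = (\<Sum>y\<in>X. c y * (a \<bullet> y - b))"
      by (simp add: sum_distrib_left sum_subtractf algebra_simps)
    also have "\<dots> = c x * (a \<bullet> x - b) + (\<Sum>y\<in>X - {x}. c y * (a \<bullet> y - b))"
      by (rule sum.remove[OF fin x])
    also have "\<dots> = c x" using ax ay by simp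
    finally show ?thesis using ab(3) p by (metis IntD1)
  qed
  define k where "k = (\<lambda>x. \<lfloor>c x\<rfloor>)"
  have k: "of_int (k x) = c x" if "x \<in> X" for x using int[OF that] by (simp add: k_def of_int_floor_cancel)
  have "p = (\<Sum>x\<in>X. of_int (k x) *\<^sub>R x)" using c(2) k by (simp cong: sum.cong)
  moreover have "real_of_int (sum k X) = 1" using c(1) k by (simp cong: sum.cong)
  then have "sum k X = 1" by linarith
  ultimately show "p \<in> int_affine_hull X" unfolding int_affine_hull_def by blast
qed

text \<open>Writing \<open>q - t\<close> through \<open>v - t\<close> and the directions of
  \<open>F\<close>, the level of \<open>q\<close> fixes the coefficient of \<open>v - t\<close>; at
  the level of \<open>F\<close> it is zero.\<close>

lemma affine_hull_facet_cone_level: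
  fixes F :: "'a::euclidean_space set"
  assumes q: "q \<in> affine hull (insert v F)" and t: "t \<in> F" and F: "\<And>y. y \<in> F \<Longrightarrow> a \<bullet> y = b"
    and v: "a \<bullet> v \<noteq> b" and qb: "a \<bullet> q = b"
  shows "q \<in> affine hull F"
proof -
  have tv: "t \<in> insert v F" using t by simp
  have vF: "v \<notin> F" "v \<noteq> t" using F v t by auto
  have "q - t \<in> span ((\<lambda>x. - t + x) ` (insert v F - {t}))"
    using q unfolding affine_hull_span2[OF tv] by auto
  moreover have "(\<lambda>x. - t + x) ` (insert v F - {t}) = insert (v - t) ((\<lambda>x. - t + x) ` (F - {t}))"
    using vF by auto
  ultimately obtain k where k: "q - t - k *\<^sub>R (v - t) \<in> span ((\<lambda>x. - t + x) ` (F - {t}))"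
    by (auto simp: span_insert)
  have "span ((\<lambda>x. - t + x) ` (F - {t})) \<subseteq> {x. a \<bullet> x = 0}"
    by (rule span_minimal) (use F t in \<open>auto simp: subspace_hyperplane inner_diff_right\<close>)
  then have "a \<bullet> (q - t - k *\<^sub>R (v - t)) = 0" using k by blast
  then have "k * (a \<bullet> v - b) = 0" using F[OF t] qb by (simp add: inner_diff_right)
  then have "k = 0" using v by simp
  then have "q - t \<in> span ((\<lambda>x. - t + x) ` (F - {t}))" using k by simp
  then have "t + (q - t) \<in> affine hull F" unfolding affine_hull_span2[OF t] by (rule imageI)
  then show ?thesis by simp
qed

text \<open>Induction along the recursion. A lattice point at level \<open>m\<close> above the facet
  is moved down by \<open>m\<close> times \<open>v - t\<close>, where \<open>v\<close> is the apex
  and \<open>t\<close> a vertex in the facet. The result is still in \<Lambda> and lies in the hull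
  of the facet, where the induction hypothesis applies.\<close>

lemma pulling_triangulation_generates:
  assumes "\<sigma> \<in> pulling_triangulation xs" "xs \<noteq> []" "width_one (set xs) \<Lambda>" "set xs \<subseteq> \<Lambda>"
    and closed: "\<And>p q r m. p \<in> \<Lambda> \<Longrightarrow> q \<in> \<Lambda> \<Longrightarrow> r \<in> \<Lambda> \<Longrightarrow> p + of_int m *\<^sub>R (q - r) \<in> \<Lambda>"
  shows "\<Lambda> \<inter> affine hull (set xs) \<subseteq> int_affine_hull \<sigma>"
  using assms(1-4)
proof (induction xs arbitrary: \<sigma> rule: pulling_triangulation.induct)
  case (1 xs)
  show ?case
  proof (cases "affine_dependent (set xs)")
    case False
    then have "\<sigma> = set xs" using 1(2) by (subst (asm) pulling_triangulation.simps) auto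
    then show ?thesis using width_one_simplex_generates[OF False 1(4)] by simp
  next
    case True
    then obtain F \<tau> where F: "F facet_of convex hull (set xs)" "hd xs \<notin> F"
      and \<tau>: "\<tau> \<in> pulling_triangulation (filter (\<lambda>x. x \<in> F) xs)" and \<sigma>: "\<sigma> = insert (hd xs) \<tau>"
      using 1(2) by (subst (asm) pulling_triangulation.simps) auto
    define v where "v = hd xs"
    have v: "v \<in> set xs" "v \<notin> F" using 1(3) F(2) by (auto simp: v_def)
    have face: "F face_of convex hull (set xs)" using F(1) facet_of_imp_face_of by blast
    have FX: "convex hull (set xs \<inter> F) = F" by (rule convex_hull_face_points) (use face in auto)
    have ne: "filter (\<lambda>x. x \<in> F) xs \<noteq> []" by (rule facet_filter_nonempty[OF F(1)])
    have set: "set (filter (\<lambda>x. x \<in> F) xs) = set xs \<inter> F" by auto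
    have simplex: "\<tau> \<subseteq> set xs \<inter> F" "\<not> affine_dependent \<tau>" "affine hull \<tau> = affine hull (set xs \<inter> F)"
      using pulling_triangulation_simplex[OF \<tau> ne] unfolding set by auto
    have hullF: "affine hull (set xs \<inter> F) = affine hull F" using FX affine_hull_convex_hull by metis
    have IH: "\<Lambda> \<inter> affine hull F \<subseteq> int_affine_hull \<tau>"
      using 1(1)[OF _ _ \<tau> ne] True F width_one_facet[OF _ 1(4) F(1)] 1(5) unfolding set hullF by auto
    have "\<tau> \<noteq> {}" using simplex(3) hullF F(1) by (auto simp: facet_of_def affine_hull_eq_empty)
    then obtain t where t: "t \<in> \<tau>" by blast
    have fin: "finite \<tau>" using simplex(2) aff_independent_finite by blast
    obtain a b where ab: "F = convex hull (set xs) \<inter> {x. a \<bullet> x = b}" "\<forall>x\<in>set xs - F. a \<bullet> x = b + 1"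
      "\<forall>p\<in>\<Lambda>. a \<bullet> p - b \<in> \<int>"
      using 1(4) F(1) unfolding width_one_def by blast
    have av: "a \<bullet> v = b + 1" using ab(2) v by blast
    have tF: "t \<in> F" "t \<in> set xs" using t simplex(1) by auto
    have at: "a \<bullet> t = b" using tF(1) ab(1) by blast
    show ?thesis
    proof
      fix p assume p: "p \<in> \<Lambda> \<inter> affine hull (set xs)"
      obtain m where m: "a \<bullet> p - b = of_int m" using ab(3) p by (meson Int_iff Ints_cases)
      define q where "q = p + of_int (- m) *\<^sub>R (v - t)"
      have "q \<in> \<Lambda>" unfolding q_def using p v tF 1(5) by (intro closed) auto
      moreover have "q \<in> affine hull F"
      proof (rule affine_hull_facet_cone_level[OF _ tF(1)])
        have "v \<in> affine hull (set xs)" "t \<in> affine hull (set xs)" using v tF by (auto intro: hull_inc)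
        then have "q \<in> affine hull (set xs)"
          unfolding q_def using p by (intro mem_affine_3_minus) (auto simp: affine_affine_hull)
        then show "q \<in> affine hull (insert v F)" using affine_hull_cone_facet[OF F(1) v] by simp
        show "a \<bullet> v \<noteq> b" using av by simp
        show "a \<bullet> q = b" using m av at by (simp add: q_def inner_diff_right inner_add_right)
      qed (use ab(1) in blast)
      ultimately obtain k where k: "q = (\<Sum>y\<in>\<tau>. of_int (k y) *\<^sub>R y)" "sum k \<tau> = (1::int)"
        using IH unfolding int_affine_hull_def by blast
      \<comment> \<open>The apex receives \<open>m\<close>, and the same amount is taken from
        \<open>t\<close>, which keeps the sum of the coefficients at 1.\<close>
      define k' where "k' = (\<lambda>y. if y = v then m else k y - (if y = t then m else 0))"
      have v\<tau>: "v \<notin> \<tau>" using simplex(1) v by auto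
      have "(\<Sum>y\<in>\<sigma>. of_int (k' y) *\<^sub>R y) = of_int m *\<^sub>R v + (\<Sum>y\<in>\<tau>. of_int (k' y) *\<^sub>R y)"
        unfolding \<sigma> v_def[symmetric] using fin v\<tau> by (simp add: k'_def)
      also have "(\<Sum>y\<in>\<tau>. of_int (k' y) *\<^sub>R y) = (\<Sum>y\<in>\<tau>. of_int (k y) *\<^sub>R y - (if y = t then of_int m *\<^sub>R y else 0))"
        using v\<tau> by (intro sum.cong) (auto simp: k'_def scaleR_left_diff_distrib)
      also have "\<dots> = q - of_int m *\<^sub>R t" using fin t k(1) by (simp add: sum_subtractf)
      finally have "(\<Sum>y\<in>\<sigma>. of_int (k' y) *\<^sub>R y) = p" by (simp add: q_def scaleR_right_diff_distrib)
      moreover have "sum k' \<sigma> = 1"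
      proof -
        have "sum k' \<sigma> = m + sum k' \<tau>" unfolding \<sigma> v_def[symmetric] using fin v\<tau> by (simp add: k'_def)
        also have "sum k' \<tau> = (\<Sum>y\<in>\<tau>. k y - (if y = t then m else 0))"
          using v\<tau> by (intro sum.cong) (auto simp: k'_def)
        also have "\<dots> = 1 - m" using fin t k(2) by (simp add: sum_subtractf)
        finally show ?thesis by simp
      qed
      ultimately show "p \<in> int_affine_hull \<sigma>" unfolding int_affine_hull_def by blast
    qed
  qed
qed

lemma width_one_imp_compressed:
  fixes P :: "(real^'m) set"
  assumes ne: "P \<inter> L \<noteq> {}" and hull: "convex hull (P \<inter> L) = P" and w1: "width_one (P \<inter> L) L"
    and closed: "\<And>p q r m. p \<in> L \<Longrightarrow> q \<in> L \<Longrightarrow> r \<in> L \<Longrightarrow> p + of_int m *\<^sub>R (q - r) \<in> L"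
  shows "compressed L P"
  unfolding compressed_def unimodular_simplex_def
proof (intro allI impI ballI, elim conjE)
  fix xs \<sigma> C
  assume xs: "distinct xs" "set xs = P \<inter> L" and \<sigma>: "\<sigma> \<in> pulling_triangulation xs"
    and C: "C \<subseteq> P \<inter> L" "\<not> affine_dependent C" "aff_dim C = aff_dim P"
  have nil: "xs \<noteq> []" using ne xs(2) by auto
  have affP: "affine hull (set xs) = affine hull P" unfolding xs(2) using hull affine_hull_convex_hull by metis
  have s: "\<not> affine_dependent \<sigma>" "affine hull \<sigma> = affine hull P"
    using pulling_triangulation_simplex[OF \<sigma> nil] affP by auto
  have gen: "L \<inter> affine hull P \<subseteq> int_affine_hull \<sigma>"
    using pulling_triangulation_generates[OF \<sigma> nil _ _ closed] w1 affP unfolding xs(2) by auto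
  have "C \<subseteq> L \<inter> affine hull P" using C(1) by (auto intro: hull_inc)
  then have "C \<subseteq> int_affine_hull \<sigma>" using gen by blast
  moreover have "affine hull C = affine hull P"
  proof (rule affine_dim_equal)
    have "P \<noteq> {}" using ne by blast
    then have "C \<noteq> {}" using C(3) by (metis aff_dim_empty)
    then show "affine hull C \<noteq> {}" by (simp add: affine_hull_eq_empty)
    show "affine hull C \<subseteq> affine hull P" using C(1) by (intro hull_mono) auto
  qed (use C(3) in \<open>auto simp: affine_affine_hull\<close>)
  ultimately show "rel_volume (convex hull \<sigma>) \<le> rel_volume (convex hull C)"
    using rel_volume_le_int_affine_hull[OF s(1) C(2)] s(2) by simp
qed

section \<open>Graphs without \<open>K\<^sub>4\<close> minor and long induced cycles\<close>

abbreviation edge_rel :: "'v set set \<Rightarrow> 'v set \<Rightarrow> ('v \<times> 'v) set" where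
  "edge_rel E S \<equiv> {(x, y). x \<in> S \<and> y \<in> S \<and> {x, y} \<in> E}"

definition graph_component :: "'v set set \<Rightarrow> 'v set \<Rightarrow> 'v \<Rightarrow> 'v set" where
  "graph_component E S x = (edge_rel E S)\<^sup>* `` {x}"

definition touches :: "'v set set \<Rightarrow> 'v set \<Rightarrow> 'v set \<Rightarrow> bool" where
  "touches E X Y \<longleftrightarrow> (\<exists>x\<in>X. \<exists>y\<in>Y. {x, y} \<in> E)"

lemma touches_commute: "touches E X Y \<longleftrightarrow> touches E Y X"
  unfolding touches_def by (metis insert_commute)

lemma touchesI: "x \<in> X \<Longrightarrow> y \<in> Y \<Longrightarrow> {x, y} \<in> E \<Longrightarrow> touches E X Y"
  unfolding touches_def by blast

lemma sym_edge_rel: "sym (edge_rel E S)"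
  by (auto simp: sym_def insert_commute)

lemma edge_rel_rtrancl_sym: "(x, y) \<in> (edge_rel E S)\<^sup>* \<Longrightarrow> (y, x) \<in> (edge_rel E S)\<^sup>*"
  by (rule symD[OF sym_rtrancl[OF sym_edge_rel]])

lemma mem_component_self: "x \<in> graph_component E S x"
  by (simp add: graph_component_def)

lemma component_subset:
  assumes "x \<in> S"
  shows "graph_component E S x \<subseteq> S"
proof
  fix y assume "y \<in> graph_component E S x"
  then have "(x, y) \<in> (edge_rel E S)\<^sup>*" by (simp add: graph_component_def)
  then show "y \<in> S" using assms by (induction) auto
qed

lemma component_closed:
  assumes "y \<in> graph_component E S x" "x \<in> S" "z \<in> S" "{y, z} \<in> E"
  shows "z \<in> graph_component E S x"
proof -
  have "y \<in> S" using assms component_subset by fast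
  then have "(y, z) \<in> edge_rel E S" using assms by simp
  then show ?thesis using assms(1) unfolding graph_component_def
    by (auto intro: rtrancl_into_rtrancl)
qed

lemma connected_component:
  assumes "x \<in> S"
  shows "connected_in E (graph_component E S x)"
proof -
  let ?C = "graph_component E S x"
  have to: "(x, y) \<in> (edge_rel E ?C)\<^sup>*" if "y \<in> ?C" for y
  proof -
    from that have "(x, y) \<in> (edge_rel E S)\<^sup>*" by (simp add: graph_component_def)
    then show ?thesis
    proof induction
      case (step y z)
      then have "y \<in> ?C" "z \<in> ?C" "{y, z} \<in> E"
        by (auto simp: graph_component_def intro: rtrancl_into_rtrancl)
      then show ?case using step.IH by (auto intro: rtrancl_into_rtrancl)
    qed simp
  qed
  have "(y, z) \<in> (edge_rel E ?C)\<^sup>*" if "y \<in> ?C" "z \<in> ?C" for y z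
  proof -
    have "(y, x) \<in> (edge_rel E ?C)\<^sup>*"
      by (rule edge_rel_rtrancl_sym[OF to[OF that(1)]])
    then show ?thesis using to[OF that(2)] by simp
  qed
  then show ?thesis using mem_component_self[of x E S] unfolding connected_in_def by blast
qed

lemma component_eq:
  assumes "y \<in> graph_component E S x"
  shows "graph_component E S y = graph_component E S x"
proof -
  have "(x, y) \<in> (edge_rel E S)\<^sup>*" using assms by (simp add: graph_component_def)
  moreover from this have "(y, x) \<in> (edge_rel E S)\<^sup>*"
    by (rule edge_rel_rtrancl_sym)
  ultimately show ?thesis by (auto simp: graph_component_def)
qed

lemma connected_singleton: "connected_in E {x}"
  by (auto simp: connected_in_def)

lemma edge_rel_rtrancl_mono: "X \<subseteq> Y \<Longrightarrow> (x, y) \<in> (edge_rel E X)\<^sup>* \<Longrightarrow> (x, y) \<in> (edge_rel E Y)\<^sup>*"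
  by (rule subsetD[OF rtrancl_mono]) auto

lemma connected_insert:
  assumes "connected_in E B" "y \<in> B" "{x, y} \<in> E"
  shows "connected_in E (insert x B)"
proof -
  let ?R = "edge_rel E (insert x B)"
  have to: "(y, z) \<in> ?R\<^sup>*" if "z \<in> insert x B" for z
  proof (cases "z = x")
    case True
    have "(y, x) \<in> ?R" using assms by (auto simp: insert_commute)
    then show ?thesis using True by auto
  next
    case False
    then have "(y, z) \<in> (edge_rel E B)\<^sup>*" using assms that unfolding connected_in_def by blast
    then show ?thesis by (rule edge_rel_rtrancl_mono[rotated]) auto
  qed
  have "(u, v) \<in> ?R\<^sup>*" if "u \<in> insert x B" "v \<in> insert x B" for u v
    by (rule rtrancl_trans[OF edge_rel_rtrancl_sym[OF to[OF that(1)]] to[OF that(2)]])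
  then show ?thesis unfolding connected_in_def by blast
qed

lemma connected_boundary_edge:
  assumes "connected_in E D" "x \<in> X" "x \<in> D" "y \<in> D" "y \<notin> X"
  shows "\<exists>u\<in>X \<inter> D. \<exists>v\<in>D - X. {u, v} \<in> E"
proof (rule ccontr)
  assume neg: "\<not> ?thesis"
  have "(x, y) \<in> (edge_rel E D)\<^sup>*" using assms unfolding connected_in_def by blast
  then have "y \<in> X"
  proof induction
    case base then show ?case using assms by simp
  next
    case (step y z) then show ?case using neg by auto
  qed
  then show False using assms by simp
qed

abbreviation K4_minor :: "'v set set \<Rightarrow> bool" where
  "K4_minor E \<equiv> has_minor UNIV E {0..<4::nat} (complete_edges {0..<4})"

section \<open>Building K4 models and induced paths\<close>

lemma K4_minorI:
  assumes "connected_in E B0" "connected_in E B1" "connected_in E B2" "connected_in E B3"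
    and "B0 \<inter> B1 = {}" "B0 \<inter> B2 = {}" "B0 \<inter> B3 = {}" "B1 \<inter> B2 = {}" "B1 \<inter> B3 = {}" "B2 \<inter> B3 = {}"
    and "touches E B0 B1" "touches E B0 B2" "touches E B0 B3"
    and "touches E B1 B2" "touches E B1 B3" "touches E B2 B3"
  shows "K4_minor E"
proof -
  define B where "B = (\<lambda>i::nat. if i = 0 then B0 else if i = 1 then B1 else if i = 2 then B2 else B3)"
  have four: "{0..<4::nat} = {0, 1, 2, 3}" by auto
  have conn: "\<forall>w\<in>{0..<4}. B w \<subseteq> UNIV \<and> connected_in E (B w)"
    using assms by (auto simp: B_def)
  have disj: "disjoint_family_on B {0..<4}"
    using assms unfolding disjoint_family_on_def four by (simp add: B_def) blast
  have edges: "touches E (B w) (B w')" if "{w, w'} \<in> complete_edges {0..<4}" for w w'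
  proof -
    have "w \<noteq> w'" "w \<in> {0, 1, 2, 3}" "w' \<in> {0, 1, 2, 3}"
      using that unfolding complete_edges_def four[symmetric] by (auto simp: card_insert_if)
    then show ?thesis using assms touches_commute[of E] by (auto simp: B_def)
  qed
  show ?thesis unfolding has_minor_def
    using conn disj edges unfolding touches_def by (intro exI[of _ B]) blast
qed

text \<open>Take the least \<open>n\<close> with a walk of \<open>n\<close> steps: a repeated vertex
  or an edge skipping ahead would give a shorter walk.\<close>

lemma shortest_induced_path:
  assumes "(a, b) \<in> (edge_rel E S)\<^sup>*"
  obtains f n where "f 0 = a" "f n = b" "\<And>i. i < n \<Longrightarrow> (f i, f (Suc i)) \<in> edge_rel E S"
    "\<And>i j. i < j \<Longrightarrow> j \<le> n \<Longrightarrow> f i \<noteq> f j"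
    "\<And>i j. i < j \<Longrightarrow> j \<le> n \<Longrightarrow> (f i, f j) \<in> edge_rel E S \<Longrightarrow> j = Suc i"
proof -
  let ?R = "edge_rel E S"
  define n where "n = (LEAST k. (a, b) \<in> ?R ^^ k)"
  have "\<exists>k. (a, b) \<in> ?R ^^ k" using assms rtrancl_power by blast
  then have n: "(a, b) \<in> ?R ^^ n" unfolding n_def by (metis (mono_tags, lifting) LeastI_ex)
  have least: "n \<le> k" if "(a, b) \<in> ?R ^^ k" for k
    unfolding n_def by (rule Least_le) (fact that)
  obtain f where f: "f 0 = a" "f n = b" "\<And>i. i < n \<Longrightarrow> (f i, f (Suc i)) \<in> ?R"
    using n unfolding relpow_fun_conv by blast
  have sub: "(f i, f j) \<in> ?R ^^ (j - i)" if "i \<le> j" "j \<le> n" for i j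
    unfolding relpow_fun_conv using that f(3) by (intro exI[of _ "\<lambda>k. f (i + k)"]) auto
  have short: "j \<le> i + m" if "i \<le> j" "j \<le> n" "(f i, f j) \<in> ?R ^^ m" for i j m
  proof -
    have "(f 0, f j) \<in> ?R ^^ (i + m)"
      using sub[of 0 i] that relpow_add[of i m ?R] by auto
    then have "(f 0, f n) \<in> ?R ^^ ((i + m) + (n - j))"
      using sub[of j n] that relpow_add[of "i + m" "n - j" ?R] by auto
    then have "n \<le> (i + m) + (n - j)" using least f by simp
    then show ?thesis using that by simp
  qed
  show thesis
  proof (rule that[of f n, OF f])
    fix i j assume ij: "i < j" "j \<le> n"
    show "f i \<noteq> f j" using short[of i j 0] ij by auto
    show "j = Suc i" if "(f i, f j) \<in> ?R" using short[of i j 1] ij that by auto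
  qed auto
qed

section \<open>Separations along small cliques and the structure theorem\<close>

text \<open>In a graph these are precisely the faces of the complex. Larger cliques are left out
  because only moments on faces are recorded, so distributions can be compared only there.\<close>

definition small_clique :: "'v set set \<Rightarrow> 'v set \<Rightarrow> bool" where
  "small_clique E K \<longleftrightarrow> K = {} \<or> (\<exists>x. K = {x}) \<or> K \<in> E"

locale short_cycle_graph =
  fixes E :: "'v set set"
  assumes card_edge: "e \<in> E \<Longrightarrow> card e = 2"
    and no_K4: "\<not> K4_minor E"
    and short_cycles: "graph_cycle E vs \<Longrightarrow> \<not> cycle_has_chord E vs \<Longrightarrow> length vs \<le> 4"
begin

lemma no_loop: "{x} \<notin> E"
  using card_edge[of "{x}"] by auto

text \<open>A shortest path from \<open>a\<close> to \<open>b\<close> through \<open>D\<close>,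
  closed up by \<open>c\<close>, is an induced cycle: \<open>c\<close> has no neighbour in
  \<open>D\<close> and \<open>a\<close>, \<open>b\<close> are not adjacent. Its length is at most
  four, so the path has a single inner vertex.\<close>

lemma common_neighbour:
  assumes D: "connected_in E D" "a \<notin> D" "b \<notin> D" "touches E {a} D" "touches E {b} D"
    and ab: "a \<noteq> b" "{a, b} \<notin> E"
    and c: "c \<notin> D" "{c, a} \<in> E" "{c, b} \<in> E" "\<not> touches E {c} D"
  shows "\<exists>d\<in>D. {a, d} \<in> E \<and> {b, d} \<in> E"
proof -
  let ?S = "insert a (insert b D)"
  obtain a' b' where a': "a' \<in> D" "{a, a'} \<in> E" and b': "b' \<in> D" "{b, b'} \<in> E"
    using D(4,5) unfolding touches_def by blast
  have "connected_in E ?S"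
    using connected_insert[OF connected_insert[OF D(1) b'], of a' a] a' by blast
  then have "(a, b) \<in> (edge_rel E ?S)\<^sup>*" unfolding connected_in_def by blast
  then obtain f n where f: "f 0 = a" "f n = b"
    and step: "\<And>i. i < n \<Longrightarrow> (f i, f (Suc i)) \<in> edge_rel E ?S"
    and inj: "\<And>i j. i < j \<Longrightarrow> j \<le> n \<Longrightarrow> f i \<noteq> f j"
    and ind: "\<And>i j. i < j \<Longrightarrow> j \<le> n \<Longrightarrow> (f i, f j) \<in> edge_rel E ?S \<Longrightarrow> j = Suc i"
    by (rule shortest_induced_path) (rule that)
  have n0: "n \<noteq> 0" using f ab by metis
  have n1: "n \<noteq> 1" using f step[of 0] ab by auto
  have inS: "f i \<in> ?S" if "i \<le> n" for i
    using step[of i] f that by (cases "i = n") auto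
  have inner: "f i \<in> D" if "0 < i" "i < n" for i
    using inS[of i] inj[of 0 i] inj[of i n] that f by auto
  have cnot: "f i \<noteq> c" if "i \<le> n" for i
    using inS[OF that] c no_loop by auto
  have cadj: "i = 0 \<or> i = n" if "i \<le> n" "{c, f i} \<in> E" for i
    using inner[of i] that c(4) unfolding touches_def by (cases "0 < i \<and> i < n") auto
  have ind': "j = Suc i" if "i < j" "j \<le> n" "{f i, f j} \<in> E" for i j
    using ind[OF that(1,2)] that inS[of i] inS[of j] by auto
  show ?thesis
  proof (cases "n = 2")
    case True
    then have "f 1 \<in> D" "{f 0, f 1} \<in> E" "{f 1, f 2} \<in> E"
      using inner[of 1] step[of 0] step[of 1] by (auto simp: numeral_2_eq_2)
    then show ?thesis using f True by (metis insert_commute)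
  next
    case False
    then have n: "3 \<le> n" using n0 n1 by simp
    \<comment> \<open>Position 0 holds \<open>c\<close> and position \<open>i\<close> holds
      \<open>f (i - 1)\<close>, so the cycle has length \<open>n + 2\<close>, at least five in this
      case.\<close>
    let ?vs = "c # map f [0..<Suc n]"
    have len: "length ?vs = n + 2" by simp
    have nth: "?vs ! i = (if i = 0 then c else f (i - 1))" if "i < n + 2" for i
      using that by (cases i) (auto simp del: upt_Suc)
    have "distinct (map f [0..<Suc n])"
      by (auto simp: distinct_map inj_on_def simp del: upt_Suc)
         (metis inj less_Suc_eq_le linorder_neqE_nat)
    moreover have "c \<notin> set (map f [0..<Suc n])"
    proof
      assume "c \<in> set (map f [0..<Suc n])"
      then obtain i where "i < Suc n" "f i = c" by (auto simp del: upt_Suc)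
      then show False using cnot[of i] by simp
    qed
    ultimately have "distinct ?vs" by (simp del: upt_Suc)
    moreover have "{?vs ! i, ?vs ! (Suc i mod length ?vs)} \<in> E" if i: "i < n + 2" for i
    proof -
      consider "i = 0" | "0 < i" "i < n + 1" | "i = n + 1" using i by linarith
      then show ?thesis
      proof cases
        case 1 then show ?thesis using c f n by (simp add: nth del: upt_Suc)
      next
        case 2
        then have "{f (i - 1), f (Suc (i - 1))} \<in> E" using step[of "i - 1"] by auto
        then show ?thesis using 2 unfolding len by (simp add: nth del: upt_Suc)
      next
        case 3
        then have "Suc i mod length ?vs = 0" unfolding len by simp
        then show ?thesis using 3 c f by (simp add: nth insert_commute del: upt_Suc)
      qed
    qed
    ultimately have cyc: "graph_cycle E ?vs"
      unfolding graph_cycle_def using n by (simp add: len del: upt_Suc)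
    have key: "j = Suc i mod (n + 2) \<or> i = Suc j mod (n + 2)"
      if ij: "i < j" "j < n + 2" and e: "{?vs ! i, ?vs ! j} \<in> E" for i j
    proof (cases "i = 0")
      case True
      then have "{c, f (j - 1)} \<in> E" using e ij nth by (metis gr_implies_not0 n n0 zero_less_iff_neq_zero less_trans)
      then have "j - 1 = 0 \<or> j - 1 = n" using cadj[of "j - 1"] ij by simp
      then show ?thesis using True ij by auto
    next
      case False
      then have "{f (i - 1), f (j - 1)} \<in> E" using e ij by (simp add: nth del: upt_Suc)
      then have "j - 1 = Suc (i - 1)" using ind'[of "i - 1" "j - 1"] ij False by auto
      then show ?thesis using ij False by auto
    qed
    have "\<not> cycle_has_chord E ?vs"
    proof
      assume "cycle_has_chord E ?vs"
      then obtain i j where "i < n + 2" "j < n + 2" and e: "{?vs ! i, ?vs ! j} \<in> E"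
        and nb: "j \<noteq> Suc i mod (n + 2)" "i \<noteq> Suc j mod (n + 2)"
        unfolding cycle_has_chord_def len by blast
      moreover have "i \<noteq> j" using e no_loop by auto
      ultimately show False
        using key[of i j] key[of j i] by (metis insert_commute linorder_neqE_nat)
    qed
    then show ?thesis using short_cycles[OF cyc] n by (simp add: len del: upt_Suc)
  qed
qed

text \<open>Vertices are removed one at a time. Without \<open>c\<close>, the component of
  \<open>d\<close> can be left only through \<open>c\<close>, from a vertex \<open>u\<close> other
  than \<open>d\<close> since \<open>c\<close> and \<open>d\<close> are not adjacent. Without
  \<open>d\<close> as well, the component of \<open>u\<close> is still attached to
  \<open>d\<close>.\<close>

lemma bridge_component:
  assumes "c \<in> T" "d \<in> graph_component E T c" "c \<noteq> d" "{c, d} \<notin> E"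
  obtains z where "z \<in> T - {c, d}" "touches E {c} (graph_component E (T - {c, d}) z)"
    "touches E {d} (graph_component E (T - {c, d}) z)"
proof -
  have dT: "d \<in> T" using assms component_subset by fast
  let ?Dd = "graph_component E (T - {c}) d"
  have dT': "d \<in> T - {c}" using dT assms by simp
  have sub: "?Dd \<subseteq> T - {c}" using component_subset[OF dT'] .
  obtain u v where uv: "u \<in> ?Dd" "v \<in> graph_component E T c" "v \<notin> ?Dd" "{u, v} \<in> E"
    using connected_boundary_edge[OF connected_component[OF assms(1), of E], of d ?Dd c]
      mem_component_self[of d E] mem_component_self[of c E] sub assms(2) by blast
  have "v \<in> T" using uv component_subset[OF assms(1)] by fast
  then have "v = c" using component_closed[OF uv(1) dT' _ uv(4)] uv(3) by blast
  have ud: "u \<noteq> d" using uv \<open>v = c\<close> assms by (metis insert_commute)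
  let ?Y = "graph_component E (T - {c, d}) u"
  have uT: "u \<in> T - {c, d}" using uv sub ud by auto
  have Ysub: "?Y \<subseteq> T - {c, d}" using component_subset[OF uT] .
  obtain x y where xy: "x \<in> ?Y" "y \<in> ?Dd" "y \<notin> ?Y" "{x, y} \<in> E"
    using connected_boundary_edge[OF connected_component[OF dT', of E], of u ?Y d]
      mem_component_self[of d E] mem_component_self[of u E] uv Ysub by blast
  have "y \<in> T - {c}" using xy sub by blast
  then have "y = d" using component_closed[OF xy(1) uT _ xy(4)] xy(3) by blast
  show thesis
  proof (rule that[OF uT])
    show "touches E {c} ?Y" using uv \<open>v = c\<close> mem_component_self[of u E]
      by (metis insert_commute singletonI touchesI)
    show "touches E {d} ?Y" using xy \<open>y = d\<close>
      by (metis insert_commute singletonI touchesI)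
  qed
qed

text \<open>Otherwise there are bridges \<open>Y\<close> between \<open>c\<close> and
  \<open>d\<close> and \<open>Z\<close> between \<open>a\<close> and \<open>b\<close>, both
  components of the rest. If they coincide, \<open>Y\<close>, {a,c}, {b}, {d} are the branch sets of
  a K4 minor; if they are disjoint, \<open>Y\<close> with \<open>c\<close>, \<open>Z\<close> with
  \<open>a\<close>, {b} and {d} are.\<close>

lemma four_cycle_separates:
  assumes "a \<in> V" "b \<in> V" "c \<in> V" "d \<in> V" "distinct [a, b, c, d]"
    and "{a, c} \<in> E" "{c, b} \<in> E" "{b, d} \<in> E" "{d, a} \<in> E" "{a, b} \<notin> E" "{c, d} \<notin> E"
  shows "d \<notin> graph_component E (V - {a, b}) c \<or> b \<notin> graph_component E (V - {c, d}) a"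
proof (rule ccontr)
  assume "\<not> ?thesis"
  then have dc: "d \<in> graph_component E (V - {a, b}) c" and ba: "b \<in> graph_component E (V - {c, d}) a"
    by auto
  let ?R = "V - {a, b, c, d}"
  have R: "V - {a, b} - {c, d} = ?R" "V - {c, d} - {a, b} = ?R" by auto
  obtain y where y: "y \<in> ?R" "touches E {c} (graph_component E ?R y)"
    "touches E {d} (graph_component E ?R y)"
    using bridge_component[OF _ dc] assms unfolding R by auto
  obtain z where z: "z \<in> ?R" "touches E {a} (graph_component E ?R z)"
    "touches E {b} (graph_component E ?R z)"
    using bridge_component[OF _ ba] assms unfolding R by auto
  let ?Y = "graph_component E ?R y" and ?Z = "graph_component E ?R z"
  have Y: "connected_in E ?Y" "?Y \<subseteq> ?R" using connected_component component_subset y(1) by metis+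
  have Z: "connected_in E ?Z" "?Z \<subseteq> ?R" using connected_component component_subset z(1) by metis+
  have "K4_minor E"
  proof (cases "?Y \<inter> ?Z = {}")
    case False
    then have eq: "?Z = ?Y" using component_eq by (metis disjoint_iff)
    have ac: "connected_in E {a, c}"
      using connected_insert[OF connected_singleton, of c c a] assms by simp
    show ?thesis
      using y z Y assms unfolding eq
      by (intro K4_minorI[OF Y(1) ac connected_singleton[of E b] connected_singleton[of E d]])
         (auto simp: touches_def insert_commute)
  next
    case True
    obtain y' where y': "y' \<in> ?Y" "{c, y'} \<in> E" using y(2) unfolding touches_def by blast
    obtain z' where z': "z' \<in> ?Z" "{a, z'} \<in> E" using z(2) unfolding touches_def by blast
    show ?thesis
      using y z Y Z True assms
      by (intro K4_minorI[OF connected_insert[OF Y(1) y'] connected_insert[OF Z(1) z']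
            connected_singleton[of E b] connected_singleton[of E d]])
         (auto simp: touches_def insert_commute)
  qed
  then show False using no_K4 by simp
qed

definition separation :: "'v set \<Rightarrow> 'v set \<Rightarrow> 'v set \<Rightarrow> bool" where
  "separation V A B \<longleftrightarrow> A \<union> B = V \<and> A \<noteq> V \<and> B \<noteq> V \<and> \<not> touches E (A - B) (B - A)"

lemma separation_component:
  assumes "D \<subseteq> V" "D \<noteq> {}" "S \<subseteq> V - D" "v \<in> V" "v \<notin> D" "v \<notin> S"
    and "\<And>x z. x \<in> D \<Longrightarrow> z \<in> V - D \<Longrightarrow> {x, z} \<in> E \<Longrightarrow> z \<in> S"
  shows "separation V (D \<union> S) (V - D)" "(D \<union> S) \<inter> (V - D) = S"
proof -
  show "(D \<union> S) \<inter> (V - D) = S" using assms(3) by blast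
  have "D \<union> S \<union> (V - D) = V" "D \<union> S \<noteq> V" "V - D \<noteq> V" using assms(1-6) by blast+
  moreover have "\<not> touches E (D \<union> S - (V - D)) (V - D - (D \<union> S))"
    using assms(3,7) unfolding touches_def by blast
  ultimately show "separation V (D \<union> S) (V - D)" unfolding separation_def by blast
qed

text \<open>The component touches both \<open>a\<close> and \<open>b\<close>, since otherwise a
  single vertex would separate. As \<open>e\<close> has no neighbour in it, it contains a common
  neighbour \<open>m\<close> of \<open>a\<close> and \<open>b\<close>. A further part
  \<open>D'\<close> of it that touches \<open>a\<close> and \<open>b\<close> gives a K4 minor on
  \<open>D'\<close>, {m}, {a,e}, {b}; one that misses \<open>a\<close> or \<open>b\<close> is cut
  off by an edge at \<open>m\<close>.\<close>

lemma component_is_common_neighbour: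
  assumes ab: "a \<in> V" "b \<in> V" "a \<noteq> b" "{a, b} \<notin> E"
    and x: "x \<in> V - {a, b}"
    and e: "e \<in> V - {a, b}" "e \<notin> graph_component E (V - {a, b}) x" "{e, a} \<in> E" "{e, b} \<in> E"
    and nosep: "\<And>A B. separation V A B \<Longrightarrow> \<not> small_clique E (A \<inter> B)"
  shows "graph_component E (V - {a, b}) x = {x}" "{x, a} \<in> E" "{x, b} \<in> E"
proof -
  let ?D = "graph_component E (V - {a, b}) x"
  have sub: "?D \<subseteq> V - {a, b}" using component_subset[OF x] .
  have conn: "connected_in E ?D" using connected_component[OF x] .
  have xD: "x \<in> ?D" by (rule mem_component_self)
  have nb: "z \<in> {a, b}" if "y \<in> ?D" "z \<in> V - ?D" "{y, z} \<in> E" for y z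
    using component_closed[OF that(1) x _ that(3)] that by blast
  have ta: "touches E {a} ?D"
  proof (rule ccontr)
    assume no: "\<not> touches E {a} ?D"
    have "separation V (?D \<union> {b}) (V - ?D)" "(?D \<union> {b}) \<inter> (V - ?D) = {b}"
    proof (rule separation_component[of _ _ _ a])
      fix w z assume "w \<in> ?D" "z \<in> V - ?D" "{w, z} \<in> E"
      then show "z \<in> {b}" using nb[of w z] no touchesI[of a "{a}" w ?D E]
        by (auto simp: insert_commute)
    qed (use sub ab xD in auto)
    then show False using nosep[of "?D \<union> {b}" "V - ?D"] by (simp add: small_clique_def)
  qed
  have tb: "touches E {b} ?D"
  proof (rule ccontr)
    assume no: "\<not> touches E {b} ?D"
    have "separation V (?D \<union> {a}) (V - ?D)" "(?D \<union> {a}) \<inter> (V - ?D) = {a}"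
    proof (rule separation_component[of _ _ _ b])
      fix w z assume "w \<in> ?D" "z \<in> V - ?D" "{w, z} \<in> E"
      then show "z \<in> {a}" using nb[of w z] no touchesI[of b "{b}" w ?D E]
        by (auto simp: insert_commute)
    qed (use sub ab xD in auto)
    then show False using nosep[of "?D \<union> {a}" "V - ?D"] by (simp add: small_clique_def)
  qed
  have noe: "\<not> touches E {e} ?D"
    using component_closed[OF _ x e(1)] e(2) unfolding touches_def by (metis insert_commute singletonD)
  obtain m where m: "m \<in> ?D" "{a, m} \<in> E" "{b, m} \<in> E"
    using common_neighbour[OF conn _ _ ta tb ab(3,4) e(2,3,4) noe] sub by blast
  have "?D = {m}"
  proof (rule ccontr)
    assume "?D \<noteq> {m}"
    then obtain y where y: "y \<in> ?D - {m}" using m by blast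
    let ?D' = "graph_component E (?D - {m}) y"
    have sub': "?D' \<subseteq> ?D - {m}" using component_subset[OF y] .
    have conn': "connected_in E ?D'" using connected_component[OF y] .
    have yD': "y \<in> ?D'" by (rule mem_component_self)
    obtain u v where uv: "u \<in> ?D'" "v \<in> ?D" "v \<notin> ?D'" "{u, v} \<in> E"
      using connected_boundary_edge[OF conn yD', of m] y m sub' by blast
    then have "v = m" using component_closed[OF uv(1) y _ uv(4)] by blast
    have nb': "z \<in> {a, b, m}" if "w \<in> ?D'" "z \<in> V - ?D'" "{w, z} \<in> E" for w z
      using component_closed[OF that(1) y _ that(3)] nb[of w z] that sub' by blast
    have ea: "connected_in E {a, e}"
      using connected_insert[OF connected_singleton, of e e a] e by (simp add: insert_commute)
    show False
    proof (cases "touches E {a} ?D' \<and> touches E {b} ?D'")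
      case True
      have "K4_minor E"
      proof (rule K4_minorI[OF conn' connected_singleton[of E m] ea connected_singleton[of E b]])
        show "touches E ?D' {m}" using uv \<open>v = m\<close> by (auto intro: touchesI)
        show "touches E ?D' {a, e}" using True by (auto simp: touches_def insert_commute)
        show "touches E ?D' {b}" using True touches_commute by metis
        show "touches E {m} {a, e}" "touches E {m} {b}" "touches E {a, e} {b}"
          using m e by (auto simp: touches_def insert_commute)
      qed (use sub' sub m e ab in auto)
      then show False using no_K4 by simp
    next
      case False
      then consider "\<not> touches E {a} ?D'" | "\<not> touches E {b} ?D'" by blast
      then show False
      proof cases
        case 1
        have "separation V (?D' \<union> {b, m}) (V - ?D')" "(?D' \<union> {b, m}) \<inter> (V - ?D') = {b, m}"
        proof (rule separation_component[of _ _ _ a])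
          fix w z assume "w \<in> ?D'" "z \<in> V - ?D'" "{w, z} \<in> E"
          then show "z \<in> {b, m}" using nb'[of w z] 1 touchesI[of a "{a}" w ?D' E]
            by (auto simp: insert_commute)
        qed (use sub' sub m ab yD' in auto)
        then show False using nosep[of "?D' \<union> {b, m}" "V - ?D'"] m by (simp add: small_clique_def)
      next
        case 2
        have "separation V (?D' \<union> {a, m}) (V - ?D')" "(?D' \<union> {a, m}) \<inter> (V - ?D') = {a, m}"
        proof (rule separation_component[of _ _ _ b])
          fix w z assume "w \<in> ?D'" "z \<in> V - ?D'" "{w, z} \<in> E"
          then show "z \<in> {a, m}" using nb'[of w z] 2 touchesI[of b "{b}" w ?D' E]
            by (auto simp: insert_commute)
        qed (use sub' sub m ab yD' in auto)
        then show False using nosep[of "?D' \<union> {a, m}" "V - ?D'"] m by (simp add: small_clique_def)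
      qed
    qed
  qed
  then have "m = x" using xD by simp
  then show "?D = {x}" "{x, a} \<in> E" "{x, b} \<in> E" using \<open>?D = {m}\<close> m by (auto simp: insert_commute)
qed

text \<open>The component of \<open>x\<close> misses \<open>c\<close> or \<open>d\<close>, and the
  missed vertex serves as the \<open>e\<close> of
  \<open>component_is_common_neighbour\<close>.\<close>

lemma separated_pair_bipartite:
  assumes ab: "a \<in> V" "b \<in> V" "a \<noteq> b" "{a, b} \<notin> E"
    and c: "c \<in> V - {a, b}" "{c, a} \<in> E" "{c, b} \<in> E"
    and d: "d \<in> V - {a, b}" "{d, a} \<in> E" "{d, b} \<in> E"
    and sep: "d \<notin> graph_component E (V - {a, b}) c"
    and nosep: "\<And>A B. separation V A B \<Longrightarrow> \<not> small_clique E (A \<inter> B)"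
    and x: "x \<in> V - {a, b}"
  shows "{a, x} \<in> E" "{b, x} \<in> E" "y \<in> V - {a, b} \<Longrightarrow> {x, y} \<notin> E"
proof -
  let ?D = "graph_component E (V - {a, b}) x"
  have "c \<notin> ?D \<or> d \<notin> ?D" using sep component_eq by metis
  then have *: "?D = {x}" "{x, a} \<in> E" "{x, b} \<in> E"
    using component_is_common_neighbour[OF ab x c(1) _ c(2,3) nosep]
      component_is_common_neighbour[OF ab x d(1) _ d(2,3) nosep] by blast+
  then show "{a, x} \<in> E" "{b, x} \<in> E" by (auto simp: insert_commute)
  show "{x, y} \<notin> E" if y: "y \<in> V - {a, b}"
  proof
    assume "{x, y} \<in> E"
    then have "y \<in> ?D" using component_closed[OF mem_component_self x y] by blast
    then show False using \<open>{x, y} \<in> E\<close> *(1) no_loop by simp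
  qed
qed

text \<open>For nonadjacent \<open>u\<close>, \<open>w\<close>, the attachment set \<open>S\<close>
  of the component of \<open>w\<close> among the non-neighbours of \<open>u\<close> separates and
  consists of neighbours of \<open>u\<close>. If it is not a small clique it contains nonadjacent
  \<open>a\<close>, \<open>b\<close>, and together with a common neighbour \<open>d\<close> in the
  component these form an induced 4-cycle u, a, d, b. One of its diagonals separates and becomes the
  pair of centres.\<close>

lemma structure_cases:
  obtains (clique) "\<forall>x\<in>V. \<forall>y\<in>V. x \<noteq> y \<longrightarrow> {x, y} \<in> E"
  | (separation) A B where "separation V A B" "small_clique E (A \<inter> B)"
  | (bipartite) a b where "a \<in> V" "b \<in> V" "a \<noteq> b"
      "\<And>x. x \<in> V - {a, b} \<Longrightarrow> {a, x} \<in> E \<and> {b, x} \<in> E"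
      "\<And>x y. x \<in> V - {a, b} \<Longrightarrow> y \<in> V - {a, b} \<Longrightarrow> {x, y} \<notin> E" "{a, b} \<notin> E"
proof (cases "(\<forall>x\<in>V. \<forall>y\<in>V. x \<noteq> y \<longrightarrow> {x, y} \<in> E) \<or>
    (\<exists>A B. separation V A B \<and> small_clique E (A \<inter> B))")
  case True
  then show thesis using clique separation by blast
next
  case False
  then obtain u w where uw: "u \<in> V" "w \<in> V" "u \<noteq> w" "{u, w} \<notin> E"
    and nosep: "\<And>A B. separation V A B \<Longrightarrow> \<not> small_clique E (A \<inter> B)" by blast
  let ?T = "{v \<in> V. v \<noteq> u \<and> {u, v} \<notin> E}"
  have wT: "w \<in> ?T" using uw by auto
  let ?C = "graph_component E ?T w"
  have Csub: "?C \<subseteq> ?T" using component_subset[OF wT] .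
  have wC: "w \<in> ?C" by (rule mem_component_self)
  have Cconn: "connected_in E ?C" using connected_component[OF wT] .
  define S where "S = {s \<in> V - ?C. touches E {s} ?C}"
  have uS: "u \<notin> S" using Csub unfolding S_def touches_def by auto
  have Su: "{u, s} \<in> E" if "s \<in> S" for s
  proof (rule ccontr)
    assume "{u, s} \<notin> E"
    then have "s \<in> ?T" using that uS unfolding S_def by auto
    then show False using that component_closed[OF _ wT, of _ E s] unfolding S_def touches_def
      by (auto simp: insert_commute)
  qed
  have sep: "separation V (?C \<union> S) (V - ?C)" "(?C \<union> S) \<inter> (V - ?C) = S"
  proof (rule separation_component[of _ _ _ u])
    fix x z assume "x \<in> ?C" "z \<in> V - ?C" "{x, z} \<in> E"
    then show "z \<in> S" unfolding S_def touches_def by (auto simp: insert_commute)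
  qed (use Csub wC uw uS in \<open>auto simp: S_def\<close>)
  have "\<exists>a\<in>S. \<exists>b\<in>S. a \<noteq> b \<and> {a, b} \<notin> E"
  proof (rule ccontr)
    \<comment> \<open>A complete \<open>S\<close> that is not a small clique has at least three
      vertices, and with \<open>u\<close> these form a K4.\<close>
    assume neg: "\<not> ?thesis"
    have notsmall: "\<not> small_clique E S" using nosep[OF sep(1)] sep(2) by simp
    then obtain x where x: "x \<in> S" unfolding small_clique_def by blast
    obtain y where y: "y \<in> S" "y \<noteq> x" using notsmall x unfolding small_clique_def by blast
    have "S \<noteq> {x, y}" using notsmall neg x y unfolding small_clique_def by metis
    then obtain z where z: "z \<in> S" "z \<noteq> x" "z \<noteq> y" using x y by blast
    have "K4_minor E"
      using neg x y z Su uS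
      by (intro K4_minorI[OF connected_singleton[of E u] connected_singleton[of E x]
            connected_singleton[of E y] connected_singleton[of E z]])
         (auto simp: touches_def)
    then show False using no_K4 by simp
  qed
  then obtain a b where ab: "a \<in> S" "b \<in> S" "a \<noteq> b" "{a, b} \<notin> E" by blast
  have "\<not> touches E {u} ?C" "u \<notin> ?C" using Csub unfolding touches_def by auto
  then obtain d where d: "d \<in> ?C" "{a, d} \<in> E" "{b, d} \<in> E"
    using common_neighbour[OF Cconn, of a b u] ab Su unfolding S_def by blast
  have ud: "u \<noteq> d" "{u, d} \<notin> E" "d \<in> V" using d Csub by auto
  have abV: "a \<in> V" "b \<in> V" "d \<noteq> a" "d \<noteq> b" "u \<noteq> a" "u \<noteq> b"
    using ab d uS unfolding S_def by auto
  have E4: "{u, a} \<in> E" "{u, b} \<in> E" "{a, u} \<in> E" "{b, u} \<in> E" "{d, a} \<in> E" "{d, b} \<in> E"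
    using Su ab d by (auto simp: insert_commute)
  from four_cycle_separates[of a V b u d] consider
      "d \<notin> graph_component E (V - {a, b}) u" | "b \<notin> graph_component E (V - {u, d}) a"
    using abV uw ud ab d E4 by auto
  then show thesis
  proof cases
    case 1
    note * = separated_pair_bipartite[OF abV(1,2) ab(3,4) _ E4(1,2) _ E4(5,6) 1 nosep]
    show ?thesis
      by (rule bipartite[of a b]) (use * abV ud uw ab in auto)
  next
    case 2
    note * = separated_pair_bipartite[OF uw(1) ud(3,1,2) _ E4(3) d(2) _ E4(4) d(3) 2 nosep]
    show ?thesis
      by (rule bipartite[of u d]) (use * abV ud uw ab in auto)
  qed
qed

end

section \<open>Realizing pairwise marginals\<close>

definition depends_on :: "'v set \<Rightarrow> (('v \<Rightarrow> bool) \<Rightarrow> real) \<Rightarrow> bool" where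
  "depends_on S g \<longleftrightarrow> (\<forall>\<iota> \<kappa>. (\<forall>v\<in>S. \<iota> v = \<kappa> v) \<longrightarrow> g \<iota> = g \<kappa>)"

lemma depends_onD: "depends_on S g \<Longrightarrow> (\<And>v. v \<in> S \<Longrightarrow> \<iota> v = \<kappa> v) \<Longrightarrow> g \<iota> = g \<kappa>"
  unfolding depends_on_def by blast

lemma depends_on_mono: "depends_on S g \<Longrightarrow> S \<subseteq> T \<Longrightarrow> depends_on T g"
  unfolding depends_on_def by blast

text \<open>Weights on cells may be negative: every point of the affine hull of the marginal polytope is
  the vector of marginals of such a signed weight.\<close>

definition expect :: "(('v::finite \<Rightarrow> bool) \<Rightarrow> real) \<Rightarrow> (('v \<Rightarrow> bool) \<Rightarrow> real) \<Rightarrow> real" where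
  "expect p g = (\<Sum>\<iota>\<in>UNIV. p \<iota> * g \<iota>)"

lemma expect_add: "expect p (\<lambda>\<iota>. f \<iota> + g \<iota>) = expect p f + expect p g"
  by (simp add: expect_def algebra_simps sum.distrib)

lemma expect_diff: "expect p (\<lambda>\<iota>. f \<iota> - g \<iota>) = expect p f - expect p g"
  by (simp add: expect_def algebra_simps sum_subtractf)

lemma expect_scale: "expect p (\<lambda>\<iota>. k * g \<iota>) = k * expect p g"
  by (simp add: expect_def sum_distrib_left mult.left_commute)

lemmas expect_linear = expect_add expect_diff expect_scale

text \<open>Change of variables for the pushforward of \<open>w\<close> under \<open>m\<close>; the
  distributions below are all constructed as such pushforwards.\<close>

lemma expect_mixture:
  assumes "finite I"
  shows "expect (\<lambda>\<iota>. \<Sum>i\<in>I. w i * of_bool (m i = \<iota>)) g = (\<Sum>i\<in>I. w i * g (m i))"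
proof -
  have "expect (\<lambda>\<iota>. \<Sum>i\<in>I. w i * of_bool (m i = \<iota>)) g
      = (\<Sum>i\<in>I. \<Sum>\<iota>\<in>UNIV. w i * of_bool (m i = \<iota>) * g \<iota>)"
    unfolding expect_def sum_distrib_right by (rule sum.swap)
  also have "\<dots> = (\<Sum>i\<in>I. w i * g (m i))"
  proof (rule sum.cong[OF refl])
    fix i
    have "(\<Sum>\<iota>\<in>UNIV. w i * of_bool (m i = \<iota>) * g \<iota>) = (\<Sum>\<iota>\<in>UNIV. if m i = \<iota> then w i * g \<iota> else 0)"
      by (rule sum.cong) auto
    then show "(\<Sum>\<iota>\<in>UNIV. w i * of_bool (m i = \<iota>) * g \<iota>) = w i * g (m i)" by simp
  qed
  finally show ?thesis .
qed

text \<open>Given the common marginal on \<open>V\<^sub>1 \<inter> V\<^sub>2\<close>, make the two sides conditionally independent.\<close>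

lemma glue_distributions:
  fixes p1 p2 :: "('v::finite \<Rightarrow> bool) \<Rightarrow> real"
  assumes p1: "\<And>\<iota>. 0 \<le> p1 \<iota>" and p2: "\<And>\<iota>. 0 \<le> p2 \<iota>"
    and agree: "\<And>g. depends_on (V1 \<inter> V2) g \<Longrightarrow> expect p1 g = expect p2 g"
  obtains p where "\<And>\<iota>. 0 \<le> p \<iota>"
    "\<And>g. depends_on V1 g \<Longrightarrow> expect p g = expect p1 g"
    "\<And>g. depends_on V2 g \<Longrightarrow> expect p g = expect p2 g"
proof -
  define same :: "('v \<Rightarrow> bool) \<Rightarrow> ('v \<Rightarrow> bool) \<Rightarrow> real"
    where "same = (\<lambda>\<iota> \<kappa>. of_bool (\<forall>v\<in>V1 \<inter> V2. \<iota> v = \<kappa> v))"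
  define m where "m = (\<lambda>\<iota>. expect p1 (same \<iota>))"
  have same_commute: "same \<iota> \<kappa> = same \<kappa> \<iota>" for \<iota> \<kappa>
    unfolding same_def by (rule arg_cong[of _ _ of_bool]) auto
  have same_nonneg: "0 \<le> same \<iota> \<kappa>" for \<iota> \<kappa> by (simp add: same_def)
  have m2: "m \<iota> = expect p2 (same \<iota>)" for \<iota>
    unfolding m_def by (rule agree) (auto simp: depends_on_def same_def)
  have m_same: "same \<iota> \<kappa> / m \<iota> = same \<iota> \<kappa> / m \<kappa>" for \<iota> \<kappa>
  proof (cases "\<forall>v\<in>V1 \<inter> V2. \<iota> v = \<kappa> v")
    case True
    then have "same \<iota> = same \<kappa>" unfolding same_def by auto
    then show ?thesis unfolding m_def by simp
  next
    case False
    then have "same \<iota> \<kappa> = 0" unfolding same_def by auto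
    then show ?thesis by simp
  qed
  \<comment> \<open>Where the shared marginal \<open>m\<close> vanishes, so does \<open>p1\<close>;
    hence the convention that division by zero gives 0 does no harm.\<close>
  have p1m: "p1 \<iota> * m \<iota> / m \<iota> = p1 \<iota>" for \<iota>
  proof -
    have "p1 \<iota> * same \<iota> \<iota> \<le> m \<iota>" unfolding m_def expect_def
      by (rule member_le_sum) (auto simp: p1 same_nonneg)
    then have "m \<iota> = 0 \<Longrightarrow> p1 \<iota> = 0" using p1[of \<iota>] by (simp add: same_def)
    then show ?thesis by auto
  qed
  have p2m: "p2 \<iota> * m \<iota> / m \<iota> = p2 \<iota>" for \<iota>
  proof -
    have "p2 \<iota> * same \<iota> \<iota> \<le> m \<iota>" unfolding m2 expect_def
      by (rule member_le_sum) (auto simp: p2 same_nonneg)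
    then have "m \<iota> = 0 \<Longrightarrow> p2 \<iota> = 0" using p2[of \<iota>] by (simp add: same_def)
    then show ?thesis by auto
  qed
  define w where "w = (\<lambda>(\<iota>, \<kappa>). p1 \<iota> * p2 \<kappa> * (same \<iota> \<kappa> / m \<iota>))"
  \<comment> \<open>Whenever \<open>w\<close> gives the pair positive weight, the two cells agree on
    the intersection, so the merged cell agrees with \<kappa> on all of \<open>V2\<close>.\<close>
  define mrg :: "('v \<Rightarrow> bool) \<times> ('v \<Rightarrow> bool) \<Rightarrow> 'v \<Rightarrow> bool"
    where "mrg = (\<lambda>(\<iota>, \<kappa>) v. if v \<in> V1 then \<iota> v else \<kappa> v)"
  define p where "p = (\<lambda>\<eta>. \<Sum>i\<in>UNIV. w i * of_bool (mrg i = \<eta>))"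
  have m_nonneg: "0 \<le> m \<iota>" for \<iota>
    unfolding m_def expect_def by (intro sum_nonneg mult_nonneg_nonneg p1 same_nonneg)
  have w_nonneg: "0 \<le> w i" for i
    unfolding w_def by (auto simp: p1 p2 same_nonneg m_nonneg split: prod.splits)
  have E: "expect p g = (\<Sum>\<iota>\<in>UNIV. \<Sum>\<kappa>\<in>UNIV. w (\<iota>, \<kappa>) * g (mrg (\<iota>, \<kappa>)))" for g
    unfolding p_def by (subst expect_mixture) (auto simp: sum.cartesian_product)
  show thesis
  proof (rule that[of p])
    show "0 \<le> p \<iota>" for \<iota> unfolding p_def by (intro sum_nonneg mult_nonneg_nonneg w_nonneg) simp
  next
    fix g assume g: "depends_on V1 g"
    have "expect p g = (\<Sum>\<iota>\<in>UNIV. \<Sum>\<kappa>\<in>UNIV. w (\<iota>, \<kappa>) * g \<iota>)"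
    proof -
      have "g (mrg (\<iota>, \<kappa>)) = g \<iota>" for \<iota> \<kappa>
        by (rule depends_onD[OF g]) (simp add: mrg_def)
      then show ?thesis unfolding E by simp
    qed
    also have "\<dots> = (\<Sum>\<iota>\<in>UNIV. (p1 \<iota> * m \<iota> / m \<iota>) * g \<iota>)"
    proof (rule sum.cong[OF refl])
      fix \<iota>
      have "(\<Sum>\<kappa>\<in>UNIV. w (\<iota>, \<kappa>) * g \<iota>) = (\<Sum>\<kappa>\<in>UNIV. (p1 \<iota> / m \<iota> * g \<iota>) * (p2 \<kappa> * same \<iota> \<kappa>))"
        unfolding w_def by (simp add: ac_simps)
      also have "\<dots> = (p1 \<iota> * m \<iota> / m \<iota>) * g \<iota>"
        unfolding m2 expect_def sum_distrib_left[symmetric] by simp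
      finally show "(\<Sum>\<kappa>\<in>UNIV. w (\<iota>, \<kappa>) * g \<iota>) = (p1 \<iota> * m \<iota> / m \<iota>) * g \<iota>" .
    qed
    finally show "expect p g = expect p1 g" unfolding p1m by (simp add: expect_def)
  next
    fix g assume g: "depends_on V2 g"
    have "expect p g = (\<Sum>\<iota>\<in>UNIV. \<Sum>\<kappa>\<in>UNIV. w (\<iota>, \<kappa>) * g \<kappa>)"
    proof -
      have "w (\<iota>, \<kappa>) * g (mrg (\<iota>, \<kappa>)) = w (\<iota>, \<kappa>) * g \<kappa>" for \<iota> \<kappa>
      proof (cases "\<forall>v\<in>V1 \<inter> V2. \<iota> v = \<kappa> v")
        case True
        then have "g (mrg (\<iota>, \<kappa>)) = g \<kappa>"
          by (intro depends_onD[OF g]) (auto simp: mrg_def)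
        then show ?thesis by simp
      next
        case False
        then have "same \<iota> \<kappa> = 0" unfolding same_def by auto
        then show ?thesis by (simp add: w_def)
      qed
      then show ?thesis unfolding E by (simp only:)
    qed
    also have "\<dots> = (\<Sum>\<kappa>\<in>UNIV. \<Sum>\<iota>\<in>UNIV. w (\<iota>, \<kappa>) * g \<kappa>)"
      by (rule sum.swap)
    also have "\<dots> = (\<Sum>\<kappa>\<in>UNIV. (p2 \<kappa> * m \<kappa> / m \<kappa>) * g \<kappa>)"
    proof (rule sum.cong[OF refl])
      fix \<kappa>
      have "(\<Sum>\<iota>\<in>UNIV. w (\<iota>, \<kappa>) * g \<kappa>) = (\<Sum>\<iota>\<in>UNIV. (p2 \<kappa> / m \<kappa> * g \<kappa>) * (p1 \<iota> * same \<kappa> \<iota>))"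
      proof (rule sum.cong[OF refl])
        fix \<iota>
        have "w (\<iota>, \<kappa>) * g \<kappa> = (p1 \<iota> * p2 \<kappa> * g \<kappa>) * (same \<iota> \<kappa> / m \<iota>)"
          by (simp add: w_def)
        also have "\<dots> = (p2 \<kappa> / m \<kappa> * g \<kappa>) * (p1 \<iota> * same \<kappa> \<iota>)"
          by (subst m_same, subst same_commute[of \<iota> \<kappa>]) (simp add: ac_simps)
        finally show "w (\<iota>, \<kappa>) * g \<kappa> = (p2 \<kappa> / m \<kappa> * g \<kappa>) * (p1 \<iota> * same \<kappa> \<iota>)" .
      qed
      also have "\<dots> = (p2 \<kappa> * m \<kappa> / m \<kappa>) * g \<kappa>"
        unfolding m_def expect_def sum_distrib_left[symmetric] by simp
      finally show "(\<Sum>\<iota>\<in>UNIV. w (\<iota>, \<kappa>) * g \<kappa>) = (p2 \<kappa> * m \<kappa> / m \<kappa>) * g \<kappa>" .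
    qed
    finally show "expect p g = expect p2 g" unfolding p2m by (simp add: expect_def)
  qed
qed

section \<open>Moments of up to three binary variables\<close>

definition pr1 :: "'v \<Rightarrow> ('v \<Rightarrow> bool) \<Rightarrow> real" where
  "pr1 a \<iota> = of_bool (\<iota> a)"

definition pr2 :: "'v \<Rightarrow> 'v \<Rightarrow> ('v \<Rightarrow> bool) \<Rightarrow> real" where
  "pr2 a b \<iota> = of_bool (\<iota> a \<and> \<iota> b)"

lemma pr2_same: "pr2 a a = pr1 a"
  by (simp add: pr1_def pr2_def fun_eq_iff)

lemma pr2_commute: "pr2 a b = pr2 b a"
  by (simp add: pr2_def fun_eq_iff conj_commute)

text \<open>A function of two bits is a multilinear polynomial in them. Its constant term is written
  as a multiple of 1, so that linearity of \<open>expect\<close> reduces everything to four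
  moments.\<close>

lemma depends_on_pair_expansion:
  assumes "depends_on {a, b} g"
  obtains \<alpha> \<beta> \<gamma> \<delta> where "g = (\<lambda>\<iota>. \<alpha> * 1 + \<beta> * pr1 a \<iota> + \<gamma> * pr1 b \<iota> + \<delta> * pr2 a b \<iota>)"
proof -
  define h where "h = (\<lambda>x y. g ((\<lambda>_. False)(a := x, b := y)))"
  have g: "g \<iota> = h (\<iota> a) (\<iota> b)" for \<iota>
    unfolding h_def by (rule depends_onD[OF assms]) auto
  show thesis
  proof (rule that)
    show "g = (\<lambda>\<iota>. h False False * 1 + (h True False - h False False) * pr1 a \<iota>
      + (h False True - h False False) * pr1 b \<iota>
      + (h True True - h True False - h False True + h False False) * pr2 a b \<iota>)"
      by (rule ext) (auto simp: g pr1_def pr2_def)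
  qed
qed

lemma expect_eq_pairI:
  assumes "expect p (\<lambda>\<iota>. 1) = expect q (\<lambda>\<iota>. 1)" "expect p (pr1 a) = expect q (pr1 a)"
    and "expect p (pr1 b) = expect q (pr1 b)" "expect p (pr2 a b) = expect q (pr2 a b)"
    and "depends_on {a, b} g"
  shows "expect p g = expect q g"
  by (rule depends_on_pair_expansion[OF assms(5)], elim ssubst)
     (simp only: expect_linear assms(1-4))

text \<open>The moments determine the four entries of the 2 by 2 table, and the four inequalities
  say that these are nonnegative.\<close>

lemma exists_pair_distribution:
  fixes a b :: "'v::finite"
  assumes "a \<noteq> b" "0 \<le> yab" "yab \<le> ya" "yab \<le> yb" "ya + yb - y0 \<le> yab"
  obtains p :: "('v \<Rightarrow> bool) \<Rightarrow> real" where "\<And>\<iota>. 0 \<le> p \<iota>"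
    "expect p (\<lambda>\<iota>. 1) = y0" "expect p (pr1 a) = ya" "expect p (pr1 b) = yb" "expect p (pr2 a b) = yab"
proof -
  define w :: "bool \<times> bool \<Rightarrow> real" where
    "w = (\<lambda>(x, y). if x then (if y then yab else ya - yab) else (if y then yb - yab else y0 - ya - yb + yab))"
  define m :: "bool \<times> bool \<Rightarrow> 'v \<Rightarrow> bool" where
    "m = (\<lambda>(x, y). (\<lambda>_. False)(a := x, b := y))"
  define p where "p = (\<lambda>\<iota>. \<Sum>i\<in>UNIV. w i * of_bool (m i = \<iota>))"
  have E: "expect p g = (\<Sum>x\<in>UNIV. \<Sum>y\<in>UNIV. w (x, y) * g (m (x, y)))" for g
    unfolding p_def by (subst expect_mixture) (auto simp: sum.cartesian_product)
  show thesis
  proof (rule that[of p])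
    show "0 \<le> p \<iota>" for \<iota> unfolding p_def using assms
      by (intro sum_nonneg mult_nonneg_nonneg) (auto simp: w_def split: prod.splits)
  qed (use assms in \<open>simp_all add: E UNIV_bool w_def m_def pr1_def pr2_def\<close>)
qed

text \<open>All eight cell weights are determined by the moments and the free triple moment
  \<open>s\<close>. Nonnegativity bounds \<open>s\<close> by four lower and four upper bounds; the
  assumed inequalities are the sixteen comparisons between them.\<close>

lemma exists_triangle_distribution:
  fixes a b c :: "'v::finite"
  assumes "distinct [a, b, c]"
    and "0 \<le> yab" "yab \<le> ya" "yab \<le> yb" "ya + yb - y0 \<le> yab"
    and "0 \<le> yac" "yac \<le> ya" "yac \<le> yc" "ya + yc - y0 \<le> yac"
    and "0 \<le> ybc" "ybc \<le> yb" "ybc \<le> yc" "yb + yc - y0 \<le> ybc"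
    and "yac + ybc - yc \<le> yab" "yab + ybc - yb \<le> yac" "yab + yac - ya \<le> ybc"
    and "ya + yb + yc - y0 \<le> yab + yac + ybc"
  obtains p :: "('v \<Rightarrow> bool) \<Rightarrow> real" where "\<And>\<iota>. 0 \<le> p \<iota>" "expect p (\<lambda>\<iota>. 1) = y0"
    "expect p (pr1 a) = ya" "expect p (pr1 b) = yb" "expect p (pr1 c) = yc"
    "expect p (pr2 a b) = yab" "expect p (pr2 a c) = yac" "expect p (pr2 b c) = ybc"
proof -
  define s where "s = Max {0, yab + yac - ya, yab + ybc - yb, yac + ybc - yc}"
  have s: "0 \<le> s" "yab + yac - ya \<le> s" "yab + ybc - yb \<le> s" "yac + ybc - yc \<le> s"
    unfolding s_def by (auto intro: Max_ge)
  have "s \<in> {0, yab + yac - ya, yab + ybc - yb, yac + ybc - yc}"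
    unfolding s_def by (rule Max_in) auto
  then consider "s = 0" | "s = yab + yac - ya" | "s = yab + ybc - yb" | "s = yac + ybc - yc" by auto
  then have s': "s \<le> yab" "s \<le> yac" "s \<le> ybc" "s \<le> y0 - ya - yb - yc + yab + yac + ybc"
    by (cases; use assms(2-) in linarith)+
  define w :: "bool \<times> bool \<times> bool \<Rightarrow> real" where
    "w = (\<lambda>(x, y, z). if x
        then (if y then (if z then s else yab - s) else (if z then yac - s else ya - yab - yac + s))
        else (if y then (if z then ybc - s else yb - yab - ybc + s)
          else (if z then yc - yac - ybc + s else y0 - ya - yb - yc + yab + yac + ybc - s)))"
  define m :: "bool \<times> bool \<times> bool \<Rightarrow> 'v \<Rightarrow> bool" where
    "m = (\<lambda>(x, y, z). (\<lambda>_. False)(a := x, b := y, c := z))"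
  define p where "p = (\<lambda>\<iota>. \<Sum>i\<in>UNIV. w i * of_bool (m i = \<iota>))"
  have E: "expect p g = (\<Sum>x\<in>UNIV. \<Sum>y\<in>UNIV. \<Sum>z\<in>UNIV. w (x, y, z) * g (m (x, y, z)))" for g
    unfolding p_def by (subst expect_mixture) (auto simp: sum.cartesian_product)
  show thesis
  proof (rule that[of p])
    show "0 \<le> p \<iota>" for \<iota> unfolding p_def using s s'
      by (intro sum_nonneg mult_nonneg_nonneg) (auto simp: w_def split: prod.splits)
  qed (use assms(1) in \<open>simp_all add: E UNIV_bool w_def m_def pr1_def pr2_def\<close>)
qed

section \<open>Pairwise functions and signed weights\<close>

inductive pairwise_sum :: "'v set set \<Rightarrow> (('v \<Rightarrow> bool) \<Rightarrow> real) \<Rightarrow> bool" for E where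
  dep: "small_clique E K \<Longrightarrow> depends_on K g \<Longrightarrow> pairwise_sum E g"
| add: "pairwise_sum E f \<Longrightarrow> pairwise_sum E g \<Longrightarrow> pairwise_sum E (\<lambda>\<iota>. f \<iota> + g \<iota>)"
| scale: "pairwise_sum E g \<Longrightarrow> pairwise_sum E (\<lambda>\<iota>. k * g \<iota>)"

lemma pairwise_sum_diff:
  assumes "pairwise_sum E f" "pairwise_sum E g"
  shows "pairwise_sum E (\<lambda>\<iota>. f \<iota> - g \<iota>)"
  using pairwise_sum.add[OF assms(1) pairwise_sum.scale[OF assms(2), of "-1"]] by simp

lemma pairwise_sum_const: "pairwise_sum E (\<lambda>\<iota>. k)"
  by (rule pairwise_sum.dep[of E "{}"]) (auto simp: small_clique_def depends_on_def)

lemma pairwise_sum_pr1: "pairwise_sum E (pr1 a)"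
  by (rule pairwise_sum.dep[of E "{a}"]) (auto simp: small_clique_def depends_on_def pr1_def)

lemma pairwise_sum_pr2: "{a, b} \<in> E \<Longrightarrow> pairwise_sum E (pr2 a b)"
  by (rule pairwise_sum.dep[of E "{a, b}"]) (auto simp: small_clique_def depends_on_def pr2_def)

lemma pairwise_sum_sum:
  assumes "finite I" "\<And>i. i \<in> I \<Longrightarrow> pairwise_sum E (f i)"
  shows "pairwise_sum E (\<lambda>\<iota>. \<Sum>i\<in>I. f i \<iota>)"
  using assms by (induction I) (auto intro: pairwise_sum.add pairwise_sum_const)

lemmas pairwise_sum_intros =
  pairwise_sum.add pairwise_sum_diff pairwise_sum_const pairwise_sum_pr1 pairwise_sum_pr2

definition binary_nonneg :: "'v::finite set set \<Rightarrow> (('v \<Rightarrow> bool) \<Rightarrow> real) \<Rightarrow> bool" where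
  "binary_nonneg E w \<longleftrightarrow> (\<forall>g. pairwise_sum E g \<longrightarrow> (\<forall>\<iota>. g \<iota> \<in> {0, 1}) \<longrightarrow> 0 \<le> expect w g)"

text \<open>\<open>V\<close> only limits the cliques on which \<open>p\<close> is tested; both
  weights live on all cells, so \<open>w\<close> stays the same throughout the induction on
  \<open>V\<close>. The empty clique forces equal total mass.\<close>

definition realizes :: "'v::finite set set \<Rightarrow> 'v set \<Rightarrow> (('v \<Rightarrow> bool) \<Rightarrow> real) \<Rightarrow> (('v \<Rightarrow> bool) \<Rightarrow> real) \<Rightarrow> bool"
  where "realizes E V w p \<longleftrightarrow> (\<forall>\<iota>. 0 \<le> p \<iota>) \<and>
    (\<forall>K g. K \<subseteq> V \<longrightarrow> small_clique E K \<longrightarrow> depends_on K g \<longrightarrow> expect p g = expect w g)"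

lemma binary_nonnegD:
  "binary_nonneg E w \<Longrightarrow> pairwise_sum E g \<Longrightarrow> (\<And>\<iota>. g \<iota> = 0 \<or> g \<iota> = 1) \<Longrightarrow> 0 \<le> expect w g"
  unfolding binary_nonneg_def by blast

text \<open>Push \<open>w\<close> forward along the map that clears all coordinates outside
  \<open>V\<close>. Each resulting weight is the expectation of an indicator depending on
  \<open>V\<close> alone.\<close>

lemma realizable_small_clique:
  assumes w: "binary_nonneg E w" and V: "small_clique E V"
  shows "\<exists>p. realizes E V w p"
proof -
  define m where "m = (\<lambda>\<iota> v. v \<in> V \<and> \<iota> v)"
  define p where "p = (\<lambda>\<kappa>. \<Sum>\<iota>\<in>UNIV. w \<iota> * of_bool (m \<iota> = \<kappa>))"
  have "0 \<le> p \<kappa>" for \<kappa>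
  proof -
    have "depends_on V (\<lambda>\<iota>. of_bool (m \<iota> = \<kappa>))"
      unfolding depends_on_def m_def by (auto intro!: arg_cong[of _ _ of_bool] simp: fun_eq_iff)
    then have "0 \<le> expect w (\<lambda>\<iota>. of_bool (m \<iota> = \<kappa>))"
      by (intro binary_nonnegD[OF w] pairwise_sum.dep[OF V]) auto
    then show ?thesis unfolding p_def expect_def .
  qed
  moreover have "expect p g = expect w g" if "K \<subseteq> V" "depends_on K g" for K g
  proof -
    have "g (m \<iota>) = g \<iota>" for \<iota>
      by (rule depends_onD[OF that(2)]) (use that(1) in \<open>auto simp: m_def\<close>)
    moreover have "expect p g = (\<Sum>\<iota>\<in>UNIV. w \<iota> * g (m \<iota>))"
      unfolding p_def by (rule expect_mixture) simp
    ultimately show ?thesis by (simp add: expect_def)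
  qed
  ultimately show ?thesis unfolding realizes_def by blast
qed

lemma binary_nonneg_edge:
  assumes w: "binary_nonneg E w" and e: "{a, b} \<in> E"
  shows "0 \<le> expect w (pr2 a b)" "expect w (pr2 a b) \<le> expect w (pr1 a)"
    "expect w (pr2 a b) \<le> expect w (pr1 b)"
    "expect w (pr1 a) + expect w (pr1 b) - expect w (\<lambda>\<iota>. 1) \<le> expect w (pr2 a b)"
proof -
  show "0 \<le> expect w (pr2 a b)" by (rule binary_nonnegD[OF w]) (intro pairwise_sum_intros e, auto simp: pr1_def pr2_def)
  have "0 \<le> expect w (\<lambda>\<iota>. pr1 a \<iota> - pr2 a b \<iota>)"
    by (rule binary_nonnegD[OF w]) (intro pairwise_sum_intros e, auto simp: pr1_def pr2_def)
  then show "expect w (pr2 a b) \<le> expect w (pr1 a)" unfolding expect_linear by simp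
  have "0 \<le> expect w (\<lambda>\<iota>. pr1 b \<iota> - pr2 a b \<iota>)"
    by (rule binary_nonnegD[OF w]) (intro pairwise_sum_intros e, auto simp: pr1_def pr2_def)
  then show "expect w (pr2 a b) \<le> expect w (pr1 b)" unfolding expect_linear by simp
  have "0 \<le> expect w (\<lambda>\<iota>. 1 - pr1 a \<iota> - pr1 b \<iota> + pr2 a b \<iota>)"
    by (rule binary_nonnegD[OF w]) (intro pairwise_sum_intros e, auto simp: pr1_def pr2_def)
  then show "expect w (pr1 a) + expect w (pr1 b) - expect w (\<lambda>\<iota>. 1) \<le> expect w (pr2 a b)"
    unfolding expect_linear by simp
qed

text \<open>The first three functions indicate that two of the vertices agree and the third differs;
  the last indicates that all three agree.\<close>

lemma binary_nonneg_triangle: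
  assumes w: "binary_nonneg E w" and e: "{a, b} \<in> E" "{a, c} \<in> E" "{b, c} \<in> E"
  shows "expect w (pr2 a c) + expect w (pr2 b c) - expect w (pr1 c) \<le> expect w (pr2 a b)"
    "expect w (pr2 a b) + expect w (pr2 b c) - expect w (pr1 b) \<le> expect w (pr2 a c)"
    "expect w (pr2 a b) + expect w (pr2 a c) - expect w (pr1 a) \<le> expect w (pr2 b c)"
    "expect w (pr1 a) + expect w (pr1 b) + expect w (pr1 c) - expect w (\<lambda>\<iota>. 1)
      \<le> expect w (pr2 a b) + expect w (pr2 a c) + expect w (pr2 b c)"
proof -
  have "0 \<le> expect w (\<lambda>\<iota>. pr2 a b \<iota> + pr1 c \<iota> - pr2 a c \<iota> - pr2 b c \<iota>)"
    by (rule binary_nonnegD[OF w]) (intro pairwise_sum_intros e, auto simp: pr1_def pr2_def)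
  then show "expect w (pr2 a c) + expect w (pr2 b c) - expect w (pr1 c) \<le> expect w (pr2 a b)"
    unfolding expect_linear by simp
  have "0 \<le> expect w (\<lambda>\<iota>. pr2 a c \<iota> + pr1 b \<iota> - pr2 a b \<iota> - pr2 b c \<iota>)"
    by (rule binary_nonnegD[OF w]) (intro pairwise_sum_intros e, auto simp: pr1_def pr2_def)
  then show "expect w (pr2 a b) + expect w (pr2 b c) - expect w (pr1 b) \<le> expect w (pr2 a c)"
    unfolding expect_linear by simp
  have "0 \<le> expect w (\<lambda>\<iota>. pr2 b c \<iota> + pr1 a \<iota> - pr2 a b \<iota> - pr2 a c \<iota>)"
    by (rule binary_nonnegD[OF w]) (intro pairwise_sum_intros e, auto simp: pr1_def pr2_def)
  then show "expect w (pr2 a b) + expect w (pr2 a c) - expect w (pr1 a) \<le> expect w (pr2 b c)"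
    unfolding expect_linear by simp
  have "0 \<le> expect w (\<lambda>\<iota>. 1 - pr1 a \<iota> - pr1 b \<iota> - pr1 c \<iota> + pr2 a b \<iota> + pr2 a c \<iota> + pr2 b c \<iota>)"
    by (rule binary_nonnegD[OF w]) (intro pairwise_sum_intros e, auto simp: pr1_def pr2_def)
  then show "expect w (pr1 a) + expect w (pr1 b) + expect w (pr1 c) - expect w (\<lambda>\<iota>. 1)
      \<le> expect w (pr2 a b) + expect w (pr2 a c) + expect w (pr2 b c)"
    unfolding expect_linear by simp
qed

lemma realizable_triangle:
  assumes w: "binary_nonneg E w" and card2: "\<And>e. e \<in> E \<Longrightarrow> card e = 2"
    and e: "{a, b} \<in> E" "{a, c} \<in> E" "{b, c} \<in> E" and dist: "distinct [a, b, c]"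
  shows "\<exists>p. realizes E {a, b, c} w p"
proof -
  obtain p where p: "\<And>\<iota>. 0 \<le> p \<iota>" "expect p (\<lambda>\<iota>. 1) = expect w (\<lambda>\<iota>. 1)"
    "expect p (pr1 a) = expect w (pr1 a)" "expect p (pr1 b) = expect w (pr1 b)"
    "expect p (pr1 c) = expect w (pr1 c)" "expect p (pr2 a b) = expect w (pr2 a b)"
    "expect p (pr2 a c) = expect w (pr2 a c)" "expect p (pr2 b c) = expect w (pr2 b c)"
    by (rule exists_triangle_distribution[OF dist binary_nonneg_edge[OF w e(1)]
          binary_nonneg_edge[OF w e(2)] binary_nonneg_edge[OF w e(3)] binary_nonneg_triangle[OF w e]]) (rule that)
  have "expect p g = expect w g" if K: "K \<subseteq> {a, b, c}" "small_clique E K" "depends_on K g" for K g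
  proof -
    have "card K \<le> 2" using K(2) card2 unfolding small_clique_def by auto
    then have "K \<noteq> {a, b, c}" using dist by auto
    then have "K \<subseteq> {a, b} \<or> K \<subseteq> {a, c} \<or> K \<subseteq> {b, c}" using K(1) by blast
    then show ?thesis
      using expect_eq_pairI[OF p(2,3,4,6)] expect_eq_pairI[OF p(2,3,5,7)] expect_eq_pairI[OF p(2,4,5,8)]
        depends_on_mono[OF K(3)] by blast
  qed
  then show ?thesis unfolding realizes_def using p(1) by (intro exI[of _ p]) simp
qed


text \<open>If \<open>t\<close> is a value for the missing moment of the pair \<open>a, b\<close> that is compatible with every
  common neighbour, the triangles on \<open>a, b, m\<close> can be glued along \<open>{a, b}\<close>.\<close>

lemma glue_common_neighbours:
  fixes w :: "('v::finite \<Rightarrow> bool) \<Rightarrow> real"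
  assumes w: "binary_nonneg E w" and ab: "a \<noteq> b" "a \<notin> M" "b \<notin> M"
    and adj: "\<forall>m\<in>M. {a, m} \<in> E \<and> {b, m} \<in> E"
    and t: "0 \<le> t" "t \<le> expect w (pr1 a)" "t \<le> expect w (pr1 b)"
      "expect w (pr1 a) + expect w (pr1 b) - expect w (\<lambda>\<iota>. 1) \<le> t"
    and tm: "\<forall>m\<in>M. expect w (pr2 a m) + expect w (pr2 b m) - expect w (pr1 m) \<le> t \<and>
        expect w (pr1 a) + expect w (pr1 b) + expect w (pr1 m) - expect w (\<lambda>\<iota>. 1)
          - expect w (pr2 a m) - expect w (pr2 b m) \<le> t \<and>
        t \<le> expect w (pr1 a) - expect w (pr2 a m) + expect w (pr2 b m) \<and>
        t \<le> expect w (pr1 b) - expect w (pr2 b m) + expect w (pr2 a m)"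
  shows "\<exists>p. (\<forall>\<iota>. 0 \<le> p \<iota>) \<and> expect p (\<lambda>\<iota>. 1) = expect w (\<lambda>\<iota>. 1) \<and>
    expect p (pr1 a) = expect w (pr1 a) \<and> expect p (pr1 b) = expect w (pr1 b) \<and>
    expect p (pr2 a b) = t \<and> (\<forall>m\<in>M. expect p (pr1 m) = expect w (pr1 m) \<and>
      expect p (pr2 a m) = expect w (pr2 a m) \<and> expect p (pr2 b m) = expect w (pr2 b m))"
proof -
  define good where "good = (\<lambda>N p. (\<forall>\<iota>. 0 \<le> p \<iota>) \<and> expect p (\<lambda>\<iota>. 1) = expect w (\<lambda>\<iota>. 1) \<and>
    expect p (pr1 a) = expect w (pr1 a) \<and> expect p (pr1 b) = expect w (pr1 b) \<and>
    expect p (pr2 a b) = t \<and> (\<forall>m\<in>N. expect p (pr1 m) = expect w (pr1 m) \<and>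
      expect p (pr2 a m) = expect w (pr2 a m) \<and> expect p (pr2 b m) = expect w (pr2 b m)))"
  have dep1: "depends_on S (pr1 x)" if "x \<in> S" for S and x :: 'v
    using that unfolding depends_on_def pr1_def by auto
  have dep2: "depends_on S (pr2 x y)" if "x \<in> S" "y \<in> S" for S and x y :: 'v
    using that unfolding depends_on_def pr2_def by auto
  have dep0: "depends_on S (\<lambda>\<iota>. 1)" for S :: "'v set" unfolding depends_on_def by auto
  have "\<exists>p. good N p" if "N \<subseteq> M" for N
    using finite[of N] that
  proof (induction N rule: finite_induct)
    case empty
    obtain p where "\<And>\<iota>. 0 \<le> p \<iota>" "expect p (\<lambda>\<iota>. 1) = expect w (\<lambda>\<iota>. 1)"
      "expect p (pr1 a) = expect w (pr1 a)" "expect p (pr1 b) = expect w (pr1 b)" "expect p (pr2 a b) = t"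
      by (rule exists_pair_distribution[OF ab(1) t]) (rule that)
    then have "good {} p" by (simp add: good_def)
    then show ?case by (rule exI[of _ p])
  next
    case (insert m N)
    have m: "m \<in> M" using insert.prems by simp
    have dist: "distinct [a, b, m]" using ab m by auto
    have am: "{a, m} \<in> E" and bm: "{b, m} \<in> E" using adj m by auto
    note edge_a = binary_nonneg_edge[OF w am] and edge_b = binary_nonneg_edge[OF w bm]
    note tms = tm[rule_format, OF m]
    obtain p2 where p2: "\<And>\<iota>. 0 \<le> p2 \<iota>" "expect p2 (\<lambda>\<iota>. 1) = expect w (\<lambda>\<iota>. 1)"
      "expect p2 (pr1 a) = expect w (pr1 a)" "expect p2 (pr1 b) = expect w (pr1 b)"
      "expect p2 (pr1 m) = expect w (pr1 m)" "expect p2 (pr2 a b) = t"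
      "expect p2 (pr2 a m) = expect w (pr2 a m)" "expect p2 (pr2 b m) = expect w (pr2 b m)"
      by (rule exists_triangle_distribution[OF dist t edge_a edge_b])
         (use tms in linarith, use tms in linarith, use tms in linarith, use tms in linarith, rule that)
    obtain p1 where "good N p1" using insert.IH insert.prems by auto
    then have p1: "\<And>\<iota>. 0 \<le> p1 \<iota>" "expect p1 (\<lambda>\<iota>. 1) = expect w (\<lambda>\<iota>. 1)"
      "expect p1 (pr1 a) = expect w (pr1 a)" "expect p1 (pr1 b) = expect w (pr1 b)"
      "expect p1 (pr2 a b) = t"
      and p1N: "\<And>x. x \<in> N \<Longrightarrow> expect p1 (pr1 x) = expect w (pr1 x)"
        "\<And>x. x \<in> N \<Longrightarrow> expect p1 (pr2 a x) = expect w (pr2 a x)"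
        "\<And>x. x \<in> N \<Longrightarrow> expect p1 (pr2 b x) = expect w (pr2 b x)"
      unfolding good_def by simp_all
    \<comment> \<open>The overlap is just the pair \<open>a\<close>, \<open>b\<close>, where the
      total mass, the two means and the moment \<open>t\<close> determine all expectations.\<close>
    have int: "({a, b} \<union> N) \<inter> {a, b, m} = {a, b}" using insert.hyps dist by auto
    obtain p where p: "\<And>\<iota>. 0 \<le> p \<iota>"
      "\<And>g. depends_on ({a, b} \<union> N) g \<Longrightarrow> expect p g = expect p1 g"
      "\<And>g. depends_on {a, b, m} g \<Longrightarrow> expect p g = expect p2 g"
    proof (rule glue_distributions[OF p1(1) p2(1), of "{a, b} \<union> N" "{a, b, m}"])
      fix g :: "('v \<Rightarrow> bool) \<Rightarrow> real" assume dep: "depends_on (({a, b} \<union> N) \<inter> {a, b, m}) g"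
      show "expect p1 g = expect p2 g"
        by (rule expect_eq_pairI[OF _ _ _ _ dep[unfolded int]]) (simp_all only: p1(2-5) p2(2-6))
    qed (rule that)
    have new: "expect p (pr1 m) = expect w (pr1 m)" "expect p (pr2 a m) = expect w (pr2 a m)"
      "expect p (pr2 b m) = expect w (pr2 b m)"
      by (subst p(3), rule dep1 dep2, simp_all only: insert_iff p2 simp_thms)+
    have old: "expect p (pr1 x) = expect w (pr1 x)" "expect p (pr2 a x) = expect w (pr2 a x)"
      "expect p (pr2 b x) = expect w (pr2 b x)" if "x \<in> N" for x
      by (subst p(2), rule dep1 dep2, simp_all only: insert_iff Un_iff p1N[OF that] that simp_thms)+
    have base: "expect p (\<lambda>\<iota>. 1) = expect w (\<lambda>\<iota>. 1)" "expect p (pr1 a) = expect w (pr1 a)"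
      "expect p (pr1 b) = expect w (pr1 b)" "expect p (pr2 a b) = t"
      by (subst p(3), rule dep0 dep1 dep2, simp_all only: insert_iff p2 simp_thms)+
    have "good (insert m N) p" unfolding good_def using p(1) base new old by auto
    then show ?case by (rule exI[of _ p])
  qed
  then show ?thesis unfolding good_def by blast
qed

text \<open>\<open>t\<close> is the largest lower bound for the missing moment of \<open>a\<close>,
  \<open>b\<close>. It obeys every upper bound because each gap between an upper and a lower bound
  is the expectation of a 0/1-valued pairwise function.\<close>

lemma realizable_bipartite:
  fixes w :: "('v::finite \<Rightarrow> bool) \<Rightarrow> real"
  assumes w: "binary_nonneg E w" and card2: "\<And>e. e \<in> E \<Longrightarrow> card e = 2"
    and ab: "a \<in> V" "b \<in> V" "a \<noteq> b" "{a, b} \<notin> E"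
    and adj: "\<And>x. x \<in> V - {a, b} \<Longrightarrow> {a, x} \<in> E \<and> {b, x} \<in> E"
    and indep: "\<And>x y. x \<in> V - {a, b} \<Longrightarrow> y \<in> V - {a, b} \<Longrightarrow> {x, y} \<notin> E"
  shows "\<exists>p. realizes E V w p"
proof -
  let ?M = "V - {a, b}"
  let ?tot = "expect w (\<lambda>\<iota>. 1)" and ?y = "\<lambda>x. expect w (pr1 x)" and ?yy = "\<lambda>x z. expect w (pr2 x z)"
  define lo1 where "lo1 = (\<lambda>m. ?yy a m + ?yy b m - ?y m)"
  define lo2 where "lo2 = (\<lambda>m. ?y a + ?y b + ?y m - ?tot - ?yy a m - ?yy b m)"
  define L where "L = {0, ?y a + ?y b - ?tot} \<union> lo1 ` ?M \<union> lo2 ` ?M"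
  define t where "t = Max L"
  have L: "finite L" "L \<noteq> {}" unfolding L_def by auto
  note pos = binary_nonnegD[OF w]
  \<comment> \<open>Swapping \<open>a\<close> and \<open>b\<close> exchanges the upper bounds and
    fixes the lower ones, so one argument for an ordered pair \<open>x\<close>, \<open>z\<close>
    covers both.\<close>
  have up: "l \<le> ?y x" "\<And>k. k \<in> ?M \<Longrightarrow> l \<le> ?y x - ?yy x k + ?yy z k"
    if l: "l \<in> L" and xz: "x = a \<and> z = b \<or> x = b \<and> z = a" for l x z
  proof -
    have L': "l \<in> {0, ?y x + ?y z - ?tot} \<union> (\<lambda>m. ?yy x m + ?yy z m - ?y m) ` ?M
        \<union> (\<lambda>m. ?y x + ?y z + ?y m - ?tot - ?yy x m - ?yy z m) ` ?M"
      using l xz unfolding L_def lo1_def lo2_def by (auto simp: algebra_simps)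
    have ex: "{x, m} \<in> E" and ez: "{z, m} \<in> E" if "m \<in> ?M" for m using adj[OF that] xz by auto
    have "0 \<le> expect w (pr1 x)" by (rule pos) (intro pairwise_sum_intros, auto simp: pr1_def)
    moreover have "0 \<le> expect w (\<lambda>\<iota>. 1 - pr1 z \<iota>)"
      by (rule pos) (intro pairwise_sum_intros, auto simp: pr1_def)
    moreover have "0 \<le> expect w (\<lambda>\<iota>. pr1 x \<iota> - pr2 x m \<iota> - pr2 z m \<iota> + pr1 m \<iota>)" if "m \<in> ?M" for m
      by (rule pos) (intro pairwise_sum_intros ex[OF that] ez[OF that], auto simp: pr1_def pr2_def)
    moreover have "0 \<le> expect w (\<lambda>\<iota>. 1 - pr1 z \<iota> - pr1 m \<iota> + pr2 x m \<iota> + pr2 z m \<iota>)" if "m \<in> ?M" for m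
      by (rule pos) (intro pairwise_sum_intros ex[OF that] ez[OF that], auto simp: pr1_def pr2_def)
    ultimately show "l \<le> ?y x" using L' unfolding expect_linear by fastforce
    fix k assume k: "k \<in> ?M"
    have "0 \<le> expect w (\<lambda>\<iota>. pr1 x \<iota> - pr2 x k \<iota> + pr2 z k \<iota>)"
      by (rule pos) (intro pairwise_sum_intros ex[OF k] ez[OF k], auto simp: pr1_def pr2_def)
    moreover have "0 \<le> expect w (\<lambda>\<iota>. 1 - pr1 z \<iota> - pr2 x k \<iota> + pr2 z k \<iota>)"
      by (rule pos) (intro pairwise_sum_intros ex[OF k] ez[OF k], auto simp: pr1_def pr2_def)
    \<comment> \<open>For \<open>k\<close> different from \<open>m\<close>, this gap and the next
      are inequalities of the 4-cycle x, k, z, m; this is where the two-valuedness of 4-cycle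
      inequalities enters.\<close>
    moreover have "0 \<le> expect w (\<lambda>\<iota>. pr1 x \<iota> - pr2 x k \<iota> + pr2 z k \<iota> - pr2 x m \<iota> - pr2 z m \<iota> + pr1 m \<iota>)"
      if "m \<in> ?M" for m
      by (rule pos) (intro pairwise_sum_intros ex[OF k] ez[OF k] ex[OF that] ez[OF that], auto simp: pr1_def pr2_def)
    moreover have "0 \<le> expect w (\<lambda>\<iota>. 1 - pr1 z \<iota> - pr1 m \<iota> - pr2 x k \<iota> + pr2 z k \<iota> + pr2 x m \<iota> + pr2 z m \<iota>)"
      if "m \<in> ?M" for m
      by (rule pos) (intro pairwise_sum_intros ex[OF k] ez[OF k] ex[OF that] ez[OF that], auto simp: pr1_def pr2_def)
    ultimately show "l \<le> ?y x - ?yy x k + ?yy z k" using L' unfolding expect_linear by fastforce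
  qed
  have tL: "t \<in> L" unfolding t_def using L by (rule Max_in)
  have Lt: "l \<le> t" if "l \<in> L" for l unfolding t_def using L(1) that by (rule Max_ge)
  have "\<exists>p. (\<forall>\<iota>. 0 \<le> p \<iota>) \<and> expect p (\<lambda>\<iota>. 1) = ?tot \<and>
    expect p (pr1 a) = ?y a \<and> expect p (pr1 b) = ?y b \<and>
    expect p (pr2 a b) = t \<and> (\<forall>m\<in>?M. expect p (pr1 m) = ?y m \<and>
      expect p (pr2 a m) = ?yy a m \<and> expect p (pr2 b m) = ?yy b m)"
  proof (rule glue_common_neighbours[OF w ab(3)])
    show "0 \<le> t" "?y a + ?y b - ?tot \<le> t" by (rule Lt; simp add: L_def)+
    show "t \<le> ?y a" "t \<le> ?y b" using up(1)[OF tL, of a b] up(1)[OF tL, of b a] by auto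
    show "\<forall>m\<in>?M. {a, m} \<in> E \<and> {b, m} \<in> E" using adj by blast
    show "\<forall>m\<in>?M. ?yy a m + ?yy b m - ?y m \<le> t \<and>
        ?y a + ?y b + ?y m - ?tot - ?yy a m - ?yy b m \<le> t \<and>
        t \<le> ?y a - ?yy a m + ?yy b m \<and> t \<le> ?y b - ?yy b m + ?yy a m"
    proof (intro ballI conjI)
      fix m assume m: "m \<in> ?M"
      show "t \<le> ?y a - ?yy a m + ?yy b m" "t \<le> ?y b - ?yy b m + ?yy a m"
        using up(2)[OF tL _ m, of a b] up(2)[OF tL _ m, of b a] by auto
      have "lo1 m \<in> L" "lo2 m \<in> L" using m unfolding L_def by auto
      then show "?yy a m + ?yy b m - ?y m \<le> t" "?y a + ?y b + ?y m - ?tot - ?yy a m - ?yy b m \<le> t"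
        using Lt[of "lo1 m"] Lt[of "lo2 m"] by (simp_all add: lo1_def lo2_def)
    qed
  qed auto
  then obtain p where P: "(\<forall>\<iota>. 0 \<le> p \<iota>) \<and> expect p (\<lambda>\<iota>. 1) = ?tot \<and>
    expect p (pr1 a) = ?y a \<and> expect p (pr1 b) = ?y b \<and>
    expect p (pr2 a b) = t \<and> (\<forall>m\<in>?M. expect p (pr1 m) = ?y m \<and>
      expect p (pr2 a m) = ?yy a m \<and> expect p (pr2 b m) = ?yy b m)" ..
  then have p: "\<And>\<iota>. 0 \<le> p \<iota>" "expect p (\<lambda>\<iota>. 1) = ?tot"
    "expect p (pr1 a) = ?y a" "expect p (pr1 b) = ?y b" by simp_all
  have pM: "expect p (pr1 m) = ?y m \<and> expect p (pr2 a m) = ?yy a m \<and> expect p (pr2 b m) = ?yy b m"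
    if "m \<in> ?M" for m
    using P that by simp
  have p1: "expect p (pr1 x) = ?y x" if "x \<in> V" for x
    using that p pM[of x] by (cases "x \<in> {a, b}") auto
  have "expect p g = expect w g" if K: "K \<subseteq> V" "small_clique E K" "depends_on K g" for K g
  proof -
    \<comment> \<open>Allowing \<open>x = z\<close> lets a single moment computation cover the empty
      clique and single vertices too.\<close>
    have "\<exists>x z. depends_on {x, z} g \<and> x \<in> V \<and> z \<in> V \<and> expect p (pr2 x z) = ?yy x z"
    proof -
      consider "K = {}" | x where "K = {x}" | "K \<in> E"
        using K(2) unfolding small_clique_def by blast
      then show ?thesis
      proof cases
        case 1
        then show ?thesis using depends_on_mono[OF K(3), of "{a, a}"] ab(1) p(3) by (intro exI[of _ a]) (simp add: pr2_same)
      next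
        case (2 x)
        then show ?thesis using p1[of x] K by (intro exI[of _ x]) (simp add: pr2_same)
      next
        case 3
        then obtain x z where "K = {x, z}" "x \<noteq> z" using card2[of K] unfolding card_2_iff by blast
        then have 3: "K = {x, z}" "{x, z} \<in> E" "x \<noteq> z" using 3 by auto
        then have V: "x \<in> V" "z \<in> V" using K(1) by auto
        have "x \<in> {a, b} \<or> z \<in> {a, b}" using indep 3 V by blast
        moreover have "{x, z} \<noteq> {a, b}" using ab(4) 3 by metis
        ultimately consider "x \<in> {a, b}" "z \<in> ?M" | "z \<in> {a, b}" "x \<in> ?M" using V 3(3) by blast
        then show ?thesis
        proof cases
          case 1
          then have "expect p (pr2 x z) = ?yy x z" using pM[of z] by auto
          then show ?thesis using V K(3) unfolding 3(1) by (intro exI[of _ x] exI[of _ z] conjI)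
        next
          case 2
          then have "expect p (pr2 x z) = ?yy x z" using pM[of x] pr2_commute[of x z] by auto
          then show ?thesis using V K(3) unfolding 3(1) by (intro exI[of _ x] exI[of _ z] conjI)
        qed
      qed
    qed
    then obtain x z where xz: "depends_on {x, z} g" "x \<in> V" "z \<in> V" "expect p (pr2 x z) = ?yy x z"
      by auto
    show ?thesis by (rule expect_eq_pairI[OF p(2) p1[OF xz(2)] p1[OF xz(3)] xz(4,1)])
  qed
  then show ?thesis unfolding realizes_def using p(1) by (intro exI[of _ p]) simp
qed

theorem realizable:
  fixes w :: "('v::finite \<Rightarrow> bool) \<Rightarrow> real"
  assumes "short_cycle_graph E" and w: "binary_nonneg E w"
  shows "\<exists>p. realizes E V w p"
proof -
  interpret short_cycle_graph E by fact
  show ?thesis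
  proof (induction "card V" arbitrary: V rule: less_induct)
    case less
    show ?case
    proof (cases V rule: structure_cases)
      case clique
      show ?thesis
      proof (cases "small_clique E V")
        case True
        then show ?thesis by (rule realizable_small_clique[OF w])
      next
        case False
        obtain x where x: "x \<in> V" using False unfolding small_clique_def by blast
        obtain y where y: "y \<in> V" "y \<noteq> x" using False x unfolding small_clique_def by blast
        have "{x, y} \<in> E" using clique x y by simp
        then have "V \<noteq> {x, y}" using False by (auto simp: small_clique_def)
        then obtain z where z: "z \<in> V" "z \<noteq> x" "z \<noteq> y" using x y by blast
        have "V = {x, y, z}"
        proof (rule ccontr)
          assume "V \<noteq> {x, y, z}"
          then obtain u where u: "u \<in> V" "u \<noteq> x" "u \<noteq> y" "u \<noteq> z" using x y z by blast
          have "K4_minor E"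
            using clique x y z u
            by (intro K4_minorI[OF connected_singleton[of E u] connected_singleton[of E x]
                  connected_singleton[of E y] connected_singleton[of E z]])
               (auto simp: touches_def)
          then show False using no_K4 by simp
        qed
        then show ?thesis
          using realizable_triangle[OF w card_edge, of x y z] clique x y z by auto
      qed
    next
      case (separation A B)
      then have AB: "A \<union> B = V" "A \<noteq> V" "B \<noteq> V" "\<not> touches E (A - B) (B - A)"
        unfolding separation_def by auto
      have "card A < card V" "card B < card V"
        using AB by (intro psubset_card_mono; auto)+
      then obtain p1 p2 where p1: "realizes E A w p1" and p2: "realizes E B w p2" using less by meson
      obtain p where p: "\<And>\<iota>. 0 \<le> p \<iota>" "\<And>g. depends_on A g \<Longrightarrow> expect p g = expect p1 g"
        "\<And>g. depends_on B g \<Longrightarrow> expect p g = expect p2 g"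
      proof (rule glue_distributions[of p1 p2 A B])
        \<comment> \<open>The separator is a small clique inside both sides, so each distribution
          reproduces the expectation under \<open>w\<close> on it.\<close>
        fix g :: "('v \<Rightarrow> bool) \<Rightarrow> real" assume "depends_on (A \<inter> B) g"
        then show "expect p1 g = expect p2 g"
          using p1 p2 separation(2) unfolding realizes_def by (metis inf.cobounded1 inf.cobounded2)
      qed (use p1 p2 in \<open>auto simp: realizes_def\<close>)
      have "expect p g = expect w g" if K: "K \<subseteq> V" "small_clique E K" "depends_on K g" for K g
      proof -
        have "K \<subseteq> A \<or> K \<subseteq> B"
        proof (rule ccontr)
          assume "\<not> ?thesis"
          then obtain x y where xy: "x \<in> K" "x \<notin> A" "y \<in> K" "y \<notin> B" by blast
          then have yx: "y \<in> A - B" "x \<in> B - A" using K(1) AB(1) by auto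
          then have "K \<in> E" using K(2) xy unfolding small_clique_def by auto
          moreover have "K = {y, x}" using card_edge[OF \<open>K \<in> E\<close>] xy yx unfolding card_2_iff by auto
          ultimately show False using AB(4) yx unfolding touches_def by blast
        qed
        then show ?thesis
          using p(2)[of g] p(3)[of g] p1 p2 K depends_on_mono[OF K(3)] unfolding realizes_def by metis
      qed
      then show ?thesis unfolding realizes_def using p(1) by (intro exI[of _ p]) simp
    next
      case (bipartite a b)
      then show ?thesis using realizable_bipartite[OF w card_edge, of a V b] by blast
    qed
  qed
qed

section \<open>Two-valued functionals\<close>

definition cell_of :: "'v set \<Rightarrow> 'v \<Rightarrow> bool" where
  "cell_of A v \<longleftrightarrow> v \<in> A"

lemma small_clique_card_le_2:
  assumes "\<And>e. e \<in> E \<Longrightarrow> card e = 2" "small_clique E K"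
  shows "finite K" "card K \<le> 2"
  using assms by (auto simp: small_clique_def intro: card_ge_0_finite)

section \<open>Linear relations satisfied by pairwise functions\<close>

text \<open>By linearity one summand on a small clique \<open>K\<close> suffices. Without a crossing
  edge \<open>K\<close> misses \<open>A - B\<close> or \<open>B - A\<close>, and then the four
  values agree in pairs.\<close>

lemma pairwise_sum_modular:
  assumes "pairwise_sum E h" and card2: "\<And>e. e \<in> E \<Longrightarrow> card e = 2"
    and A: "\<not> touches E (A - B) (B - A)"
  shows "h (cell_of (A \<union> B)) + h (cell_of (A \<inter> B)) = h (cell_of A) + h (cell_of B)"
  using assms(1)
proof induction
  case (dep K g)
  have "K \<inter> (A - B) = {} \<or> K \<inter> (B - A) = {}"
  proof (rule ccontr)
    assume "\<not> ?thesis"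
    then obtain x y where xy: "x \<in> K" "x \<in> A - B" "y \<in> K" "y \<in> B - A" by blast
    then have "K \<in> E" using dep(1) unfolding small_clique_def by auto
    moreover have "K = {x, y}" using card2[OF \<open>K \<in> E\<close>] xy unfolding card_2_iff by auto
    ultimately show False using A xy unfolding touches_def by blast
  qed
  then show ?case
  proof
    assume *: "K \<inter> (A - B) = {}"
    have "g (cell_of (A \<union> B)) = g (cell_of B)" "g (cell_of (A \<inter> B)) = g (cell_of A)"
      by (rule depends_onD[OF dep(2)]; use * in \<open>auto simp: cell_of_def\<close>)+
    then show ?thesis by simp
  next
    assume *: "K \<inter> (B - A) = {}"
    have "g (cell_of (A \<union> B)) = g (cell_of A)" "g (cell_of (A \<inter> B)) = g (cell_of B)"
      by (rule depends_onD[OF dep(2)]; use * in \<open>auto simp: cell_of_def\<close>)+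
    then show ?thesis by simp
  qed
next
  case (add f g)
  then show ?case by simp
next
  case (scale g k)
  then show ?case by (simp flip: distrib_left)
qed

text \<open>The third finite difference of a function of degree two: a clique of at most two
  vertices misses one of three disjoint sets, and toggling that set changes nothing.\<close>

lemma pairwise_sum_third_difference:
  assumes "pairwise_sum E h" and card2: "\<And>e. e \<in> E \<Longrightarrow> card e = 2"
    and disj: "A \<inter> B = {}" "A \<inter> C = {}" "B \<inter> C = {}"
  shows "h (cell_of Y) + h (cell_of (Y \<union> A \<union> B)) + h (cell_of (Y \<union> A \<union> C)) + h (cell_of (Y \<union> B \<union> C)) =
    h (cell_of (Y \<union> A)) + h (cell_of (Y \<union> B)) + h (cell_of (Y \<union> C)) + h (cell_of (Y \<union> A \<union> B \<union> C))"
  using assms(1)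
proof induction
  case (dep K g)
  have "K \<inter> A = {} \<or> K \<inter> B = {} \<or> K \<inter> C = {}"
  proof (rule ccontr)
    assume "\<not> ?thesis"
    then obtain x y z where xyz: "x \<in> K" "x \<in> A" "y \<in> K" "y \<in> B" "z \<in> K" "z \<in> C" by blast
    then have "x \<noteq> y" "x \<noteq> z" "y \<noteq> z" using disj by auto
    then have "card {x, y, z} = 3" by simp
    moreover have "card {x, y, z} \<le> card K"
      using xyz small_clique_card_le_2(1)[OF card2 dep(1)] by (intro card_mono) auto
    ultimately show False using small_clique_card_le_2(2)[OF card2 dep(1)] by simp
  qed
  then consider "K \<inter> A = {}" | "K \<inter> B = {}" | "K \<inter> C = {}" by blast
  then show ?case
  proof cases
    case 1
    have "g (cell_of (Y \<union> A)) = g (cell_of Y)" "g (cell_of (Y \<union> A \<union> B)) = g (cell_of (Y \<union> B))"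
      "g (cell_of (Y \<union> A \<union> C)) = g (cell_of (Y \<union> C))" "g (cell_of (Y \<union> A \<union> B \<union> C)) = g (cell_of (Y \<union> B \<union> C))"
      by (rule depends_onD[OF dep(2)]; use 1 in \<open>auto simp: cell_of_def\<close>)+
    then show ?thesis by simp
  next
    case 2
    have "g (cell_of (Y \<union> B)) = g (cell_of Y)" "g (cell_of (Y \<union> A \<union> B)) = g (cell_of (Y \<union> A))"
      "g (cell_of (Y \<union> B \<union> C)) = g (cell_of (Y \<union> C))" "g (cell_of (Y \<union> A \<union> B \<union> C)) = g (cell_of (Y \<union> A \<union> C))"
      by (rule depends_onD[OF dep(2)]; use 2 in \<open>auto simp: cell_of_def\<close>)+
    then show ?thesis by simp
  next
    case 3
    have "g (cell_of (Y \<union> C)) = g (cell_of Y)" "g (cell_of (Y \<union> A \<union> C)) = g (cell_of (Y \<union> A))"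
      "g (cell_of (Y \<union> B \<union> C)) = g (cell_of (Y \<union> B))" "g (cell_of (Y \<union> A \<union> B \<union> C)) = g (cell_of (Y \<union> A \<union> B))"
      by (rule depends_onD[OF dep(2)]; use 3 in \<open>auto simp: cell_of_def\<close>)+
    then show ?thesis by simp
  qed
next
  case (add f g)
  then show ?case by simp
next
  case (scale g k)
  then show ?case by (simp flip: distrib_left)
qed

text \<open>Every face of the marginal polytope is an intersection of facets, so in a compressed
  polytope it can be separated from a given vertex by a two-valued functional.\<close>

definition faces_two_valued :: "'v set set \<Rightarrow> bool" where
  "faces_two_valued E \<longleftrightarrow> (\<forall>f \<iota> \<kappa>. pairwise_sum E f \<longrightarrow> (\<forall>\<eta>. 0 \<le> f \<eta>) \<longrightarrow> 0 < f \<iota> \<longrightarrow> f \<kappa> = 0 \<longrightarrow>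
     (\<exists>h. pairwise_sum E h \<and> (\<forall>\<eta>. h \<eta> = 0 \<or> h \<eta> = h \<iota>) \<and> (\<forall>\<eta>. f \<eta> = 0 \<longrightarrow> h \<eta> = 0) \<and> h \<iota> \<noteq> 0))"

section \<open>The obstructions: K4 minors and long induced cycles\<close>

lemma pairwise_sum_disagree:
  "{a, b} \<in> E \<Longrightarrow> pairwise_sum E (\<lambda>\<iota>. of_bool (\<iota> a \<noteq> \<iota> b))"
  by (rule pairwise_sum.dep[of E "{a, b}"]) (auto simp: small_clique_def depends_on_def)

lemma faces_two_valued_imp_no_K4_minor:
  assumes tv: "faces_two_valued E" and card2: "\<And>e. e \<in> E \<Longrightarrow> card e = 2"
  shows "\<not> K4_minor (E :: 'v::finite set set)"
proof
  assume "K4_minor E"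
  then obtain B :: "nat \<Rightarrow> 'v set" where conn: "\<And>i. i < 4 \<Longrightarrow> connected_in E (B i)"
    and disj: "disjoint_family_on B {0..<4}"
    and adj: "\<And>i j. {i, j} \<in> complete_edges {0..<4} \<Longrightarrow> \<exists>x\<in>B i. \<exists>y\<in>B j. {x, y} \<in> E"
    unfolding has_minor_def by fastforce
  have dj: "B i \<inter> B j = {}" if "i < 4" "j < 4" "i \<noteq> j" for i j
    using disj that unfolding disjoint_family_on_def by auto
  have "\<exists>x y. x \<in> B i \<and> y \<in> B j \<and> {x, y} \<in> E" if "i < 4" "j < 4" "i \<noteq> j" for i j
    using adj[of i j] that by (auto simp: complete_edges_def)
  then obtain u v where uv: "\<And>i j. i < 4 \<Longrightarrow> j < 4 \<Longrightarrow> i \<noteq> j \<Longrightarrow> u i j \<in> B i \<and> v i j \<in> B j \<and> {u i j, v i j} \<in> E"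
    by metis
  have "\<exists>x. x \<in> B i" if "i < 4" for i using conn[OF that] unfolding connected_in_def by blast
  then obtain r where r: "\<And>i. i < 4 \<Longrightarrow> r i \<in> B i" by metis
  define D where "D = {(x, y). {x, y} \<in> E \<and> (\<exists>i<4. x \<in> B i \<and> y \<in> B i)}"
  \<comment> \<open>On cells constant on the branch sets this is 1 - s + s(s - 1)/2 for the number
    \<open>s\<close> of true sets: a representative stands for each set and one connecting edge for
    each pair.\<close>
  define l where "l = (\<lambda>\<iota>. 1 - pr1 (r 0) \<iota> - pr1 (r 1) \<iota> - pr1 (r 2) \<iota> - pr1 (r 3) \<iota>
      + pr2 (u 0 1) (v 0 1) \<iota> + pr2 (u 0 2) (v 0 2) \<iota> + pr2 (u 0 3) (v 0 3) \<iota>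
      + pr2 (u 1 2) (v 1 2) \<iota> + pr2 (u 1 3) (v 1 3) \<iota> + pr2 (u 2 3) (v 2 3) \<iota>)"
  define pen where "pen = (\<lambda>\<iota> :: 'v \<Rightarrow> bool. \<Sum>e\<in>D. of_bool (\<iota> (fst e) \<noteq> \<iota> (snd e)) :: real)"
  \<comment> \<open>Since \<open>l\<close> is at least -3, the weight 4 makes \<open>f\<close>
    positive as soon as one edge inside a branch set is broken.\<close>
  define f where "f = (\<lambda>\<iota>. l \<iota> + 4 * pen \<iota>)"
  have pw: "pairwise_sum E f"
  proof -
    have "pairwise_sum E l" unfolding l_def
      by (intro pairwise_sum_intros; use uv in simp)
    moreover have "pairwise_sum E pen" unfolding pen_def
      by (intro pairwise_sum_sum pairwise_sum_disagree) (auto simp: D_def)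
    ultimately show ?thesis unfolding f_def by (intro pairwise_sum.add pairwise_sum.scale)
  qed
  have blocks: "f \<iota> = 1 - of_bool (\<beta> 0) - of_bool (\<beta> 1) - of_bool (\<beta> 2) - of_bool (\<beta> 3)
      + of_bool (\<beta> 0 \<and> \<beta> 1) + of_bool (\<beta> 0 \<and> \<beta> 2) + of_bool (\<beta> 0 \<and> \<beta> 3)
      + of_bool (\<beta> 1 \<and> \<beta> 2) + of_bool (\<beta> 1 \<and> \<beta> 3) + of_bool (\<beta> 2 \<and> \<beta> 3)"
    if \<beta>: "\<And>i x. i < 4 \<Longrightarrow> x \<in> B i \<Longrightarrow> \<iota> x = \<beta> i" for \<iota> and \<beta> :: "nat \<Rightarrow> bool"
  proof -
    have "\<iota> (fst e) = \<iota> (snd e)" if eD: "e \<in> D" for e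
    proof -
      obtain i where "i < 4" "fst e \<in> B i" "snd e \<in> B i" using eD by (auto simp: D_def)
      then show ?thesis using \<beta> by blast
    qed
    then have "pen \<iota> = 0" unfolding pen_def by simp
    moreover have "\<iota> (r i) = \<beta> i" if "i < 4" for i using \<beta> r that by blast
    moreover have "\<iota> (u i j) = \<beta> i" "\<iota> (v i j) = \<beta> j" if "i < 4" "j < 4" "i \<noteq> j" for i j
      using \<beta> uv[OF that] that by blast+
    ultimately show ?thesis unfolding f_def l_def pr1_def pr2_def by simp
  qed
  have nonneg: "0 \<le> f \<iota>" for \<iota>
  proof (cases "\<exists>e\<in>D. \<iota> (fst e) \<noteq> \<iota> (snd e)")
    case True
    then obtain e where e: "e \<in> D" "\<iota> (fst e) \<noteq> \<iota> (snd e)" by blast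
    have "of_bool (\<iota> (fst e) \<noteq> \<iota> (snd e)) \<le> pen \<iota>"
      unfolding pen_def using e(1) by (intro member_le_sum) auto
    then have "1 \<le> pen \<iota>" using e(2) by simp
    moreover have "-3 \<le> l \<iota>"
    proof -
      have "pr1 x \<iota> \<le> 1" "0 \<le> pr2 x y \<iota>" for x y by (auto simp: pr1_def pr2_def)
      then show ?thesis unfolding l_def by (smt (verit))
    qed
    ultimately show ?thesis unfolding f_def by simp
  next
    case False
    have const: "\<iota> x = \<iota> (r i)" if i: "i < 4" and x: "x \<in> B i" for i x
    proof -
      have "(r i, x) \<in> (edge_rel E (B i))\<^sup>*"
        using conn[OF i] r[OF i] x unfolding connected_in_def by blast
      then show ?thesis
      proof induction
        case (step y z)
        then have "(y, z) \<in> D" using i by (auto simp: D_def)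
        then have "\<iota> y = \<iota> z" using False by fastforce
        then show ?case using step by simp
      qed simp
    qed
    show ?thesis
      by (subst blocks[of \<iota> "\<lambda>i. \<iota> (r i)"]) (erule (1) const, auto simp: of_bool_def)
  qed
  have cell: "cell_of (\<Union>i\<in>I. B i) x = (j \<in> I)" if "I \<subseteq> {..<4}" "j < 4" "x \<in> B j" for I j x
    using that dj by (auto simp: cell_of_def)
  define F where "F = (\<lambda>I. f (cell_of (\<Union>i\<in>I. B i)))"
  have F: "F I = 1 - of_bool (0 \<in> I) - of_bool (1 \<in> I) - of_bool (2 \<in> I) - of_bool (3 \<in> I)
      + of_bool (0 \<in> I \<and> 1 \<in> I) + of_bool (0 \<in> I \<and> 2 \<in> I) + of_bool (0 \<in> I \<and> 3 \<in> I)
      + of_bool (1 \<in> I \<and> 2 \<in> I) + of_bool (1 \<in> I \<and> 3 \<in> I) + of_bool (2 \<in> I \<and> 3 \<in> I)"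
    if "I \<subseteq> {..<4}" for I
    unfolding F_def using blocks[of "cell_of (\<Union>i\<in>I. B i)" "\<lambda>j. j \<in> I"] cell[OF that] by blast
  have "0 < f (cell_of {})" "f (cell_of (B 0)) = 0"
    using F[of "{}"] F[of "{0}"] by (simp_all add: F_def)
  then obtain h where h: "pairwise_sum E h" "\<And>\<eta>. h \<eta> = 0 \<or> h \<eta> = h (cell_of {})"
    "\<And>\<eta>. f \<eta> = 0 \<Longrightarrow> h \<eta> = 0" "h (cell_of {}) \<noteq> 0"
    using tv pw nonneg unfolding faces_two_valued_def by metis
  define H where "H = (\<lambda>I. h (cell_of (\<Union>i\<in>I. B i)))"
  have H0: "H I = 0" if "I \<in> {{0}, {1}, {2}, {3}, {0, 1}, {0, 2}, {0, 3}, {1, 2}, {1, 3}, {2, 3}}" for I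
  proof -
    have "F I = 0" using that F[of I] by auto
    then show ?thesis unfolding F_def H_def by (rule h(3))
  qed
  have third: "H Y + H (Y \<union> {i, j}) + H (Y \<union> {i, k}) + H (Y \<union> {j, k}) =
      H (Y \<union> {i}) + H (Y \<union> {j}) + H (Y \<union> {k}) + H (Y \<union> {i, j, k})"
    if "i < 4" "j < 4" "k < 4" "i \<noteq> j" "i \<noteq> k" "j \<noteq> k" for Y i j k
    using pairwise_sum_third_difference[OF h(1) card2 dj[of i j] dj[of i k] dj[of j k], of "\<Union>i\<in>Y. B i"] that
    by (simp add: H_def Un_ac)
  let ?t = "H {}"
  \<comment> \<open>\<open>H\<close> vanishes on one and two blocks. Third differences at the empty
    set give \<open>?t\<close> on every three blocks, and the one based at {3} then gives three
    times \<open>?t\<close> on all four.\<close>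
  have "H {0, 1, 2} = ?t" using third[of 0 1 2 "{}"] by (simp add: H0)
  moreover have "H {0, 1, 3} = ?t" using third[of 0 1 3 "{}"] by (simp add: H0)
  moreover have "H {0, 2, 3} = ?t" using third[of 0 2 3 "{}"] by (simp add: H0)
  moreover have "H {1, 2, 3} = ?t" using third[of 1 2 3 "{}"] by (simp add: H0)
  moreover have "H {3} + H {0, 1, 3} + H {0, 2, 3} + H {1, 2, 3} = H {0, 3} + H {1, 3} + H {2, 3} + H {0, 1, 2, 3}"
    using third[of 0 1 2 "{3}"] by (simp add: insert_commute)
  ultimately have "H {0, 1, 2, 3} = 3 * ?t" by (simp add: H0)
  moreover have "H {0, 1, 2, 3} = 0 \<or> H {0, 1, 2, 3} = ?t" using h(2) by (simp add: H_def)
  moreover have "?t \<noteq> 0" using h(4) by (simp add: H_def)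
  ultimately show False by simp
qed

text \<open>The cycle inequality: if the ends of a path differ, the value changes somewhere along
  it.\<close>

lemma alternations_triangle:
  fixes x :: "nat \<Rightarrow> bool"
  shows "of_bool (x n \<noteq> x 0) \<le> (\<Sum>i<n. of_bool (x i \<noteq> x (Suc i)) :: real)"
proof (induction n)
  case (Suc n)
  have "of_bool (x (Suc n) \<noteq> x 0) \<le> (of_bool (x n \<noteq> x 0) + of_bool (x n \<noteq> x (Suc n)) :: real)" by auto
  then show ?case using Suc by simp
qed simp

lemma faces_two_valued_imp_short_cycles:
  assumes tv: "faces_two_valued E" and card2: "\<And>e. e \<in> E \<Longrightarrow> card e = 2"
    and cyc: "graph_cycle E vs" and chord: "\<not> cycle_has_chord E vs"
  shows "length vs \<le> 4"
proof (rule ccontr)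
  assume "\<not> length vs \<le> 4"
  define m where "m = length vs"
  then have m: "5 \<le> m" using \<open>\<not> length vs \<le> 4\<close> by simp
  have dist: "distinct vs" and edge: "\<And>i. i < m \<Longrightarrow> {vs ! i, vs ! (Suc i mod m)} \<in> E"
    using cyc unfolding graph_cycle_def m_def by auto
  define C where "C = (\<lambda>J. {vs ! j |j. j \<in> J \<and> j < m})"
  have memC: "cell_of (C J) (vs ! i) \<longleftrightarrow> i \<in> J" if "i < m" for i J
    using that dist unfolding cell_of_def C_def m_def by (auto simp: nth_eq_iff_index_eq)
  have Cset: "C J \<union> C K = C (J \<union> K)" "C J \<inter> C K = C (J \<inter> K)" "C J - C K = C (J - K)" for J K
    using dist unfolding C_def m_def by (auto simp: nth_eq_iff_index_eq)
  have adjC: "\<exists>j\<in>J. \<exists>k\<in>K. j < m \<and> k < m \<and> (k = Suc j \<or> j = Suc k \<or> (j = 0 \<and> k = m - 1) \<or> (k = 0 \<and> j = m - 1))"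
    if touch: "touches E (C J) (C K)" for J K
  proof -
    obtain j k where jk: "j \<in> J" "k \<in> K" "j < m" "k < m" "{vs ! j, vs ! k} \<in> E"
      using touch unfolding touches_def C_def by blast
    then have "k = Suc j mod m \<or> j = Suc k mod m"
      using chord unfolding cycle_has_chord_def m_def by blast
    moreover have "Suc i mod m = (if Suc i = m then 0 else Suc i)" if "i < m" for i
      using that by (simp add: mod_Suc)
    ultimately have "k = Suc j \<or> j = Suc k \<or> (j = 0 \<and> k = m - 1) \<or> (k = 0 \<and> j = m - 1)"
      using jk(3,4) by (auto split: if_splits)
    then show ?thesis using jk by blast
  qed
  \<comment> \<open>The gap in the cycle inequality with the edge from position \<open>m - 1\<close>
    back to 0 singled out. It vanishes on initial and final segments of positions, and is 2 on the
    single position 1.\<close>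
  define f where "f = (\<lambda>\<iota> :: _ \<Rightarrow> bool. (\<Sum>i<m - 1. of_bool (\<iota> (vs ! i) \<noteq> \<iota> (vs ! Suc i))) - of_bool (\<iota> (vs ! (m - 1)) \<noteq> \<iota> (vs ! 0)) :: real)"
  have pw: "pairwise_sum E f"
  proof -
    have "{vs ! i, vs ! Suc i} \<in> E" if "i < m - 1" for i using edge[of i] that by simp
    moreover have "{vs ! (m - 1), vs ! 0} \<in> E" using edge[of "m - 1"] m by simp
    ultimately show ?thesis unfolding f_def
      by (intro pairwise_sum_diff pairwise_sum_sum pairwise_sum_disagree) auto
  qed
  have nonneg: "0 \<le> f \<iota>" for \<iota>
    unfolding f_def using alternations_triangle[of "\<lambda>i. \<iota> (vs ! i)" "m - 1"] by simp
  have fC: "f (cell_of (C J)) = (\<Sum>i<m - 1. of_bool ((i \<in> J) \<noteq> (Suc i \<in> J))) - of_bool ((m - 1 \<in> J) \<noteq> (0 \<in> J))" for J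
  proof -
    have "(\<Sum>i<m - 1. of_bool (cell_of (C J) (vs ! i) \<noteq> cell_of (C J) (vs ! Suc i)) :: real)
        = (\<Sum>i<m - 1. of_bool ((i \<in> J) \<noteq> (Suc i \<in> J)))"
      by (rule sum.cong) (auto simp: memC)
    then show ?thesis unfolding f_def using m by (simp add: memC)
  qed
  have one: "(\<Sum>i<m - 1. of_bool (i = k) :: real) = 1" if "k < m - 1" for k
    using that by (simp add: of_bool_def)
  have "f (cell_of (C {1})) = 2"
  proof -
    have "(\<Sum>i<m - 1. of_bool ((i \<in> {1}) \<noteq> (Suc i \<in> {1})) :: real)
        = (\<Sum>i<m - 1. of_bool (i = 1) + of_bool (i = 0))"
      by (rule sum.cong) auto
    then show ?thesis unfolding fC using one[of 1] one[of 0] m by (simp add: sum.distrib)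
  qed
  then have pos: "0 < f (cell_of (C {1}))" by simp
  have z1: "f (cell_of (C {})) = 0" unfolding fC by simp
  have z2: "f (cell_of (C {..<m})) = 0"
  proof -
    have "(\<Sum>i<m - 1. of_bool ((i \<in> {..<m}) \<noteq> (Suc i \<in> {..<m})) :: real) = 0"
      by (rule sum.neutral) auto
    then show ?thesis unfolding fC using m by simp
  qed
  have z3: "f (cell_of (C {..k})) = 0" if k: "k < m - 1" for k
  proof -
    have "(\<Sum>i<m - 1. of_bool ((i \<in> {..k}) \<noteq> (Suc i \<in> {..k})) :: real) = (\<Sum>i<m - 1. of_bool (i = k))"
      by (rule sum.cong) auto
    then show ?thesis unfolding fC using one[OF k] k by simp
  qed
  have z4: "f (cell_of (C {k..<m})) = 0" if k: "0 < k" "k < m" for k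
  proof -
    have "(\<Sum>i<m - 1. of_bool ((i \<in> {k..<m}) \<noteq> (Suc i \<in> {k..<m})) :: real) = (\<Sum>i<m - 1. of_bool (i = k - 1))"
      by (rule sum.cong) (use k in auto)
    then show ?thesis unfolding fC using one[of "k - 1"] k by simp
  qed
  obtain h where h: "pairwise_sum E h" "\<And>\<eta>. h \<eta> = 0 \<or> h \<eta> = h (cell_of (C {1}))"
    "\<And>\<eta>. f \<eta> = 0 \<Longrightarrow> h \<eta> = 0" "h (cell_of (C {1})) \<noteq> 0"
    using tv pw nonneg pos z1 unfolding faces_two_valued_def by metis
  define H where "H = (\<lambda>J. h (cell_of (C J)))"
  have modular: "H (J \<union> K) + H (J \<inter> K) = H J + H K"
    if "\<not> (\<exists>j\<in>J - K. \<exists>k\<in>K - J. j < m \<and> k < m \<and> (k = Suc j \<or> j = Suc k \<or> (j = 0 \<and> k = m - 1) \<or> (k = 0 \<and> j = m - 1)))"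
    for J K
    using pairwise_sum_modular[OF h(1) card2, of "C J" "C K"] adjC[of "J - K" "K - J"] that
    unfolding H_def Cset by blast
  have zero: "H {} = 0" "H {..<m} = 0" "H {..1} = 0" "H {..3} = 0" "H {1..<m} = 0" "H {3..<m} = 0"
    unfolding H_def using m by (intro h(3) z1 z2 z3 z4; simp)+
  \<comment> \<open>All positions but 2. The modular relations link \<open>H {1}\<close> and
    \<open>H {3}\<close> to \<open>H ?R\<close> through segments on which \<open>H\<close> vanishes;
    equal as they are, they add up to twice \<open>H {1}\<close> on the two positions
    together.\<close>
  let ?R = "{..1} \<union> {3..<m}"
  have "H ({1} \<union> {3}) + H ({1} \<inter> {3}) = H {1} + H {3}" using m by (intro modular) auto
  then have 1: "H ({1} \<union> {3}) = H {1} + H {3}" using zero by simp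
  have "H ({1} \<union> {3..<m}) + H ({1} \<inter> {3..<m}) = H {1} + H {3..<m}" using m by (intro modular) auto
  then have 2: "H ({1} \<union> {3..<m}) = H {1}" using zero by simp
  have "H ({1..<m} \<union> ?R) + H ({1..<m} \<inter> ?R) = H {1..<m} + H ?R" using m by (intro modular) auto
  moreover have "{1..<m} \<union> ?R = {..<m}" "{1..<m} \<inter> ?R = {1} \<union> {3..<m}" using m by auto
  ultimately have 3: "H ({1} \<union> {3..<m}) = H ?R" using zero by simp
  have "H ({..3} \<union> ?R) + H ({..3} \<inter> ?R) = H {..3} + H ?R" using m by (intro modular) auto
  moreover have "{..3} \<union> ?R = {..<m}" "{..3} \<inter> ?R = {..1} \<union> {3}" using m by auto
  ultimately have 4: "H ({..1} \<union> {3}) = H ?R" using zero by simp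
  have "H ({..1} \<union> {3}) + H ({..1} \<inter> {3}) = H {..1} + H {3}" using m by (intro modular) auto
  then have 5: "H ({..1} \<union> {3}) = H {3}" using zero by simp
  have "H ({1} \<union> {3}) = 2 * H {1}" using 1 2 3 4 5 by simp
  moreover have "H ({1} \<union> {3}) = 0 \<or> H ({1} \<union> {3}) = H {1}" unfolding H_def by (rule h(2))
  moreover have "H {1} \<noteq> 0" using h(4) unfolding H_def .
  ultimately show False by simp
qed

section \<open>Binary graph models\<close>

locale binary_graph_model =
  fixes \<Delta> :: "'n::finite set set" and d :: "'n \<Rightarrow> bool set"
  assumes graph: "graph_on UNIV \<Delta>" and binary: "d = (\<lambda>_. UNIV)"
begin

abbreviation "E \<equiv> sc_edges \<Delta>"
abbreviation "L \<equiv> marginal_lattice \<Delta> d"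
abbreviation "P \<equiv> marginal_polytope \<Delta> d"

section \<open>Columns, lattice points and linear functionals\<close>

definition col :: "('n \<Rightarrow> bool) \<Rightarrow> real ^ ('n set \<times> ('n \<Rightarrow> bool))" where
  "col \<iota> = column \<iota> (marginal_matrix \<Delta> d)"

lemma card_edge: "e \<in> E \<Longrightarrow> card e = 2"
  by (simp add: sc_edges_def)

lemma cells_eq: "cells d = UNIV"
  by (simp add: cells_def binary)

lemma restrict_mem_rows: "(T, restrict \<iota> T) \<in> marginal_rows \<Delta> d \<longleftrightarrow> T \<in> sc_facets \<Delta>"
  by (auto simp: marginal_rows_def binary)

lemma col_nth: "col \<iota> $ r = (if fst r \<in> sc_facets \<Delta> \<and> restrict \<iota> (fst r) = snd r then 1 else 0)"
  using restrict_mem_rows[of "fst r" \<iota>]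
  by (cases r) (auto simp: col_def column_def marginal_matrix_def cells_eq)

lemma columns_eq: "marginal_columns \<Delta> d = range col"
  by (simp add: marginal_columns_def cells_eq col_def)

lemma polytope_eq: "P = convex hull (range col)"
  by (simp add: marginal_polytope_def columns_eq)

lemma lattice_eq: "L = group_closure (range col)"
  by (simp add: marginal_lattice_def columns_eq)

lemma face_subset_facet:
  assumes "S \<in> \<Delta>"
  obtains T where "T \<in> sc_facets \<Delta>" "S \<subseteq> T"
proof -
  obtain T where T: "T \<in> \<Delta>" "S \<subseteq> T" "\<And>U. U \<in> \<Delta> \<Longrightarrow> T \<subseteq> U \<Longrightarrow> U = T"
    using finite_has_maximal2[OF finite assms] by metis
  then have "T \<in> sc_facets \<Delta>" by (simp add: sc_facets_def)
  then show thesis using T(2) by (rule that)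
qed

lemma facet_mem: "T \<in> sc_facets \<Delta> \<Longrightarrow> T \<in> \<Delta>"
  by (simp add: sc_facets_def)

lemma face_iff_small_clique: "K \<in> \<Delta> \<longleftrightarrow> small_clique E K"
proof
  assume K: "K \<in> \<Delta>"
  obtain T where T: "T \<in> sc_facets \<Delta>" "K \<subseteq> T" by (rule face_subset_facet[OF K])
  have "card T \<le> 2" using graph T(1) unfolding graph_on_def face_dim_def by fastforce
  then have "card K \<le> 2" using card_mono[OF finite T(2)] by simp
  then consider "card K = 0" | "card K = 1" | "card K = 2" by linarith
  then show "small_clique E K"
    using K by cases (auto simp: small_clique_def sc_edges_def card_1_singleton_iff)
next
  have sub: "T \<in> \<Delta>" if "S \<in> \<Delta>" "T \<subseteq> S" for S T
    using graph that unfolding graph_on_def simplicial_complex_on_def by blast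
  have single: "{v} \<in> \<Delta>" for v using graph unfolding graph_on_def simplicial_complex_on_def by blast
  assume "small_clique E K"
  then show "K \<in> \<Delta>" using single sub[OF single, of "{}"] by (auto simp: small_clique_def sc_edges_def)
qed

lemma depends_on_linear:
  assumes "K \<in> \<Delta>" "depends_on K g"
  shows "\<exists>a. \<forall>\<iota>. g \<iota> = a \<bullet> col \<iota>"
proof -
  obtain T where T: "T \<in> sc_facets \<Delta>" "K \<subseteq> T" by (rule face_subset_facet[OF assms(1)])
  \<comment> \<open>Weight the rows of one facet \<open>T\<close> by \<open>g\<close>; each column
    has exactly one entry 1 among them. The row label is undefined outside \<open>T\<close>, where
    \<open>g\<close> does not look because \<open>K\<close> lies in \<open>T\<close>.\<close>
  define a where "a = (\<chi> r. if fst r = T then g (snd r) else 0)"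
  have "g \<iota> = a \<bullet> col \<iota>" for \<iota>
  proof -
    have "a \<bullet> col \<iota> = (\<Sum>r\<in>UNIV. if r = (T, restrict \<iota> T) then g (restrict \<iota> T) else 0)"
      unfolding inner_vec_def by (rule sum.cong) (auto simp: a_def col_nth T(1))
    also have "\<dots> = g (restrict \<iota> T)" by simp
    also have "\<dots> = g \<iota>" by (rule depends_onD[OF assms(2)]) (use T(2) in auto)
    finally show ?thesis by simp
  qed
  then show ?thesis by blast
qed

lemma pairwise_sum_linear: "pairwise_sum E g \<Longrightarrow> \<exists>a. \<forall>\<iota>. g \<iota> = a \<bullet> col \<iota>"
proof (induction rule: pairwise_sum.induct)
  case (dep K g)
  then show ?case using depends_on_linear face_iff_small_clique by blast
next
  case (add f g)
  then obtain a b where "\<forall>\<iota>. f \<iota> = a \<bullet> col \<iota>" "\<forall>\<iota>. g \<iota> = b \<bullet> col \<iota>" by blast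
  then show ?case by (intro exI[of _ "a + b"]) (simp add: inner_add_left)
next
  case (scale g k)
  then obtain a where "\<forall>\<iota>. g \<iota> = a \<bullet> col \<iota>" by blast
  then show ?case by (intro exI[of _ "k *\<^sub>R a"]) simp
qed

lemma depends_on_col_nth:
  obtains K where "small_clique E K" "depends_on K (\<lambda>\<iota>. col \<iota> $ r)"
proof (cases "fst r \<in> sc_facets \<Delta>")
  case True
  have "depends_on (fst r) (\<lambda>\<iota>. col \<iota> $ r)"
    unfolding depends_on_def
  proof (intro allI impI)
    fix \<iota> \<kappa> :: "'n \<Rightarrow> bool" assume "\<forall>v\<in>fst r. \<iota> v = \<kappa> v"
    then have "restrict \<iota> (fst r) = restrict \<kappa> (fst r)" by (intro restrict_ext) blast
    then show "col \<iota> $ r = col \<kappa> $ r" by (simp add: col_nth)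
  qed
  then show thesis using that face_iff_small_clique facet_mem[OF True] by blast
next
  case False
  then show thesis using that[of "{}"] by (auto simp: small_clique_def depends_on_def col_nth)
qed

lemma pairwise_sum_functional: "pairwise_sum E (\<lambda>\<iota>. a \<bullet> col \<iota>)"
  unfolding inner_vec_def
proof (rule pairwise_sum_sum)
  fix r
  obtain K where "small_clique E K" "depends_on K (\<lambda>\<iota>. col \<iota> $ r)" by (rule depends_on_col_nth)
  then show "pairwise_sum E (\<lambda>\<iota>. (a $ r) \<bullet> (col \<iota> $ r))"
    using pairwise_sum.scale[OF pairwise_sum.dep, of E K _ "a $ r"] by simp
qed simp

lemma columns_subset: "range col \<subseteq> P \<inter> L"
proof
  fix y assume "y \<in> range col"
  then show "y \<in> P \<inter> L"
    unfolding polytope_eq lattice_eq by (intro IntI hull_inc group_closure.base) simp_all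
qed

lemma hull_lattice_points: "convex hull (P \<inter> L) = P"
proof
  show "convex hull (P \<inter> L) \<subseteq> P" by (rule hull_minimal) (auto simp: polytope_eq)
  show "P \<subseteq> convex hull (P \<inter> L)" using hull_mono[OF columns_subset, of convex] by (simp add: polytope_eq)
qed

lemma lattice_scale: "p \<in> L \<Longrightarrow> of_int m *\<^sub>R p \<in> L"
proof -
  assume p: "p \<in> L"
  have nat: "of_nat n *\<^sub>R p \<in> L" for n
    using p unfolding lattice_eq
    by (induction n) (auto simp: scaleR_left_distrib intro: group_closure_add)
  show ?thesis
  proof (cases "0 \<le> m")
    case True
    then show ?thesis using nat[of "nat m"] by simp
  next
    case False
    then have "- (of_nat (nat (- m)) *\<^sub>R p) \<in> L" using nat[of "nat (- m)"] by (simp add: lattice_eq)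
    then show ?thesis using False by simp
  qed
qed

lemma lattice_closed: "p \<in> L \<Longrightarrow> q \<in> L \<Longrightarrow> r \<in> L \<Longrightarrow> p + of_int m *\<^sub>R (q - r) \<in> L"
proof -
  assume "p \<in> L" "q \<in> L" "r \<in> L"
  then have "q - r \<in> L" unfolding lattice_eq by (intro group_closure.diff)
  then have "of_int m *\<^sub>R (q - r) \<in> L" by (rule lattice_scale)
  then show ?thesis using \<open>p \<in> L\<close> unfolding lattice_eq by (intro group_closure_add)
qed

lemma polyhedron_P: "polyhedron P"
  unfolding polytope_eq by (intro polytope_imp_polyhedron polytope_convex_hull) simp

lemma functional_bounds_P:
  assumes "\<And>\<iota>. l \<le> a \<bullet> col \<iota>" "x \<in> P"
  shows "l \<le> a \<bullet> x"
proof -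
  have "P \<subseteq> {x. l \<le> a \<bullet> x}"
    unfolding polytope_eq by (rule hull_minimal) (use assms(1) convex_halfspace_ge[of l a] in auto)
  then show ?thesis using assms(2) by blast
qed

section \<open>From compressed to the graph conditions\<close>

lemma compressed_imp_faces_two_valued:
  assumes comp: "compressed L P"
  shows "faces_two_valued E"
  unfolding faces_two_valued_def
proof (intro allI impI)
  fix f \<iota> \<kappa>
  assume f: "pairwise_sum E f" "\<forall>\<eta>. 0 \<le> f \<eta>" "0 < f \<iota>" "f \<kappa> = 0"
  obtain a where a: "\<And>\<eta>. f \<eta> = a \<bullet> col \<eta>" using pairwise_sum_linear[OF f(1)] by blast
  let ?G = "P \<inter> {x. a \<bullet> x = 0}"
  have colP: "col \<eta> \<in> P" and colX: "col \<eta> \<in> P \<inter> L" for \<eta> using columns_subset by auto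
  have G: "?G face_of P"
    by (rule face_of_Int_supporting_hyperplane_ge) (use f(2) a functional_bounds_P in \<open>auto simp: polytope_eq\<close>)
  \<comment> \<open>A polyhedron's face is the intersection of the facets containing it only if it
    is nonempty and proper: the zero \<kappa> and the positive cell \<iota> provide this.\<close>
  have "col \<kappa> \<in> ?G" using colP a f(4) by auto
  moreover have \<iota>: "col \<iota> \<notin> ?G" using a[of \<iota>] f(3) by auto
  ultimately have "?G = \<Inter>{H. H facet_of P \<and> ?G \<subseteq> H}"
    using face_of_polyhedron[OF polyhedron_P G] colP[of \<iota>] by blast
  then obtain H where H: "H facet_of P" "?G \<subseteq> H" "col \<iota> \<notin> H" using \<iota> by blast
  have "H exposed_face_of P"
    using exposed_face_of_polyhedron[OF polyhedron_P] facet_of_imp_face_of[OF H(1)] by blast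
  then obtain c b where cb: "P \<subseteq> {x. c \<bullet> x \<le> b}" "H = P \<inter> {x. c \<bullet> x = b}"
    unfolding exposed_face_of_def by blast
  define h where "h = (\<lambda>\<eta>. b - c \<bullet> col \<eta>)"
  have "pairwise_sum E h" unfolding h_def by (intro pairwise_sum_intros pairwise_sum_functional)
  moreover have lt: "c \<bullet> col \<iota> < b" using cb H(3) colP[of \<iota>] by force
  moreover have "h \<eta> = 0 \<or> h \<eta> = h \<iota>" for \<eta>
  proof (cases "c \<bullet> col \<eta> = b")
    case False
    then have "c \<bullet> col \<eta> < b" using cb(1) colP[of \<eta>] by force
    then have "c \<bullet> col \<eta> = c \<bullet> col \<iota>"
      using compressed_facet_two_valued[OF comp finite_marginal_lattice_points hull_lattice_points cb(1)]
        H(1) cb(2) colX lt by simp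
    then show ?thesis by (simp add: h_def)
  qed (simp add: h_def)
  moreover have "h \<eta> = 0" if "f \<eta> = 0" for \<eta>
  proof -
    have "col \<eta> \<in> H" using H(2) that a[of \<eta>] colP[of \<eta>] by auto
    then show ?thesis using cb(2) by (simp add: h_def)
  qed
  ultimately show "\<exists>h. pairwise_sum E h \<and> (\<forall>\<eta>. h \<eta> = 0 \<or> h \<eta> = h \<iota>) \<and>
      (\<forall>\<eta>. f \<eta> = 0 \<longrightarrow> h \<eta> = 0) \<and> h \<iota> \<noteq> 0"
    by (intro exI[of _ h]) (simp add: h_def)
qed

section \<open>From the graph conditions to width one\<close>

lemma affine_hull_signed_weights:
  assumes "x \<in> affine hull P"
  obtains w where "(\<Sum>\<iota>\<in>UNIV. w \<iota>) = 1" "x = (\<Sum>\<iota>\<in>UNIV. w \<iota> *\<^sub>R col \<iota>)"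
proof -
  have "x \<in> affine hull (range col)" using assms by (simp add: polytope_eq)
  then obtain v where v: "sum v (range col) = 1" "(\<Sum>y\<in>range col. v y *\<^sub>R y) = x"
    by (auto simp: affine_hull_finite)
  \<comment> \<open>Each coefficient is put on one representative cell of its column, so that a
    column shared by several cells is counted once.\<close>
  define rep where "rep = inv col"
  define w where "w = (\<lambda>\<iota>. if \<iota> \<in> rep ` range col then v (col \<iota>) else 0)"
  have rep: "col (rep y) = y" if "y \<in> range col" for y unfolding rep_def using that by (simp add: f_inv_into_f)
  have inj: "inj_on rep (range col)" by (rule inj_on_inverseI[of _ col]) (rule rep)
  have sum_w: "(\<Sum>\<iota>\<in>UNIV. w \<iota> *\<^sub>R g (col \<iota>)) = (\<Sum>y\<in>range col. v y *\<^sub>R g y)"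
    for g :: "_ \<Rightarrow> 'z::real_vector"
  proof -
    have "(\<Sum>\<iota>\<in>UNIV. w \<iota> *\<^sub>R g (col \<iota>)) = (\<Sum>\<iota>\<in>rep ` range col. v (col \<iota>) *\<^sub>R g (col \<iota>))"
      by (rule sum.mono_neutral_cong_right) (auto simp: w_def)
    also have "\<dots> = (\<Sum>y\<in>range col. v (col (rep y)) *\<^sub>R g (col (rep y)))"
      by (simp add: sum.reindex[OF inj])
    also have "\<dots> = (\<Sum>y\<in>range col. v y *\<^sub>R g y)" by (rule sum.cong) (simp_all add: rep)
    finally show ?thesis .
  qed
  show thesis
  proof (rule that[of w])
    show "(\<Sum>\<iota>\<in>UNIV. w \<iota>) = 1" using sum_w[of "\<lambda>_. 1 :: real"] v(1) by simp
    show "x = (\<Sum>\<iota>\<in>UNIV. w \<iota> *\<^sub>R col \<iota>)" using sum_w[of "\<lambda>y. y"] v(2) by simp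
  qed
qed

text \<open>Write \<open>x\<close> as a signed combination of columns. Realizability replaces the
  signs by a nonnegative weight with the same expectations on small cliques, and every coordinate of
  \<open>col\<close> is a function on such a clique.\<close>

lemma mem_polytopeI:
  assumes short: "short_cycle_graph E" and x: "x \<in> affine hull P"
    and pos: "\<And>a. (\<And>\<iota>. a \<bullet> col \<iota> = 0 \<or> a \<bullet> col \<iota> = 1) \<Longrightarrow> 0 \<le> a \<bullet> x"
  shows "x \<in> P"
proof -
  obtain w where w: "(\<Sum>\<iota>\<in>UNIV. w \<iota>) = 1" "x = (\<Sum>\<iota>\<in>UNIV. w \<iota> *\<^sub>R col \<iota>)"
    by (rule affine_hull_signed_weights[OF x])
  have "binary_nonneg E w" unfolding binary_nonneg_def
  proof (intro allI impI)
    fix g assume g: "pairwise_sum E g" "\<forall>\<iota>. g \<iota> \<in> {0, 1}"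
    obtain a where a: "\<And>\<iota>. g \<iota> = a \<bullet> col \<iota>" using pairwise_sum_linear[OF g(1)] by blast
    have "0 \<le> a \<bullet> x" by (rule pos) (use g(2) a in auto)
    also have "a \<bullet> x = expect w g" by (simp add: w(2) expect_def inner_sum_right a)
    finally show "0 \<le> expect w g" .
  qed
  then obtain p where "realizes E UNIV w p" using realizable[OF short] by blast
  then have p: "\<And>\<iota>. 0 \<le> p \<iota>" "\<And>K g. small_clique E K \<Longrightarrow> depends_on K g \<Longrightarrow> expect p g = expect w g"
    unfolding realizes_def by auto
  have "x $ r = (\<Sum>\<iota>\<in>UNIV. p \<iota> *\<^sub>R col \<iota>) $ r" for r
  proof -
    obtain K where K: "small_clique E K" "depends_on K (\<lambda>\<iota>. col \<iota> $ r)" by (rule depends_on_col_nth)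
    show ?thesis using p(2)[OF K] by (simp add: w(2) expect_def)
  qed
  then have "x = (\<Sum>\<iota>\<in>UNIV. p \<iota> *\<^sub>R col \<iota>)" by (simp add: vec_eq_iff)
  moreover have "(\<Sum>\<iota>\<in>UNIV. p \<iota>) = 1"
    using p(2)[of "{}" "\<lambda>_. 1"] w(1) by (simp add: small_clique_def depends_on_def expect_def)
  moreover have "(\<Sum>\<iota>\<in>UNIV. p \<iota> *\<^sub>R col \<iota>) \<in> P"
    using p(1) columns_subset \<open>(\<Sum>\<iota>\<in>UNIV. p \<iota>) = 1\<close>
    by (intro convex_sum) (auto simp: polytope_eq)
  ultimately show ?thesis by simp
qed

text \<open>If no binary functional cut out the facet, a point in its relative interior could be pushed out
  of the polytope without violating any of the finitely many binary inequalities.\<close>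

lemma facet_binary_functional:
  assumes short: "short_cycle_graph E" and F: "F facet_of P"
  obtains a where "\<And>\<iota>. a \<bullet> col \<iota> = 0 \<or> a \<bullet> col \<iota> = 1" "F = P \<inter> {x. a \<bullet> x = 0}"
proof -
  have face: "F face_of P" and "F \<noteq> {}" and dim: "aff_dim F = aff_dim P - 1"
    using F by (simp_all add: facet_of_def)
  have convP: "convex P" by (simp add: polytope_eq)
  have "rel_interior F \<noteq> {}"
    using \<open>F \<noteq> {}\<close> face_of_imp_convex[OF face] by (simp add: rel_interior_eq_empty)
  then obtain z where z: "z \<in> rel_interior F" by blast
  then have zF: "z \<in> F" using rel_interior_subset by blast
  then have zP: "z \<in> P" using face_of_imp_subset[OF face] by blast
  have "F \<noteq> P" using dim by auto
  then obtain q where q: "q \<in> P" "q \<notin> F" using face_of_imp_subset[OF face] by blast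
  define bin where "bin = (\<lambda>a. \<forall>\<iota>. a \<bullet> col \<iota> = 0 \<or> a \<bullet> col \<iota> = 1)"
  have bounds: "0 \<le> a \<bullet> x" "a \<bullet> x \<le> 1" if "bin a" "x \<in> P" for a x
  proof -
    have "0 \<le> a \<bullet> col \<iota>" "-1 \<le> (- a) \<bullet> col \<iota>" for \<iota>
      using that(1)[unfolded bin_def, rule_format, of \<iota>] by auto
    then show "0 \<le> a \<bullet> x" "a \<bullet> x \<le> 1"
      using functional_bounds_P[of 0 a x] functional_bounds_P[of "-1" "- a" x] that(2) by auto
  qed
  have zero: "a \<bullet> x = 0" if "P \<subseteq> {x. a \<bullet> x = 0}" "x \<in> affine hull P" for a x
    using hull_minimal[OF that(1), of affine] affine_hyperplane[of a 0] that(2) by blast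
  have "\<exists>a. bin a \<and> a \<bullet> z = 0 \<and> \<not> P \<subseteq> {x. a \<bullet> x = 0}"
  proof (rule ccontr)
    assume neg: "\<not> ?thesis"
    define \<Z> where "\<Z> = {a \<bullet> z | a. bin a \<and> 0 < a \<bullet> z}"
    obtain w where w: "z = (\<Sum>\<iota>\<in>UNIV. w \<iota> *\<^sub>R col \<iota>)"
      using affine_hull_signed_weights[of z] zP by (metis hull_inc)
    \<comment> \<open>A binary functional takes at \<open>z\<close> the sum of \<open>w\<close> over
      the cells where it equals 1, so only finitely many values occur.\<close>
    have "\<Z> \<subseteq> (\<lambda>A. \<Sum>\<iota>\<in>A. w \<iota>) ` UNIV"
    proof
      fix y assume "y \<in> \<Z>"
      then obtain a where a: "y = a \<bullet> z" "bin a" unfolding \<Z>_def by blast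
      have "y = (\<Sum>\<iota>\<in>UNIV. w \<iota> * (a \<bullet> col \<iota>))" unfolding a(1) by (subst w) (simp add: inner_sum_right)
      also have "\<dots> = (\<Sum>\<iota>\<in>{\<iota>. a \<bullet> col \<iota> = 1}. w \<iota>)"
        by (rule sum.mono_neutral_cong_right) (use a(2) in \<open>auto simp: bin_def\<close>)
      finally show "y \<in> (\<lambda>A. \<Sum>\<iota>\<in>A. w \<iota>) ` UNIV" by blast
    qed
    then have fin: "finite \<Z>" by (rule finite_subset) simp
    \<comment> \<open>The extra 1 covers the case that no binary functional is positive at
      \<open>z\<close>.\<close>
    define \<epsilon> where "\<epsilon> = Min (insert 1 \<Z>)"
    have "\<epsilon> \<in> insert 1 \<Z>" unfolding \<epsilon>_def using fin by (intro Min_in) auto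
    then have \<epsilon>: "0 < \<epsilon>" unfolding \<Z>_def by auto
    \<comment> \<open>Overshooting from \<open>q\<close> past \<open>z\<close> lowers a binary
      functional by at most \<epsilon>, as its value at \<open>q\<close> is at most 1 and at
      \<open>z\<close> nonnegative.\<close>
    define y where "y = z + \<epsilon> *\<^sub>R (z - q)"
    have "y \<in> affine hull P" unfolding y_def using zP q(1)
      by (intro mem_affine_3_minus) (auto simp: affine_affine_hull hull_inc)
    have "y \<in> P"
    proof (rule mem_polytopeI[OF short \<open>y \<in> affine hull P\<close>])
      fix a assume "\<And>\<iota>. a \<bullet> col \<iota> = 0 \<or> a \<bullet> col \<iota> = 1"
      then have a: "bin a" unfolding bin_def by blast
      show "0 \<le> a \<bullet> y"
      proof (cases "a \<bullet> z = 0")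
        case True
        then have "P \<subseteq> {x. a \<bullet> x = 0}" using neg a by blast
        then show ?thesis using zero \<open>y \<in> affine hull P\<close> by simp
      next
        case False
        then have az: "0 < a \<bullet> z" using bounds(1)[OF a zP] by simp
        then have "\<epsilon> \<le> a \<bullet> z" unfolding \<epsilon>_def using fin a by (intro Min_le) (auto simp: \<Z>_def)
        moreover have "\<epsilon> * (a \<bullet> q) \<le> \<epsilon> * 1" using \<epsilon> bounds(2)[OF a q(1)] by (intro mult_left_mono) auto
        moreover have "0 \<le> \<epsilon> * (a \<bullet> z)" using \<epsilon> az by simp
        ultimately show ?thesis by (simp add: y_def inner_add_right inner_diff_right algebra_simps)
      qed
    qed
    moreover have "z \<in> open_segment q y"
    proof -
      have zq: "z \<noteq> q" using zF q(2) by blast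
      have yq: "y - q = (1 + \<epsilon>) *\<^sub>R (z - q)" by (simp add: y_def algebra_simps)
      then have "q \<noteq> y" using zq \<epsilon> by auto
      moreover have "z = (1 - 1 / (1 + \<epsilon>)) *\<^sub>R q + (1 / (1 + \<epsilon>)) *\<^sub>R y"
      proof -
        have "(1 - 1 / (1 + \<epsilon>)) *\<^sub>R q + (1 / (1 + \<epsilon>)) *\<^sub>R y = q + (1 / (1 + \<epsilon>)) *\<^sub>R (y - q)"
          by (simp add: algebra_simps)
        also have "\<dots> = z" unfolding yq using \<epsilon> by simp
        finally show ?thesis by simp
      qed
      moreover have "0 < 1 / (1 + \<epsilon>)" "1 / (1 + \<epsilon>) < 1" using \<epsilon> by auto
      ultimately show ?thesis unfolding in_segment(2) by blast
    qed
    \<comment> \<open>\<open>z\<close> would lie strictly between two points of the polytope, and a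
      face containing \<open>z\<close> contains both of them.\<close>
    ultimately have "q \<in> F" using face q(1) zF unfolding face_of_def by blast
    then show False using q(2) by blast
  qed
  then obtain a where a: "bin a" "a \<bullet> z = 0" "\<not> P \<subseteq> {x. a \<bullet> x = 0}" by blast
  let ?F = "P \<inter> {x. a \<bullet> x = 0}"
  have faceF': "?F face_of P"
    by (rule face_of_Int_supporting_hyperplane_ge[OF convP]) (use bounds(1)[OF a(1)] in auto)
  have sub: "F \<subseteq> ?F"
    \<comment> \<open>A face that meets the relative interior of \<open>F\<close> contains all of
      \<open>F\<close>.\<close>
    by (rule subset_of_face_of[OF faceF' face_of_imp_subset[OF face]]) (use z zP a(2) in auto)
  have "F = ?F"
  proof (rule ccontr)
    assume ne: "F \<noteq> ?F"
    have "F face_of ?F" by (rule face_of_subset[OF face sub]) auto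
    then have "aff_dim F < aff_dim ?F"
      by (rule face_of_aff_dim_lt[OF face_of_imp_convex[OF faceF'] _ ne])
    moreover have "aff_dim ?F < aff_dim P"
      by (rule face_of_aff_dim_lt[OF convP faceF']) (use a(3) in blast)
    ultimately show False using dim by simp
  qed
  then show thesis using that a(1) unfolding bin_def by blast
qed

text \<open>A 0/1 functional on the columns is integral on the lattice they generate and lies
  between 0 and 1 on their hull, so a lattice point off the facet has level exactly 1.\<close>

lemma width_one_lattice_points:
  assumes short: "short_cycle_graph E"
  shows "width_one (P \<inter> L) L"
  unfolding width_one_def hull_lattice_points
proof (intro allI impI)
  fix F assume "F facet_of P"
  then obtain a where a: "\<And>\<iota>. a \<bullet> col \<iota> = 0 \<or> a \<bullet> col \<iota> = 1" and F: "F = P \<inter> {x. a \<bullet> x = 0}"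
    by (rule facet_binary_functional[OF short]) (rule that)
  have int: "a \<bullet> p \<in> \<int>" if "p \<in> L" for p
    using that unfolding lattice_eq
  proof (induction rule: group_closure.induct)
    case (base s)
    then show ?case using a by (auto; metis Ints_0 Ints_1)
  next
    case (diff s t)
    then show ?case by (simp add: inner_diff_right)
  qed
  have "a \<bullet> x = 1" if x: "x \<in> P \<inter> L - F" for x
  proof -
    have "0 \<le> a \<bullet> col \<iota>" "-1 \<le> (- a) \<bullet> col \<iota>" for \<iota> using a[of \<iota>] by auto
    then have "0 \<le> a \<bullet> x" "a \<bullet> x \<le> 1"
      using functional_bounds_P[of 0 a x] functional_bounds_P[of "-1" "- a" x] x by auto
    moreover obtain k where k: "a \<bullet> x = of_int k" using int[of x] x by (auto elim: Ints_cases)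
    moreover have "a \<bullet> x \<noteq> 0" using x F by auto
    ultimately show ?thesis by auto
  qed
  then show "\<exists>a b. F = P \<inter> {x. a \<bullet> x = b} \<and> (\<forall>x\<in>P \<inter> L - F. a \<bullet> x = b + 1) \<and> (\<forall>p\<in>L. a \<bullet> p - b \<in> \<int>)"
    using F int by (intro exI[of _ a] exI[of _ 0]) auto
qed

theorem compressed_iff:
  "compressed L P \<longleftrightarrow> short_cycle_graph E"
proof
  assume "compressed L P"
  then have tv: "faces_two_valued E" by (fact compressed_imp_faces_two_valued)
  show "short_cycle_graph E"
    using card_edge faces_two_valued_imp_no_K4_minor[OF tv] faces_two_valued_imp_short_cycles[OF tv]
    by unfold_locales blast+
next
  assume "short_cycle_graph E"
  then show "compressed L P"
    using columns_subset
    by (intro width_one_imp_compressed hull_lattice_points width_one_lattice_points lattice_closed) auto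
qed

end

theorem theorem5p10:
  fixes \<Delta> :: "'n::finite set set" and d :: "'n \<Rightarrow> bool set"
  assumes "graph_on UNIV \<Delta>"
    and "d = (\<lambda>_. UNIV)"
  shows "compressed (marginal_lattice \<Delta> d) (marginal_polytope \<Delta> d) \<longleftrightarrow>
    \<not> has_K4_minor \<Delta> \<and> (\<forall>vs. induced_cycle \<Delta> vs \<longrightarrow> length vs \<le> 4)"
proof -
  interpret binary_graph_model \<Delta> d using assms by unfold_locales
  have "{v} \<in> \<Delta>" for v
    using assms(1) unfolding graph_on_def simplicial_complex_on_def by simp
  \<comment> \<open>\<open>has_K4_minor\<close> takes its vertices from the union of the complex,
    the locale from the whole type.\<close>
  then have "\<Union>\<Delta> = UNIV" by auto
  then have "short_cycle_graph (sc_edges \<Delta>) \<longleftrightarrow>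
      \<not> has_K4_minor \<Delta> \<and> (\<forall>vs. induced_cycle \<Delta> vs \<longrightarrow> length vs \<le> 4)"
    using card_edge unfolding short_cycle_graph_def has_K4_minor_def induced_cycle_def by auto
  then show ?thesis using compressed_iff by simp
qed

end
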